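(* There exists an absolute constant $c>0$ such that for every $\varepsilon>0$ there is a constant $K(\varepsilon)>0$ with the following property. For every prime $p$, every non-principal multiplicative character $\chi$ modulo $p$, all positive integers $A,B,C,D$ with $$p>ABC\ge p^{1/2+\varepsilon}\quad\text{and}\quad D\ge p^{\varepsilon},$$ every set $\mathcal D\subseteq\mathbb F_p^*$ of cardinality $\sharp\mathcal D=D$, and all complex weights $\boldsymbol\alpha=(\alpha_d)_{d\in\mathcal D}$ satisfying $|\alpha_d|\le 1$ for $d\in\mathcal D$, one has $$T_\chi(A,B,C,\mathcal D;\boldsymbol\alpha)\le K(\varepsilon)\,ABCD\,p^{-c\varepsilon^2},$$ where $$T_\chi(A,B,C,\mathcal D;\boldsymbol\alpha)=\sum_{1\le a\le A}\ \sum_{1\le b\le B}\ \sum_{1\le c'\le C}\left|\sum_{d\in\mathcal D}\alpha_d\,\chi(ab-c'd)\right|.$$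
   Context: $\mathbb F_p^*$ is identified with the set of integers $\{1,2,\ldots,p-1\}$. A multiplicative character $\chi$ modulo $p$ is viewed as a function on $\mathbb Z$ (Dirichlet character), with $\chi(n)=0$ when $p\mid n$. *)

theory Defs
  imports Complex_Main "HOL-Computational_Algebra.Primes"
begin

definition dirichlet_character :: "nat \<Rightarrow> (int \<Rightarrow> complex) \<Rightarrow> bool" where
  "dirichlet_character m \<chi> \<longleftrightarrow>
     (\<forall>x y. \<chi> (x * y) = \<chi> x * \<chi> y) \<and>
     (\<forall>x. \<chi> (x + int m) = \<chi> x) \<and>
     (\<forall>x. \<chi> x = 0 \<longleftrightarrow> \<not> coprime x (int m))"

definition principal_character :: "nat \<Rightarrow> int \<Rightarrow> complex" where
  "principal_character m = (\<lambda>x. if coprime x (int m) then 1 else 0)"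

(* The set of residues is represented by integers, here a subset of {1..p-1};
   the values of the weight function outside this set are irrelevant. *)
definition T_sum ::
  "(int \<Rightarrow> complex) \<Rightarrow> nat \<Rightarrow> nat \<Rightarrow> nat \<Rightarrow> int set \<Rightarrow> (int \<Rightarrow> complex) \<Rightarrow> real" where
  "T_sum \<chi> A B C \<D> \<alpha> =
     (\<Sum>a=1..A. \<Sum>b=1..B. \<Sum>c=1..C.
        cmod (\<Sum>d\<in>\<D>. \<alpha> d * \<chi> (int a * int b - int c * d)))"

end

theory Submission
  imports Defs "HOL-Algebra.Algebraic_Closure_Type" "HOL-Number_Theory.Residues" "HOL-Analysis.Convex"
begin

text \<open>
  Since \<open>C < p\<close>, every \<open>c \<le> C\<close> is invertible modulo \<open>p\<close>, so the inner sum of \<open>T\<^sub>\<chi>\<close> has the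
  absolute value of \<open>W(x) = \<Sum>\<^sub>d \<alpha>\<^sub>d \<chi>(x - d)\<close> at \<open>x = a b / c\<close>. Thus
  \<open>T\<^sub>\<chi> = \<Sum>\<^sub>x \<nu>(x) \<bar>W(x)\<bar>\<close> with \<open>\<nu>(x)\<close> the number of triples whose quotient is \<open>x\<close>, and
  Hoelder's inequality (\<open>hoelder_second_moment\<close>) bounds \<open>T\<^sub>\<chi>\<^sup>2\<^sup>r\<close> by
  \<open>(ABC)\<^sup>2\<^sup>r\<^sup>-\<^sup>2 (\<Sum> \<nu>\<^sup>2) (\<Sum> \<bar>W\<bar>\<^sup>2\<^sup>r)\<close>.
  The second factor counts solutions of \<open>a b c' = a' b' c\<close> modulo \<open>p\<close>; both sides are at most
  \<open>ABC < p\<close>, so the congruence is an equality of integers, and the divisor bound gives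
  \<open>ABC\<close> up to an arbitrarily small power of \<open>p\<close>. In the third factor one
  expands the power: tuples of elements of \<open>\<D>\<close> in which every entry is repeated number
  \<open>O(D\<^sup>r)\<close>, and for all others the complete sum over \<open>x\<close> is \<open>O(\<surd>p)\<close> by Weil
  (\<open>moment_bound\<close>). Hence
  \<open>T\<^sub>\<chi>\<^sup>2\<^sup>r \<lless> (ABCD)\<^sup>2\<^sup>r p\<^sup>o\<^sup>(\<^sup>1\<^sup>) (p D\<^sup>-\<^sup>r + \<surd>p) / (ABC)\<close>. With \<open>r\<close> about \<open>1 / (2 \<epsilon>)\<close> one
  has \<open>D\<^sup>r \<ge> \<surd>p\<close>, the last quotient is essentially \<open>p\<close> to the power \<open>- \<epsilon>\<close>, and taking the
  \<open>2 r\<close>-th root leaves a saving of order \<open>\<epsilon>\<^sup>2\<close> in the exponent.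

  The bulk of the work is the Weil bound for sums \<open>\<Sum> \<chi>(f(x))\<close> in which some root of \<open>f\<close> is
  simple. Move that root to \<open>0\<close> and let \<open>F n\<close> be the field with \<open>p\<^sup>n\<close> elements inside an algebraic
  closure. The coefficients of the L-function are sums over monic polynomials of degree \<open>n\<close>
  with coefficients in \<open>F 1\<close>. They vanish for large \<open>n\<close> by interpolation, and Newton's identities
  relate them to the sums \<open>S\<^sub>n = \<Sum>\<^sub>x \<chi>(Norm f(x))\<close> over \<open>F n\<close>, with \<open>S\<^sub>1\<close> the sum to be bounded.
  By Stepanov's method every nonzero value of the norm of \<open>f\<close> is attained
  \<open>p\<^sup>n / (p - 1) + O(p\<^sup>n\<^sup>/\<^sup>2)\<close> times, so \<open>S\<^sub>n = O(p\<^sup>n\<^sup>/\<^sup>2)\<close>; the constant depends on \<open>p\<close>, but that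
  does not matter because \<open>n\<close> tends to infinity: the growth rate alone forces all zeros of the
  L-polynomial to have absolute value at least \<open>1 / \<surd>p\<close> (\<open>newton_power_sum_bound\<close>), and so
  bounds \<open>S\<^sub>1\<close> with a constant depending only on the number of roots.
\<close>

hide_const (open) Coset.order Divisibility.prime Divisibility.irreducible

section \<open>Linear systems and roots of polynomials\<close>

text \<open>
  Gaussian elimination: an equation with a nonzero coefficient removes one unknown and itself.
\<close>

lemma homogeneous_system_nontrivial:
  fixes a :: "'e \<Rightarrow> 'u \<Rightarrow> 'a::field"
  assumes "finite E" "finite U" "card E < card U"
  shows "\<exists>v. (\<exists>u\<in>U. v u \<noteq> 0) \<and> (\<forall>e\<in>E. (\<Sum>u\<in>U. a e u * v u) = 0)"
  using assms
proof (induction E arbitrary: a U rule: finite_induct)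
  case empty
  then have "U \<noteq> {}" by auto
  then show ?case by (intro exI[of _ "\<lambda>_. 1"]) auto
next
  case (insert e0 E)
  show ?case
  proof (cases "\<forall>u\<in>U. a e0 u = 0")
    case True
    obtain v where "\<exists>u\<in>U. v u \<noteq> 0" "\<forall>e\<in>E. (\<Sum>u\<in>U. a e u * v u) = 0"
      using insert.IH[of U a] insert.prems insert.hyps by auto
    with True show ?thesis by (intro exI[of _ v]) auto
  next
    case False
    then obtain u0 where u0: "u0 \<in> U" "a e0 u0 \<noteq> 0" by auto
    define U' where "U' = U - {u0}"
    have U: "U = insert u0 U'" "u0 \<notin> U'" "finite U'"
      using u0 insert.prems by (auto simp: U'_def)
    have "card E < card U'"
      using insert.prems insert.hyps U by simp
    then obtain w where w: "\<exists>u\<in>U'. w u \<noteq> 0"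
      "\<forall>e\<in>E. (\<Sum>u\<in>U'. (a e u - a e u0 * a e0 u / a e0 u0) * w u) = 0"
      using insert.IH[of U' "\<lambda>e u. a e u - a e u0 * a e0 u / a e0 u0"] U(3) by blast
    define s where "s = (\<Sum>u\<in>U'. a e0 u * w u)"
    (* the value at u0 is forced by the eliminated equation *)
    define v where "v = w(u0 := - s / a e0 u0)"
    have v: "(\<Sum>u\<in>U. a e u * v u) = a e u0 * (- s / a e0 u0) + (\<Sum>u\<in>U'. a e u * w u)" for e
    proof -
      have "(\<Sum>u\<in>U'. a e u * v u) = (\<Sum>u\<in>U'. a e u * w u)"
        by (intro sum.cong) (use U(2) in \<open>auto simp: v_def\<close>)
      then show ?thesis using U by (simp add: v_def)
    qed
    have "(\<Sum>u\<in>U. a e u * v u) = 0" if "e \<in> E" for e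
    proof -
      have "0 = (\<Sum>u\<in>U'. (a e u - a e u0 * a e0 u / a e0 u0) * w u)"
        using w(2) that by simp
      also have "\<dots> = (\<Sum>u\<in>U'. a e u * w u - (a e u0 / a e0 u0) * (a e0 u * w u))"
        by (intro sum.cong refl) (simp add: left_diff_distrib)
      also have "\<dots> = (\<Sum>u\<in>U'. a e u * w u) - (a e u0 / a e0 u0) * s"
        by (simp only: sum_subtractf s_def sum_distrib_left)
      finally show ?thesis unfolding v by (simp add: field_simps)
    qed
    moreover have "(\<Sum>u\<in>U. a e0 u * v u) = 0"
      unfolding v using u0 by (simp add: s_def)
    moreover have "\<exists>u\<in>U. v u \<noteq> 0"
      using w(1) U by (auto simp: v_def)
    ultimately show ?thesis by (intro exI[of _ v]) auto
  qed
qed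

lemma card_mult_order_le_degree:
  fixes P :: "'a::idom poly"
  assumes "P \<noteq> 0" "\<And>x. x \<in> Z \<Longrightarrow> M \<le> order x P" "M > 0"
  shows "card Z * M \<le> degree P"
proof -
  have fin: "finite {x. poly P x = 0}" using assms(1) by (rule poly_roots_finite)
  have sub: "Z \<subseteq> {x. poly P x = 0}"
    using assms by (force simp: order_root)
  have "card Z * M = (\<Sum>x\<in>Z. M)" by simp
  also have "\<dots> \<le> (\<Sum>x\<in>Z. order x P)" by (intro sum_mono assms)
  also have "\<dots> \<le> (\<Sum>x | poly P x = 0. order x P)"
    by (intro sum_mono2 fin sub) auto
  also have "\<dots> \<le> degree P" by (rule sum_order_le_degree) fact
  finally show ?thesis .
qed

lemma pcompose_power:
  fixes P :: "'a::comm_semiring_1 poly"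
  shows "(P ^ n) \<circ>\<^sub>p Q = (P \<circ>\<^sub>p Q) ^ n"
  by (induction n) (simp_all add: pcompose_mult pcompose_1)

text \<open>
  In positive characteristic ordinary derivatives do not detect orders of vanishing beyond the
  characteristic; the coefficients of the Taylor expansion \<open>P(x + T)\<close> in \<open>T\<close>, which are the Hasse
  derivatives of \<open>P\<close> at \<open>x\<close>, always do.
\<close>

lemma le_order_if_shift_coeffs_vanish:
  fixes P :: "'a::idom poly"
  assumes "P \<noteq> 0" "\<And>t. t < M \<Longrightarrow> coeff (P \<circ>\<^sub>p [:x, 1:]) t = 0"
  shows "M \<le> order x P"
proof -
  have "monom 1 M dvd P \<circ>\<^sub>p [:x, 1:]"
    using assms(2) by (simp add: monom_1_dvd_iff')
  then obtain Q where Q: "P \<circ>\<^sub>p [:x, 1:] = monom 1 M * Q" by (elim dvdE)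
  have "P = P \<circ>\<^sub>p [:x, 1:] \<circ>\<^sub>p [:-x, 1:]"
    by (simp add: pcompose_assoc[symmetric] pcompose_pCons)
  also have "\<dots> = [:-x, 1:] ^ M * (Q \<circ>\<^sub>p [:-x, 1:])"
    unfolding Q by (simp add: pcompose_mult monom_altdef pcompose_power pcompose_pCons)
  finally have "[:-x, 1:] ^ M dvd P" by (metis dvd_triv_left)
  then show ?thesis using assms(1) by (simp add: order_divides)
qed

lemma sum_order_eq_degree:
  fixes P :: "'a::alg_closed_field poly"
  assumes "P \<noteq> 0"
  shows "(\<Sum>x | poly P x = 0. order x P) = degree P"
proof -
  obtain A where A: "size A = degree P" "P = smult (lead_coeff P) (\<Prod>x\<in>#A. [:-x, 1:])"
    using alg_closed_imp_factorization[OF assms] by blast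
  have nz: "(\<Prod>x\<in>#B. [:-x, 1:]) \<noteq> 0" for B :: "'a multiset"
    by (induction B) (auto simp del: mult_pCons_left)
  have "proots P = proots (\<Prod>x\<in>#A. [:-x, 1:])"
    by (subst A(2)) (use assms in simp)
  also have "\<dots> = A"
  proof (induction A)
    case (add x A)
    have "proots (\<Prod>x\<in>#add_mset x A. [:-x, 1:]) = proots [:-x, 1:] + proots (\<Prod>x\<in>#A. [:-x, 1:])"
      using proots_mult[OF _ nz[of A], of "[:-x, 1:]"] by (simp del: mult_pCons_left)
    then show ?case using add by simp
  qed simp
  finally have "size (proots P) = degree P" using A by simp
  then show ?thesis using assms by (simp add: size_multiset_overloaded_eq)
qed

lemma rsquarefree_if_no_common_root_pderiv:
  fixes P :: "'a::idom poly"
  assumes "P \<noteq> 0" "\<And>a. poly P a = 0 \<Longrightarrow> poly (pderiv P) a \<noteq> 0"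
  shows "rsquarefree P"
proof -
  have "order a P \<le> 1" for a
  proof (rule ccontr)
    assume "\<not> order a P \<le> 1"
    then have "[:-a, 1:] ^ 2 dvd P" using assms(1) by (simp add: order_divides)
    then obtain Q where Q: "P = [:-a, 1:] * ([:-a, 1:] * Q)"
      by (metis dvdE mult.assoc power2_eq_square)
    have "poly P a = 0" "poly (pderiv P) a = 0"
      unfolding Q by (simp_all only: pderiv_mult poly_mult poly_add) auto
    then show False using assms(2) by blast
  qed
  then show ?thesis using assms(1) by (auto simp: rsquarefree_def le_Suc_eq)
qed

lemma card_roots_if_rsquarefree:
  fixes P :: "'a::alg_closed_field poly"
  assumes "rsquarefree P"
  shows "card {x. poly P x = 0} = degree P"
proof -
  have P: "P \<noteq> 0" using assms by (auto simp: rsquarefree_def)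
  have "degree P = (\<Sum>x | poly P x = 0. order x P)"
    using sum_order_eq_degree[OF P] by simp
  also have "\<dots> = (\<Sum>x | poly P x = 0. 1)"
    by (intro sum.cong refl) (use rsquarefree_root_order[OF assms _ P] in auto)
  finally show ?thesis by simp
qed

section \<open>The Frobenius map on an algebraically closed field\<close>

text \<open>
  For \<open>n \<ge> 1\<close> the fixed points \<open>F n\<close> of the \<open>n\<close>-th Frobenius power form the subfield with \<open>p\<^sup>n\<close> elements.
  All fields of characteristic \<open>p\<close> that occur are subsets of the one algebraically closed type
  \<open>'a\<close>; \<open>F\<close> is a parameter only so that these sets have a short name.
\<close>

locale char_p_field =
  fixes p :: nat and F :: "nat \<Rightarrow> 'a::alg_closed_field set"
  assumes prime_p: "prime p" and CHAR_p: "CHAR('a) = p"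
    and F_def: "\<And>n. F n = {x. x ^ (p ^ n) = x}"
begin

lemma p_gt_1: "p > 1"
  using prime_p by (rule prime_gt_1_nat)

lemma frob_add: "(x + y :: 'a) ^ (p ^ n) = x ^ (p ^ n) + y ^ (p ^ n)"
  using freshmans_dream'[where 'a = 'a] prime_p CHAR_p by simp

lemma frob_diff: "(x - y :: 'a) ^ (p ^ n) = x ^ (p ^ n) - y ^ (p ^ n)"
  using frob_add[of "x - y" y n] by (simp add: algebra_simps)

lemma frob_poly_add: "(P + Q :: 'a poly) ^ (p ^ n) = P ^ (p ^ n) + Q ^ (p ^ n)"
  using freshmans_dream'[where 'a = "'a poly"] prime_p CHAR_p by simp

lemma frob_poly_diff: "(P - Q :: 'a poly) ^ (p ^ n) = P ^ (p ^ n) - Q ^ (p ^ n)"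
  using frob_poly_add[of "P - Q" Q n] by (simp add: algebra_simps)

lemma frob_inj: "(x :: 'a) ^ (p ^ n) = y ^ (p ^ n) \<longleftrightarrow> x = y"
proof
  assume "x ^ (p ^ n) = y ^ (p ^ n)"
  then have "(x - y) ^ (p ^ n) = 0" by (simp add: frob_diff)
  then show "x = y" by simp
qed simp

lemma frob_iterate: "(x ^ (p ^ i)) ^ (p ^ j) = (x :: 'a) ^ (p ^ (i + j))"
  by (simp add: power_add power_mult)

lemma F_iff: "x \<in> F n \<longleftrightarrow> x ^ (p ^ n) = x"
  by (simp add: F_def)

lemma zero_in_F [simp]: "0 \<in> F n" and one_in_F [simp]: "1 \<in> F n"
  using p_gt_1 by (auto simp: F_iff)

lemma F_add: "x \<in> F n \<Longrightarrow> y \<in> F n \<Longrightarrow> x + y \<in> F n"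
  and F_diff: "x \<in> F n \<Longrightarrow> y \<in> F n \<Longrightarrow> x - y \<in> F n"
  by (simp_all add: F_iff frob_add frob_diff)

lemma F_uminus: "x \<in> F n \<Longrightarrow> - x \<in> F n"
  using F_diff[of 0 n x] by simp

lemma F_mult: "x \<in> F n \<Longrightarrow> y \<in> F n \<Longrightarrow> x * y \<in> F n"
  by (simp add: F_iff power_mult_distrib)

lemma F_divide: "x \<in> F n \<Longrightarrow> y \<in> F n \<Longrightarrow> x / y \<in> F n"
  by (simp add: F_iff power_divide)

lemma F_power: "x \<in> F n \<Longrightarrow> x ^ k \<in> F n"
  by (simp add: F_iff) (metis mult.commute power_mult)

lemma F_prod: "(\<And>i. i \<in> A \<Longrightarrow> f i \<in> F n) \<Longrightarrow> prod f A \<in> F n"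
  by (induction A rule: infinite_finite_induct) (auto intro: F_mult)

lemma F_one_subset: "F 1 \<subseteq> F n"
proof
  fix x assume "x \<in> F 1"
  then have x: "x ^ p = x" by (simp add: F_iff)
  have "x ^ (p ^ n) = x" by (induction n) (auto simp: power_mult x)
  then show "x \<in> F n" by (simp add: F_iff)
qed

text \<open>
  The polynomial \<open>X^(p^n) - X\<close> has derivative \<open>- 1\<close>, hence \<open>p\<^sup>n\<close> distinct roots.
\<close>

lemma assumes "n \<ge> 1" shows finite_F: "finite (F n)"
  and card_F: "card (F n) = p ^ n"
proof -
  define P :: "'a poly" where "P = monom 1 (p ^ n) - monom 1 1"
  have big: "p ^ n > 1" using p_gt_1 assms by (intro one_less_power) auto
  have deg: "degree P = p ^ n"
    using degree_add_eq_left[of "- monom 1 1" "monom (1::'a) (p ^ n)"] big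
    by (simp add: P_def degree_monom_eq)
  have P0: "P \<noteq> 0" using deg big degree_0[where 'a = 'a] by (metis not_less_zero)
  have F: "F n = {x. poly P x = 0}"
    by (auto simp: F_def P_def poly_monom)
  show "finite (F n)" unfolding F by (rule poly_roots_finite[OF P0])
  have "of_nat (p ^ n) = (0 :: 'a)"
    using assms of_nat_CHAR[where 'a = 'a] CHAR_p by (cases n) auto
  then have "pderiv P = -1"
    using assms by (simp add: P_def pderiv_diff pderiv_monom monom_0 one_pCons power_0_left)
  then have "rsquarefree P"
    using P0 by (intro rsquarefree_if_no_common_root_pderiv) auto
  then show "card (F n) = p ^ n"
    using card_roots_if_rsquarefree[of P] deg F by simp
qed

text \<open>
  The norm from \<open>F n\<close> to \<open>F 1\<close> is the product of the Frobenius conjugates, that is, raising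
  to the power \<open>1 + p + \<dots> + p^(n - 1)\<close>.
\<close>

definition norm_exp :: "nat \<Rightarrow> nat" where "norm_exp n = (\<Sum>i<n. p ^ i)"

lemma norm_exp_mult: "norm_exp n * (p - 1) = p ^ n - 1"
proof -
  have "int (norm_exp n * (p - 1)) = int (p ^ n - 1)"
    using p_gt_1 power_diff_1_eq[of "int p" n] by (simp add: norm_exp_def of_nat_diff mult.commute)
  then show ?thesis by linarith
qed

lemma norm_in_F_one: assumes "x \<in> F n" shows "x ^ norm_exp n \<in> F 1"
proof (cases "x = 0")
  case False
  have "norm_exp n * p = norm_exp n + (p ^ n - 1)"
    using norm_exp_mult[of n] p_gt_1 by (cases p) auto
  then have "(x ^ norm_exp n) ^ p = x ^ norm_exp n * x ^ (p ^ n - 1)"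
    by (metis power_add power_mult)
  moreover have "x * x ^ (p ^ n - 1) = x"
    using assms p_gt_1 by (simp add: F_iff power_eq_if[of x "p ^ n"])
  ultimately show ?thesis using False by (simp add: F_iff)
qed (simp add: power_0_left)

lemma prod_frob: "(\<Prod>l<n. (x :: 'a) ^ (p ^ l)) = x ^ norm_exp n"
  by (simp add: norm_exp_def power_sum)

end

section \<open>Polynomials over the prime field and conjugates\<close>

context char_p_field
begin

text \<open>
  The identity \<open>g(X^p) = g(X)^p\<close> says that all coefficients of \<open>g\<close> lie in \<open>F 1\<close> (see \<open>stable_pCons\<close>).
  In this form closure under products and exact quotients is immediate.
\<close>

definition stable :: "'a poly \<Rightarrow> bool" where
  "stable g \<longleftrightarrow> g \<circ>\<^sub>p monom 1 p = g ^ p"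

lemma stable_1: "stable 1"
  by (simp add: stable_def pcompose_1)

lemma stable_mult: "stable g \<Longrightarrow> stable h \<Longrightarrow> stable (g * h)"
  by (simp add: stable_def pcompose_mult power_mult_distrib)

lemma stable_power: "stable g \<Longrightarrow> stable (g ^ n)"
  by (induction n) (auto simp: stable_1 stable_mult)

lemma stable_prod: "(\<And>i. i \<in> A \<Longrightarrow> stable (f i)) \<Longrightarrow> stable (prod f A)"
  by (induction A rule: infinite_finite_induct) (auto intro: stable_mult simp: stable_1)

lemma stable_add: "stable g \<Longrightarrow> stable h \<Longrightarrow> stable (g + h)"
  using frob_poly_add[of g h 1] by (simp add: stable_def pcompose_add)

lemma stable_cancel:
  assumes "stable (c * g)" "stable c" "c \<noteq> 0"
  shows "stable g"
proof -
  have "c ^ p * (g \<circ>\<^sub>p monom 1 p) = c ^ p * g ^ p"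
    using assms by (simp add: stable_def pcompose_mult power_mult_distrib)
  then show ?thesis using assms(3) by (simp add: stable_def)
qed

text \<open>
  Compare constant terms in \<open>g(X^p) = g(X)^p\<close> and cancel \<open>X^p\<close> from the rest.
\<close>

lemma stable_pCons: "stable (pCons a g) \<longleftrightarrow> a \<in> F 1 \<and> stable g"
proof -
  define V :: "'a poly" where "V = monom 1 p"
  have V: "V = monom 1 1 ^ p" by (simp add: V_def monom_power)
  have V0: "poly V 0 = 0" using p_gt_1 by (simp add: V_def poly_monom)
  have L: "pCons a g \<circ>\<^sub>p V = [:a:] + V * (g \<circ>\<^sub>p V)"
    by (simp add: pcompose_pCons)
  have "pCons a g = [:a:] + monom 1 1 * g" by (simp add: monom_Suc monom_0)
  then have R: "pCons a g ^ p = [:a ^ p:] + V * g ^ p"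
    using frob_poly_add[of "[:a:]" "monom 1 1 * g" 1]
    by (simp add: V power_mult_distrib poly_const_pow)
  have "stable (pCons a g) \<longleftrightarrow> pCons a g \<circ>\<^sub>p V = pCons a g ^ p"
    by (simp only: stable_def V_def)
  also have "\<dots> \<longleftrightarrow> [:a:] + V * (g \<circ>\<^sub>p V) = [:a ^ p:] + V * g ^ p"
    by (simp only: L R)
  also have "\<dots> \<longleftrightarrow> a = a ^ p \<and> g \<circ>\<^sub>p V = g ^ p"
  proof
    assume *: "[:a:] + V * (g \<circ>\<^sub>p V) = [:a ^ p:] + V * g ^ p"
    then have "poly ([:a:] + V * (g \<circ>\<^sub>p V)) 0 = poly ([:a ^ p:] + V * g ^ p) 0" by simp
    then have "a = a ^ p" using V0 by simp
    moreover have "V \<noteq> 0" by (simp add: V_def)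
    ultimately show "a = a ^ p \<and> g \<circ>\<^sub>p V = g ^ p" using * by simp
  qed simp
  finally show ?thesis by (auto simp: F_iff stable_def V_def)
qed

lemma stable_0: "stable 0"
  using p_gt_1 by (simp add: stable_def)

lemma stable_const: "stable [:a:] \<longleftrightarrow> a \<in> F 1"
  by (simp add: stable_pCons stable_0)

lemma stable_poly_frob: assumes "stable g" shows "poly g x ^ p = poly g (x ^ p)"
proof -
  have "poly (g \<circ>\<^sub>p monom 1 p) x = poly (g ^ p) x"
    using assms by (simp add: stable_def)
  then show ?thesis by (simp add: poly_pcompose poly_monom)
qed

lemma stable_poly_frob_power: assumes "stable g" shows "poly g x ^ (p ^ n) = poly g (x ^ (p ^ n))"
proof (induction n)
  case (Suc n)
  have "poly g x ^ (p ^ Suc n) = (poly g x ^ (p ^ n)) ^ p"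
    by (simp add: power_mult[symmetric] mult.commute)
  also have "\<dots> = poly g (x ^ (p ^ n)) ^ p" by (simp add: Suc)
  also have "\<dots> = poly g ((x ^ (p ^ n)) ^ p)" by (rule stable_poly_frob[OF assms])
  also have "(x ^ (p ^ n)) ^ p = x ^ (p ^ Suc n)"
    by (simp add: power_mult[symmetric] mult.commute)
  finally show ?case .
qed simp

lemma stable_poly_in_F: "stable g \<Longrightarrow> x \<in> F n \<Longrightarrow> poly g x \<in> F n"
  by (simp add: F_iff stable_poly_frob_power)

lemma finite_stable: "finite {g. stable g \<and> degree g \<le> n}"
proof (induction n)
  case 0
  have "{g. stable g \<and> degree g \<le> 0} \<subseteq> (\<lambda>a. [:a:]) ` F 1"
    by (auto elim!: degree_eq_zeroE simp: stable_const)
  then show ?case using finite_F[of 1] by (meson finite_imageI finite_subset le_refl)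
next
  case (Suc n)
  have "{g. stable g \<and> degree g \<le> Suc n} \<subseteq>
      (\<lambda>(a, g). pCons a g) ` (F 1 \<times> {g. stable g \<and> degree g \<le> n})"
  proof
    fix g assume g: "g \<in> {g. stable g \<and> degree g \<le> Suc n}"
    obtain a h where h: "g = pCons a h" by (cases g) auto
    have "degree h \<le> n" using g h by (auto split: if_splits)
    then show "g \<in> (\<lambda>(a, g). pCons a g) ` (F 1 \<times> {g. stable g \<and> degree g \<le> n})"
      using g h by (auto simp: stable_pCons intro!: image_eqI[of _ _ "(a, h)"])
  qed
  then show ?case
    using Suc finite_F[of 1] by (meson finite_SigmaI finite_imageI finite_subset le_refl)
qed

text \<open>
  For \<open>x \<in> F j\<close> this is the characteristic polynomial of \<open>x\<close> over \<open>F 1\<close>, a power of the minimal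
  polynomial.
\<close>

definition conj_poly :: "'a \<Rightarrow> nat \<Rightarrow> 'a poly" where
  "conj_poly x j = (\<Prod>i<j. [:- (x ^ (p ^ i)), 1:])"

lemma conj_poly_0 [simp]: "conj_poly x 0 = 1"
  by (simp add: conj_poly_def)

lemma degree_conj_poly: "degree (conj_poly x j) = j"
  and lead_coeff_conj_poly: "lead_coeff (conj_poly x j) = 1"
  and conj_poly_nz: "conj_poly x j \<noteq> 0"
proof -
  show nz: "conj_poly x j \<noteq> 0" by (auto simp: conj_poly_def)
  show "degree (conj_poly x j) = j"
    unfolding conj_poly_def by (subst degree_prod_eq_sum_degree) auto
  show "lead_coeff (conj_poly x j) = 1"
    unfolding conj_poly_def by (simp add: lead_coeff_prod)
qed

lemma conj_poly_add:
  assumes "x \<in> F i"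
  shows "conj_poly x (i + j) = conj_poly x i * conj_poly x j"
proof -
  have "x ^ (p ^ (i + l)) = x ^ (p ^ l)" for l
    using assms by (simp add: F_iff power_add power_mult)
  then have "(\<Prod>l<j. [:- (x ^ (p ^ (i + l))), 1:]) = conj_poly x j"
    by (simp add: conj_poly_def)
  moreover have "conj_poly x (i + j) = conj_poly x i * (\<Prod>l<j. [:- (x ^ (p ^ (i + l))), 1:])"
    unfolding conj_poly_def by (induction j) (auto simp: mult_ac simp del: mult_pCons_left mult_pCons_right)
  ultimately show ?thesis by simp
qed

text \<open>
  The Frobenius map permutes the factors cyclically.
\<close>

lemma stable_conj_poly: assumes "x \<in> F j" shows "stable (conj_poly x j)"
proof -
  define V :: "'a poly" where "V = monom 1 p"
  have V: "[:0,1:] ^ p = V" by (simp add: V_def monom_altdef)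
  define f where "f i = V - [:x ^ (p ^ i):]" for i
  have lin: "[:- a, 1:] ^ p = V - [:a ^ p:]" for a :: 'a
  proof -
    have "[:- a, 1:] = [:0, 1:] - [:a:]" by simp
    then show ?thesis
      using frob_poly_diff[of "[:0,1:]" "[:a:]" 1] by (simp only: V power_one_right poly_const_pow)
  qed
  have "conj_poly x j \<circ>\<^sub>p V = (\<Prod>i<j. f i)"
    by (auto simp: conj_poly_def pcompose_prod pcompose_pCons f_def algebra_simps intro!: prod.cong)
  also have "\<dots> = (\<Prod>i<j. f (Suc i))"
  proof (cases j)
    case (Suc m)
    have "f 0 = f j" using assms by (simp add: f_def F_iff)
    then show ?thesis
      using prod.lessThan_Suc_shift[of f m] prod.lessThan_Suc[of "\<lambda>i. f (Suc i)" m]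
      by (simp add: Suc mult.commute del: prod.lessThan_Suc)
  qed simp
  also have "\<dots> = (\<Prod>i<j. [:- (x ^ (p ^ i)), 1:] ^ p)"
    by (intro prod.cong refl) (simp add: lin f_def power_mult[symmetric] mult.commute)
  also have "\<dots> = conj_poly x j ^ p" by (simp add: conj_poly_def prod_power_distrib)
  finally show ?thesis by (simp add: stable_def V_def)
qed

lemma poly_conj_poly:
  assumes "a \<in> F 1"
  shows "poly (conj_poly x j) a = (a - x) ^ norm_exp j"
proof -
  have "poly (conj_poly x j) a = (\<Prod>i<j. (a - x) ^ (p ^ i))"
    unfolding conj_poly_def poly_prod
  proof (intro prod.cong refl)
    fix i assume "i \<in> {..<j}"
    have "a ^ (p ^ i) = a" using assms F_one_subset[of i] by (auto simp: F_iff)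
    then show "poly [:- (x ^ p ^ i), 1:] a = (a - x) ^ p ^ i" by (simp add: frob_diff)
  qed
  then show ?thesis by (simp add: prod_frob)
qed

end

section \<open>Polynomial families of truncated Taylor expansions\<close>

text \<open>
  The family \<open>\<phi> x\<close> of polynomials in an auxiliary variable \<open>T\<close> stands for a polynomial in \<open>x\<close> and
  \<open>T\<close> whose degree in \<open>x\<close> is at most \<open>B\<close>. In Stepanov's method only this degree matters: it
  limits the number of linear conditions under which a \<open>T\<close>-coefficient vanishes for all \<open>x\<close>.
\<close>

definition coeff_family :: "nat \<Rightarrow> ('a::field \<Rightarrow> 'a poly) \<Rightarrow> bool" where
  "coeff_family B \<phi> \<longleftrightarrow> (\<forall>t. \<exists>Q. degree Q \<le> B \<and> (\<forall>x. coeff (\<phi> x) t = poly Q x))"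

lemma coeff_family_mono: "coeff_family B \<phi> \<Longrightarrow> B \<le> B' \<Longrightarrow> coeff_family B' \<phi>"
  unfolding coeff_family_def by (meson le_trans)

lemma coeff_family_const: "coeff_family 0 (\<lambda>_. P)"
  unfolding coeff_family_def by (intro allI exI[of _ "[:coeff P _:]"]) auto

lemma coeff_family_value: "coeff_family (degree R) (\<lambda>x. [:poly R x:])"
  unfolding coeff_family_def
proof
  fix t show "\<exists>Q. degree Q \<le> degree R \<and> (\<forall>x. coeff [:poly R x:] t = poly Q x)"
    by (intro exI[of _ "if t = 0 then R else 0"]) (auto simp: coeff_pCons split: nat.splits)
qed

lemma coeff_family_variable: "coeff_family 1 (\<lambda>x. [:x, 1:])"
  unfolding coeff_family_def
proof
  fix t show "\<exists>Q. degree Q \<le> 1 \<and> (\<forall>x::'a. coeff [:x, 1:] t = poly Q x)"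
    by (intro exI[of _ "if t = 0 then [:0, 1:] else if t = 1 then 1 else 0"])
       (auto simp: coeff_pCons split: nat.splits)
qed

lemma coeff_family_add:
  assumes "coeff_family B \<phi>" "coeff_family B \<psi>"
  shows "coeff_family B (\<lambda>x. \<phi> x + \<psi> x)"
  unfolding coeff_family_def
proof
  fix t
  obtain Q R where "degree Q \<le> B" "\<forall>x. coeff (\<phi> x) t = poly Q x"
    "degree R \<le> B" "\<forall>x. coeff (\<psi> x) t = poly R x"
    using assms unfolding coeff_family_def by meson
  then show "\<exists>Q. degree Q \<le> B \<and> (\<forall>x. coeff (\<phi> x + \<psi> x) t = poly Q x)"
    by (intro exI[of _ "Q + R"]) (auto intro: degree_add_le)
qed

lemma coeff_family_sum:
  "(\<And>l. l \<in> A \<Longrightarrow> coeff_family B (\<phi> l)) \<Longrightarrow> coeff_family B (\<lambda>x. \<Sum>l\<in>A. \<phi> l x)"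
  by (induction A rule: infinite_finite_induct)
     (auto intro: coeff_family_add coeff_family_mono[OF coeff_family_const])

lemma coeff_family_mult:
  assumes "coeff_family B \<phi>" "coeff_family C \<psi>"
  shows "coeff_family (B + C) (\<lambda>x. \<phi> x * \<psi> x)"
  unfolding coeff_family_def
proof
  fix t
  obtain Q R where Q: "\<And>t. degree (Q t) \<le> B" "\<And>t x. coeff (\<phi> x) t = poly (Q t) x"
    and R: "\<And>t. degree (R t) \<le> C" "\<And>t x. coeff (\<psi> x) t = poly (R t) x"
    using assms unfolding coeff_family_def by metis
  show "\<exists>Q. degree Q \<le> B + C \<and> (\<forall>x. coeff (\<phi> x * \<psi> x) t = poly Q x)"
  proof (intro exI[of _ "\<Sum>i\<le>t. Q i * R (t - i)"] conjI allI)
    show "degree (\<Sum>i\<le>t. Q i * R (t - i)) \<le> B + C"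
      by (intro degree_sum_le) (auto intro!: order_trans[OF degree_mult_le] add_mono Q R)
  qed (simp add: coeff_mult poly_sum Q R)
qed

lemma coeff_family_power:
  "coeff_family B \<phi> \<Longrightarrow> coeff_family (B * n) (\<lambda>x. \<phi> x ^ n)"
proof (induction n)
  case 0
  then show ?case using coeff_family_const[of 1] by simp
next
  case (Suc n)
  then show ?case using coeff_family_mult[of B \<phi> "B * n" "\<lambda>x. \<phi> x ^ n"] by simp
qed

lemma coeff_family_shift: "coeff_family (degree P) (\<lambda>x. P \<circ>\<^sub>p [:x, 1:])"
proof (induction P)
  case 0
  then show ?case using coeff_family_const[of 0] by simp
next
  case (pCons a P)
  show ?case
  proof (cases "P = 0")
    case True
    then show ?thesis using coeff_family_const[of "[:a:]"] by simp
  next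
    case False
    have "coeff_family (1 + degree P) (\<lambda>x. [:a:] + [:x, 1:] * (P \<circ>\<^sub>p [:x, 1:]))"
      by (intro coeff_family_add coeff_family_mult pCons.IH coeff_family_variable
            coeff_family_mono[OF coeff_family_const]) simp
    then show ?thesis using False by (simp add: pcompose_pCons)
  qed
qed

lemma coeff_family_poly_shift:
  "coeff_family B \<phi> \<Longrightarrow> coeff_family B (\<lambda>x. poly_shift k (\<phi> x))"
  unfolding coeff_family_def by (simp add: coeff_poly_shift)

lemma poly_eq_const_plus_shift:
  "P = [:coeff P 0:] + monom 1 1 * poly_shift 1 (P :: 'a::comm_semiring_1 poly)"
  by (intro poly_eqI) (auto simp: coeff_monom_mult coeff_poly_shift coeff_pCons split: nat.splits)

text \<open>
  Expand \<open>f(x + T) = f(x) + T h(T)\<close> binomially. Modulo \<open>T\<^sup>M\<close> only the terms \<open>l < M\<close> survive, and after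
  multiplication by \<open>f(x)^(M - 1)\<close> the large exponent \<open>N\<close> enters only through the factor \<open>f(x)\<^sup>N\<close>
  and the constants \<open>N choose l\<close>. Where \<open>f(x)\<^sup>N\<close> has a prescribed value, what remains has degree in
  \<open>x\<close> independent of \<open>N\<close>.
\<close>

lemma truncated_power_cong:
  fixes f :: "'a::field poly"
  assumes c: "c = poly f x" and M: "M > 0"
  defines "h \<equiv> poly_shift 1 (f \<circ>\<^sub>p [:x, 1:])"
  shows "[[:c ^ (M - 1):] * (f \<circ>\<^sub>p [:x, 1:]) ^ N =
          [:c ^ N:] * (\<Sum>l<M. [:of_nat (N choose l):] * [:c ^ (M - 1 - l):] * monom 1 l * h ^ l)]
          (mod monom 1 M)"
proof -
  have f: "f \<circ>\<^sub>p [:x, 1:] = monom 1 1 * h + [:c:]"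
    using poly_eq_const_plus_shift[of "f \<circ>\<^sub>p [:x, 1:]"]
    by (simp add: h_def c pcompose_coeff_0 add.commute)
  define S where "S l = [:of_nat (N choose l):] * [:c ^ (N - l) * c ^ (M - 1):] * monom 1 l * h ^ l" for l
  define R where "R l = (if l < M then [:c ^ N:] *
    ([:of_nat (N choose l):] * [:c ^ (M - 1 - l):] * monom 1 l * h ^ l) else 0)" for l
  have "[:c ^ (M - 1):] * (f \<circ>\<^sub>p [:x, 1:]) ^ N = (\<Sum>l\<le>N. S l)"
    unfolding f binomial_ring sum_distrib_left
    by (intro sum.cong refl)
       (simp add: S_def power_mult_distrib monom_power poly_const_pow of_nat_poly
             mult.assoc mult.left_commute mult.commute)
  (* summing beyond N makes both sides range over the same indices, whichever of N and M is larger *)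
  also have "\<dots> = (\<Sum>l\<le>N + M. S l)"
    by (intro sum.mono_neutral_left) (auto simp: S_def binomial_eq_0)
  finally have lhs: "[:c ^ (M - 1):] * (f \<circ>\<^sub>p [:x, 1:]) ^ N = (\<Sum>l\<le>N + M. S l)" .
  have rhs: "[:c ^ N:] * (\<Sum>l<M. [:of_nat (N choose l):] * [:c ^ (M - 1 - l):] * monom 1 l * h ^ l)
      = (\<Sum>l\<le>N + M. R l)"
    unfolding sum_distrib_left
    by (intro sum.mono_neutral_cong_left) (auto simp: R_def)
  have "monom 1 M dvd S l - R l" for l
  proof (cases "l < M")
    case True
    have "S l = R l"
    proof (cases "l \<le> N")
      case le: True
      have "c ^ (N - l) * c ^ (M - 1) = c ^ N * c ^ (M - 1 - l)"
        unfolding power_add[symmetric] using le True by simp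
      then show ?thesis using True by (simp add: S_def R_def mult_ac)
    qed (use True in \<open>simp add: S_def R_def binomial_eq_0\<close>)
    then show ?thesis by simp
  next
    case False
    then have "(monom 1 l :: 'a poly) = monom 1 M * monom 1 (l - M)"
      by (simp add: mult_monom)
    then have "monom 1 M dvd (monom 1 l :: 'a poly)" by (metis dvd_triv_left)
    then show ?thesis using False by (auto simp: S_def R_def intro!: dvd_smult dvd_mult2)
  qed
  then have "monom 1 M dvd (\<Sum>l\<le>N + M. S l) - (\<Sum>l\<le>N + M. R l)"
    unfolding sum_subtractf[symmetric] by (intro dvd_sum)
  then show ?thesis unfolding lhs rhs by (simp add: cong_iff_dvd_diff)
qed

lemma cong_monom_coeff:
  fixes P Q :: "'a::field poly"
  assumes "[P = Q] (mod monom 1 M)" "t < M"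
  shows "coeff P t = coeff Q t"
  using assms by (simp add: cong_iff_dvd_diff monom_1_dvd_iff')

section \<open>Stepanov's method\<close>

context char_p_field
begin

text \<open>
  As \<open>(x + T)^(p^n) = x + T^(p^n)\<close>, powers with exponent divisible by \<open>p\<^sup>n\<close> are locally
  constant to high order, and their values have low degree in \<open>x\<close>.
\<close>

lemma frob_linear_cong:
  assumes "x \<in> F n" "M \<le> p ^ n"
  shows "[([:x, 1:] ^ (p ^ n)) ^ i = [:x ^ i:]] (mod monom 1 M)"
proof -
  have "[:x, 1:] = [:x:] + [:0, 1:]" by simp
  then have "[:x, 1:] ^ (p ^ n) = [:x:] + monom 1 (p ^ n)"
    using assms(1) frob_poly_add[of "[:x:]" "[:0, 1:]" n]
    by (simp add: poly_const_pow F_iff monom_altdef)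
  moreover have "(monom 1 (p ^ n) :: 'a poly) = monom 1 M * monom 1 (p ^ n - M)"
    using assms(2) by (simp add: mult_monom)
  ultimately have "[[:x, 1:] ^ (p ^ n) = [:x:]] (mod monom 1 M)"
    by (simp add: cong_iff_dvd_diff)
  from cong_pow[OF this, of i] show ?thesis by (simp add: poly_const_pow)
qed

text \<open>
  Let \<open>q = p\<^sup>n\<close>, let \<open>E\<close> be the norm exponent, so that \<open>E (p - 1) = q - 1\<close>, and let \<open>Z\<close> be the set
  counted. The auxiliary polynomial is a linear combination \<open>P\<close> of \<open>X^(s + q i) f^(E j)\<close> with
  \<open>i < J\<close>, \<open>j < p - 1\<close>, \<open>s < E\<close>. On \<open>Z\<close> one has \<open>x\<^sup>q = x\<close> and \<open>f(x)\<^sup>E = z\<close>, so the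
  condition that \<open>P\<close> vanishes to order \<open>M\<close> at a point of \<open>Z\<close> follows from the vanishing of \<open>M\<close>
  polynomials of low degree, and the assumption \<open>count\<close> says that these conditions on the
  coefficients are fewer than the coefficients.
  
  That \<open>P \<noteq> 0\<close> is where the simple root of \<open>f\<close> at \<open>0\<close> enters: \<open>X^(s + q i) f^(E j)\<close> has order
  exactly \<open>s + E j + q i\<close> at \<open>0\<close>, and these orders are pairwise distinct, being mixed-radix
  expansions with digits \<open>s < E\<close>, \<open>j < p - 1\<close>, \<open>i\<close>. So \<open>P\<close> is a nonzero polynomial with a
  zero of order at least \<open>M\<close> at each point of \<open>Z\<close>, and its degree bounds \<open>M\<close> times the size of \<open>Z\<close>.
\<close>

lemma stepanov_count:
  assumes f: "f = [:0, c:] * g" and c: "c \<noteq> 0" and g0: "poly g 0 \<noteq> 0"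
    and n: "n \<ge> 1" and z: "z \<noteq> 0" and M: "M > 0" "M \<le> p ^ n"
    and count: "M * (norm_exp n + J + degree f * M) < J * (p ^ n - 1)"
  shows "card {x \<in> F n. poly f x ^ norm_exp n = z} * M \<le> p ^ n * (J + degree f)"
proof -
  define q where "q = p ^ n"
  define E where "E = norm_exp n"
  define Df where "Df = degree f"
  define Z where "Z = {x \<in> F n. poly f x ^ E = z}"
  define U :: "(nat \<times> nat \<times> nat) set" where "U = {..<J} \<times> {..<p - 1} \<times> {..<E}"
  have E1: "E * (p - 1) = q - 1" using norm_exp_mult by (simp add: E_def q_def)
  have q1: "q > 1" using n p_gt_1 unfolding q_def by (intro one_less_power) auto
  have J: "J > 0" using count by (cases J) auto
  have E0: "E > 0" using E1 q1 by (cases E) auto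
  have f0: "f \<noteq> 0" using f c g0 by auto

  (* phi is the local form of W u at a point of Z: low degree in x, valid modulo T^M *)
  define W where "W = (\<lambda>(i, j, s). monom 1 (s + q * i) * f ^ (E * j))"
  define B where "B = (E - 1) + (J - 1) + Df * (M - 1)"
  define fx1 where "fx1 x = poly_shift 1 (f \<circ>\<^sub>p [:x, 1:])" for x
  define \<phi> where "\<phi> = (\<lambda>(i, j, s) x. [:x, 1:] ^ s * [:x ^ i:] * [:z ^ j:] *
    (\<Sum>l<M. [:of_nat ((E * j) choose l):] * [:poly f x ^ (M - 1 - l):] * monom 1 l * fx1 x ^ l))"

  have cong: "[[:poly f x ^ (M - 1):] * (W u \<circ>\<^sub>p [:x, 1:]) = \<phi> u x] (mod monom 1 M)"
    if "x \<in> Z" "u \<in> U" for x u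
  proof -
    obtain i j s where u: "u = (i, j, s)" by (cases u) auto
    have zj: "poly f x ^ (E * j) = z ^ j" using that by (simp add: Z_def power_mult)
    have "[:poly f x ^ (M - 1):] * (W u \<circ>\<^sub>p [:x, 1:])
        = [:x, 1:] ^ s * ([:x, 1:] ^ q) ^ i * ([:poly f x ^ (M - 1):] * (f \<circ>\<^sub>p [:x, 1:]) ^ (E * j))"
      by (simp add: W_def u pcompose_mult pcompose_power monom_altdef pcompose_pCons
            power_add power_mult[symmetric] mult_ac)
    also have "[\<dots> = [:x, 1:] ^ s * [:x ^ i:] * ([:poly f x ^ (E * j):] *
      (\<Sum>l<M. [:of_nat ((E * j) choose l):] * [:poly f x ^ (M - 1 - l):] * monom 1 l * fx1 x ^ l))]
      (mod monom 1 M)"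
      unfolding q_def fx1_def using that M
      by (intro cong_mult cong_refl frob_linear_cong truncated_power_cong) (auto simp: Z_def)
    also have "[:x, 1:] ^ s * [:x ^ i:] * ([:poly f x ^ (E * j):] *
      (\<Sum>l<M. [:of_nat ((E * j) choose l):] * [:poly f x ^ (M - 1 - l):] * monom 1 l * fx1 x ^ l))
      = \<phi> u x"
      unfolding \<phi>_def u zj by (simp only: prod.case mult.assoc)
    finally show ?thesis .
  qed

  have fam: "coeff_family B (\<phi> u)" if "u \<in> U" for u
  proof -
    obtain i j s where u: "u = (i, j, s)" by (cases u) auto
    have fam_f: "coeff_family Df (\<lambda>x. [:poly f x:])"
      unfolding Df_def by (rule coeff_family_value)
    have fam_h: "coeff_family Df fx1"
      unfolding Df_def fx1_def by (intro coeff_family_poly_shift coeff_family_shift)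
    have "coeff_family (Df * (M - 1)) (\<lambda>x. \<Sum>l<M. [:of_nat ((E * j) choose l):] *
        [:poly f x ^ (M - 1 - l):] * monom 1 l * fx1 x ^ l)"
    proof (rule coeff_family_sum)
      fix l assume "l \<in> {..<M}"
      then have "0 + Df * (M - 1 - l) + 0 + Df * l = Df * (M - 1)"
        by (simp add: add_mult_distrib2[symmetric])
      moreover have "coeff_family (0 + Df * (M - 1 - l) + 0 + Df * l)
        (\<lambda>x. [:of_nat ((E * j) choose l):] * [:poly f x:] ^ (M - 1 - l) * monom 1 l * fx1 x ^ l)"
        by (intro coeff_family_mult coeff_family_power coeff_family_const fam_f fam_h)
      ultimately show "coeff_family (Df * (M - 1)) (\<lambda>x. [:of_nat ((E * j) choose l):] *
        [:poly f x ^ (M - 1 - l):] * monom 1 l * fx1 x ^ l)"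
        by (simp add: poly_const_pow)
    qed
    moreover have "coeff_family (1 * s) (\<lambda>x. [:x, 1:] ^ s)"
      by (intro coeff_family_power coeff_family_variable)
    moreover have "coeff_family i (\<lambda>x. [:x ^ i:])"
      using coeff_family_value[of "monom 1 i"] by (simp add: degree_monom_eq poly_monom)
    ultimately have "coeff_family (1 * s + i + 0 + Df * (M - 1)) (\<phi> u)"
      unfolding \<phi>_def u prod.case by (intro coeff_family_mult coeff_family_const)
    moreover have "1 * s + i + 0 + Df * (M - 1) \<le> B"
      using that by (auto simp: u U_def B_def)
    ultimately show ?thesis by (rule coeff_family_mono)
  qed
  then have "\<forall>u t. \<exists>Q. u \<in> U \<longrightarrow> degree Q \<le> B \<and> (\<forall>x. coeff (\<phi> u x) t = poly Q x)"
    unfolding coeff_family_def by blast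
  then obtain Q where Q: "\<And>u t. u \<in> U \<Longrightarrow> degree (Q u t) \<le> B"
      "\<And>u t x. u \<in> U \<Longrightarrow> coeff (\<phi> u x) t = poly (Q u t) x"
    by metis

  have "card ({..<M} \<times> {..B}) \<le> M * (E + J + Df * M)"
  proof -
    have "B + 1 \<le> E + J + Df * M"
      using E0 J M by (auto simp: B_def diff_mult_distrib2)
    then have "M * (B + 1) \<le> M * (E + J + Df * M)" by (rule mult_le_mono2)
    then show ?thesis by (simp only: card_cartesian_product card_lessThan card_atMost Suc_eq_plus1)
  qed
  also have "\<dots> < J * (q - 1)" using count by (simp add: E_def Df_def q_def)
  also have "\<dots> = card U" using E1 by (simp add: U_def mult.commute)
  finally have "card ({..<M} \<times> {..B}) < card U" .
  then obtain v where v: "\<exists>u\<in>U. v u \<noteq> 0"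
    "\<And>t b. t < M \<Longrightarrow> b \<le> B \<Longrightarrow> (\<Sum>u\<in>U. coeff (Q u t) b * v u) = 0"
    using homogeneous_system_nontrivial[of "{..<M} \<times> {..B}" U "\<lambda>(t, b) u. coeff (Q u t) b"]
    by (auto simp: U_def)

  define P where "P = (\<Sum>u\<in>U. [:v u:] * W u)"

  (* the factor f x ^ (M - 1) does not vanish on Z, because z is nonzero *)
  have vanish: "coeff (P \<circ>\<^sub>p [:x, 1:]) t = 0" if x: "x \<in> Z" and t: "t < M" for x t
  proof -
    have c1: "[(\<Sum>u\<in>U. [:v u:] * ([:poly f x ^ (M - 1):] * (W u \<circ>\<^sub>p [:x, 1:])))
        = (\<Sum>u\<in>U. [:v u:] * \<phi> u x)] (mod monom 1 M)"
      by (intro cong_sum cong_mult cong_refl cong x)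
    have c2: "(\<Sum>u\<in>U. [:v u:] * ([:poly f x ^ (M - 1):] * (W u \<circ>\<^sub>p [:x, 1:])))
        = [:poly f x ^ (M - 1):] * (P \<circ>\<^sub>p [:x, 1:])"
    proof -
      have "P \<circ>\<^sub>p [:x, 1:] = (\<Sum>u\<in>U. [:v u:] * (W u \<circ>\<^sub>p [:x, 1:]))"
        unfolding P_def pcompose_sum pcompose_mult pcompose_const ..
      then show ?thesis by (simp only: sum_distrib_left mult.left_commute)
    qed
    have "coeff ([:poly f x ^ (M - 1):] * (P \<circ>\<^sub>p [:x, 1:])) t
        = coeff (\<Sum>u\<in>U. [:v u:] * \<phi> u x) t"
      using cong_monom_coeff[OF c1 t] unfolding c2 .
    also have "\<dots> = (\<Sum>u\<in>U. v u * poly (Q u t) x)"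
      by (simp add: coeff_sum Q)
    also have "\<dots> = (\<Sum>u\<in>U. \<Sum>b\<le>B. v u * (coeff (Q u t) b * x ^ b))"
    proof (intro sum.cong refl)
      fix u assume u: "u \<in> U"
      have "poly (Q u t) x = (\<Sum>b\<le>B. coeff (Q u t) b * x ^ b)"
        unfolding poly_altdef
        by (intro sum.mono_neutral_left) (use Q(1)[OF u, of t] in \<open>auto simp: coeff_eq_0\<close>)
      then show "v u * poly (Q u t) x = (\<Sum>b\<le>B. v u * (coeff (Q u t) b * x ^ b))"
        by (simp add: sum_distrib_left)
    qed
    also have "\<dots> = (\<Sum>b\<le>B. (\<Sum>u\<in>U. coeff (Q u t) b * v u) * x ^ b)"
      by (subst sum.swap, intro sum.cong refl, unfold sum_distrib_right, intro sum.cong refl) (simp only: mult_ac)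
    also have "\<dots> = 0" using v(2) t by simp
    finally have "poly f x ^ (M - 1) * coeff (P \<circ>\<^sub>p [:x, 1:]) t = 0" by simp
    moreover have "poly f x \<noteq> 0"
      using x z E0 by (auto simp: Z_def zero_power)
    ultimately show ?thesis by simp
  qed

  define N where "N = (\<lambda>(i, j, s). (s + E * j) + q * i)"
  have low: "s + E * j < q" if "(i, j, s) \<in> U" for i j s
  proof -
    have "s + E * j < E * Suc j" using that by (simp add: U_def)
    also have "\<dots> \<le> E * (p - 1)" using that by (intro mult_le_mono) (auto simp: U_def)
    finally show ?thesis using E1 by simp
  qed
  have inj: "inj_on N U"
  proof (rule inj_onI)
    fix u u' assume uU: "u \<in> U" "u' \<in> U" "N u = N u'"
    obtain i j s where u: "u = (i, j, s)" by (cases u) auto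
    obtain i' j' s' where u': "u' = (i', j', s')" by (cases u') auto
    have l: "s + E * j < q" "s' + E * j' < q" "s < E" "s' < E"
      using low uU by (auto simp: u u' U_def)
    have *: "(s + E * j) + q * i = (s' + E * j') + q * i'" using uU by (simp add: N_def u u')
    have "i = ((s + E * j) + q * i) div q" using l by simp
    also have "\<dots> = i'" unfolding * using l by simp
    finally have i: "i = i'" .
    with * have **: "s + E * j = s' + E * j'" by simp
    have "j = (s + E * j) div E" using l by simp
    also have "\<dots> = j'" unfolding ** using l by simp
    finally have "j = j'" .
    with ** i show "u = u'" by (simp add: u u')
  qed
  have W: "W u = monom 1 (N u) * (smult (c ^ (E * j)) (g ^ (E * j)))" if "u = (i, j, s)" for u i j s
  proof -
    have "f = monom c 1 * g" by (simp add: f monom_Suc monom_0)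
    then have "f ^ (E * j) = monom (c ^ (E * j)) (E * j) * g ^ (E * j)"
      by (simp only: power_mult_distrib monom_power mult_1)
    then have "W u = (monom 1 (s + q * i) * monom (c ^ (E * j)) (E * j)) * g ^ (E * j)"
      by (simp only: W_def that prod.case mult.assoc)
    also have "monom 1 (s + q * i) * monom (c ^ (E * j)) (E * j)
        = smult (c ^ (E * j)) (monom 1 (N u))"
      by (simp add: mult_monom smult_monom N_def that add_ac)
    finally show ?thesis by (simp only: mult_smult_left mult_smult_right)
  qed
  have P0: "P \<noteq> 0"
  proof -
    (* the term of least order at 0 cannot cancel *)
    obtain u where u: "u \<in> U" "v u \<noteq> 0" "\<And>u'. u' \<in> U \<Longrightarrow> v u' \<noteq> 0 \<Longrightarrow> N u \<le> N u'"
      using ex_has_least_nat[of "\<lambda>u. u \<in> U \<and> v u \<noteq> 0" _ N] v(1) by metis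
    obtain i j s where uu: "u = (i, j, s)" by (cases u) auto
    have "coeff P (N u) = (\<Sum>u'\<in>U. v u' * coeff (W u') (N u))"
      by (simp add: P_def coeff_sum)
    also have "\<dots> = (\<Sum>u'\<in>{u}. v u' * coeff (W u') (N u))"
    proof (intro sum.mono_neutral_right ballI)
      fix u' assume u': "u' \<in> U - {u}"
      obtain i' j' s' where uu': "u' = (i', j', s')" by (cases u') auto
      show "v u' * coeff (W u') (N u) = 0"
      proof (cases "v u' = 0")
        case False
        then have "N u \<le> N u'" using u(3)[of u'] u' by blast
        moreover have "N u \<noteq> N u'" using inj_onD[OF inj, of u u'] u(1) u' by blast
        ultimately have "N u < N u'" by simp
        then show ?thesis by (simp add: W[OF uu'] coeff_monom_mult)
      qed simp
    qed (use u in \<open>auto simp: U_def\<close>)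
    also have "\<dots> = v u * (c ^ (E * j) * coeff (g ^ (E * j)) 0)"
      by (simp add: W[OF uu] coeff_monom_mult)
    also have "\<dots> \<noteq> 0"
      using u c g0 by (simp add: poly_0_coeff_0[symmetric])
    finally show ?thesis by auto
  qed

  have "degree P \<le> q * (J + Df)"
    unfolding P_def
  proof (rule degree_sum_le)
    fix u assume uU: "u \<in> U"
    obtain i j s where u: "u = (i, j, s)" by (cases u) auto
    have "degree ([:v u:] * W u) \<le> (s + q * i) + Df * (E * j)"
    proof -
      have "degree ([:v u:] * W u) \<le> degree (W u)"
        using degree_mult_le[of "[:v u:]" "W u"] by simp
      also have "\<dots> \<le> degree (monom (1::'a) (s + q * i)) + degree (f ^ (E * j))"
        unfolding W_def u prod.case by (rule degree_mult_le)
      also have "\<dots> \<le> (s + q * i) + Df * (E * j)"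
        unfolding Df_def by (intro add_mono degree_monom_le degree_power_le)
      finally show ?thesis .
    qed
    also have "\<dots> \<le> q * Suc i + Df * q"
    proof -
      have "s \<le> q" "E * j \<le> q" using low[of i j s] uU by (auto simp: u)
      then show ?thesis by (intro add_mono mult_le_mono) auto
    qed
    also have "\<dots> \<le> q * J + Df * q"
      using uU by (intro add_mono mult_le_mono) (auto simp: u U_def)
    finally show "degree ([:v u:] * W u) \<le> q * (J + Df)" by (simp add: algebra_simps)
  qed (simp add: U_def)
  moreover have "card Z * M \<le> degree P"
    using card_mult_order_le_degree[OF P0 le_order_if_shift_coeffs_vanish[OF P0 vanish] M(1)] by blast
  ultimately show ?thesis by (simp add: Z_def E_def q_def Df_def)
qed

end

context char_p_field
begin

text \<open>
  Take \<open>M \<le> \<surd>q\<close> with \<open>q = p\<^sup>n\<close>, smaller than \<open>\<surd>q\<close> by a factor of at most \<open>\<surd>p\<close>, and \<open>J\<close> slightly larger than \<open>M / (p - 1)\<close>. The main terms of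
  the numbers of coefficients and of conditions then agree, and the surplus \<open>k\<close> in \<open>J\<close> pays for the
  remaining conditions, which number \<open>O(M\<^sup>2) = O(q)\<close>. The bound \<open>n \<ge> 6\<close> makes \<open>M\<close> at least \<open>8\<close>,
  which absorbs the lower order terms.
\<close>

lemma stepanov_upper_bound:
  assumes f: "f = [:0, c:] * g" and c: "c \<noteq> 0" and g0: "poly g 0 \<noteq> 0" and p2: "p > 2"
  shows "\<exists>C\<ge>0. \<forall>n\<ge>6. \<forall>z. z \<noteq> 0 \<longrightarrow>
    real (card {x \<in> F n. poly f x ^ norm_exp n = z}) \<le> p ^ n / (p - 1) + C * sqrt p ^ n"
proof (intro exI[of _ "sqrt p * (3 * degree f + 5)"] conjI allI impI)
  fix n :: nat and z :: 'a
  assume n: "n \<ge> 6" and z: "z \<noteq> 0"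
  define N where "N = card {x \<in> F n. poly f x ^ norm_exp n = z}"
  define M where "M = p ^ (n div 2)"
  define Df where "Df = degree f"
  define k where "k = 2 * Df + 5"
  define J where "J = M div (p - 1) + k"
  define q where "q = p ^ n"
  define E where "E = norm_exp n"
  have MM: "M * M \<le> q"
    unfolding M_def q_def power_add[symmetric] using p2 by (intro power_increasing) auto
  have M8: "M \<ge> 8"
  proof -
    have "(8::nat) \<le> 3 ^ 3" by simp
    also have "\<dots> \<le> p ^ 3" using p2 by (intro power_mono) auto
    also have "\<dots> \<le> M" unfolding M_def using p2 n by (intro power_increasing) auto
    finally show ?thesis .
  qed
  have Mq: "8 * M \<le> q" by (rule order_trans[OF mult_le_mono1[OF M8] MM])
  have E1: "real E * (real p - 1) = real q - 1"
  proof -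
    have "q \<ge> 1" using p2 by (simp add: q_def)
    moreover have "real (E * (p - 1)) = real (q - 1)" by (simp only: E_def q_def norm_exp_mult)
    ultimately show ?thesis using p2 by (simp add: of_nat_diff)
  qed
  have J_ge: "real M + (real p - 1) * (real k - 1) \<le> (real p - 1) * real J"
  proof -
    have "M < (p - 1) * (M div (p - 1)) + (p - 1)"
      using dividend_less_div_times[of "p - 1" M] p2 by (simp add: mult.commute)
    then have "real M \<le> real ((p - 1) * (M div (p - 1)) + (p - 1))" by linarith
    also have "\<dots> = (real p - 1) * (real (M div (p - 1)) + 1)"
    proof -
      have "real (p - 1) = real p - 1" using p2 by (simp add: of_nat_diff)
      then show ?thesis by (simp only: of_nat_add of_nat_mult) (simp add: algebra_simps)
    qed
    finally show ?thesis by (simp add: J_def algebra_simps)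
  qed
  have div_le: "real (M div (p - 1)) \<le> real M / (real p - 1)"
    using of_nat_div_le_of_nat[of M "p - 1"] p2 by (simp add: of_nat_diff)
  also have "\<dots> \<le> real M / 2" using p2 by (intro divide_left_mono) auto
  finally have J_le: "real J \<le> real M / 2 + real k" by (simp add: J_def)

  have count: "M * (E + J + Df * M) < J * (q - 1)"
  proof -
    have rMM: "real M * real M \<le> real q" using MM by (metis of_nat_le_iff of_nat_mult)
    have rMq: "8 * real M \<le> real q" using Mq by linarith
    have q8: "real q \<ge> 8" using rMq M8 by linarith
    have "real M * real J \<le> real M * (real M / 2 + real k)"
      using J_le by (intro mult_left_mono) auto
    also have "\<dots> = real M * real M / 2 + (2 * real Df + 5) * real M"
      by (simp add: k_def algebra_simps)
    also have "\<dots> \<le> real q / 2 + (2 * real Df + 5) * (real q / 8)"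
      using rMM rMq by (intro add_mono mult_left_mono) auto
    finally have 1: "real M * real J \<le> real q / 2 + (2 * real Df + 5) * (real q / 8)" .
    have 2: "real Df * (real M * real M) \<le> real Df * real q"
      using rMM by (intro mult_left_mono) auto
    have 3: "real Df * 8 \<le> real Df * real q"
      using q8 by (intro mult_left_mono) auto
    have "real M * real E + (2 * real Df + 4) * (real q - 1)
        = (real M + (real p - 1) * (real k - 1)) * real E"
      by (simp add: E1[symmetric] k_def algebra_simps)
    also have "\<dots> \<le> (real p - 1) * real J * real E"
      using J_ge by (intro mult_right_mono) auto
    also have "\<dots> = real J * (real q - 1)" by (simp add: E1[symmetric] algebra_simps)
    finally have 4: "real M * real E + (2 * real Df + 4) * (real q - 1) \<le> real J * (real q - 1)" .
    have "real M * (real E + real J + real Df * real M) < real J * (real q - 1)"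
      using 1 2 3 4 q8 by (simp add: algebra_simps)
    moreover have "real q - 1 = real (q - 1)" using q8 by (simp add: of_nat_diff)
    ultimately have "real (M * (E + J + Df * M)) < real (J * (q - 1))"
      by (simp only: of_nat_mult of_nat_add)
    then show ?thesis by (simp only: of_nat_less_iff)
  qed
  have "N * M \<le> q * (J + Df)"
    unfolding N_def q_def Df_def
  proof (rule stepanov_count[OF f c g0 _ z])
    show "n \<ge> 1" "M > 0" using n M8 by simp_all
    show "M \<le> p ^ n" using Mq unfolding q_def by simp
    show "M * (norm_exp n + J + degree f * M) < J * (p ^ n - 1)"
      using count unfolding E_def Df_def q_def .
  qed
  then have "real N * real M \<le> real q * (real J + real Df)"
    by (simp only: of_nat_add[symmetric] of_nat_mult[symmetric] of_nat_le_iff)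
  also have "\<dots> \<le> real q * (real M / (real p - 1) + (3 * real Df + 5))"
    using div_le by (intro mult_left_mono) (auto simp: J_def k_def)
  also have "\<dots> = (real q / (real p - 1) + real q / real M * (3 * real Df + 5)) * real M"
  proof -
    have "a * (m / r + k) = (a / r + a / m * k) * m" if "m \<noteq> 0" for a m r k :: real
      using that by (simp add: distrib_left distrib_right)
    then show ?thesis using M8 by simp
  qed
  finally have "real N \<le> real q / (real p - 1) + real q / real M * (3 * real Df + 5)"
    by (rule mult_right_le_imp_le) (use M8 in simp)
  also have "real q / real M \<le> sqrt p * sqrt p ^ n"
  proof -
    have "real q / real M = real p ^ (n - n div 2)"
      using p2 by (simp add: q_def M_def power_diff)
    also have "\<dots> = sqrt p ^ (2 * (n - n div 2))" by (simp add: power_mult)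
    also have "\<dots> \<le> sqrt p ^ Suc n" using p2 by (intro power_increasing) auto
    finally show ?thesis by simp
  qed
  then have "real q / real M * (3 * real Df + 5) \<le> sqrt p * sqrt p ^ n * (3 * real Df + 5)"
    by (intro mult_right_mono) auto
  finally show "real (card {x \<in> F n. poly f x ^ norm_exp n = z})
      \<le> p ^ n / (p - 1) + sqrt p * (3 * degree f + 5) * sqrt p ^ n"
    using p2 by (simp add: N_def q_def Df_def of_nat_diff algebra_simps)
qed simp

text \<open>
  The upper bounds for the \<open>p - 1\<close> possible values of the norm add up to \<open>p\<^sup>n + O(p\<^sup>n\<^sup>/\<^sup>2)\<close>, while the
  counts add up to at least \<open>p\<^sup>n\<close> minus the number of roots. So no count can be much smaller than
  its upper bound.
\<close>

lemma norm_equidistributed: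
  assumes f: "f = [:0, c:] * g" and c: "c \<noteq> 0" and g0: "poly g 0 \<noteq> 0" and p2: "p > 2"
    and stable: "stable f"
  shows "\<exists>C\<ge>0. \<forall>n\<ge>6. \<forall>z\<in>F 1 - {0}.
    \<bar>real (card {x \<in> F n. poly f x ^ norm_exp n = z}) - p ^ n / (p - 1)\<bar> \<le> C * sqrt p ^ n"
proof -
  obtain C where C: "C \<ge> 0" "\<And>n z. n \<ge> 6 \<Longrightarrow> z \<noteq> 0 \<Longrightarrow>
    real (card {x \<in> F n. poly f x ^ norm_exp n = z}) \<le> p ^ n / (p - 1) + C * sqrt p ^ n"
    using stepanov_upper_bound[OF f c g0 p2] by blast
  have f0: "f \<noteq> 0" using f c g0 by auto
  show ?thesis
  proof (intro exI[of _ "C * p + degree f"] conjI allI impI ballI)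
    fix n :: nat and z assume n: "n \<ge> 6" and z: "z \<in> F 1 - {0}"
    define N where "N z = card {x \<in> F n. poly f x ^ norm_exp n = z}" for z
    define t where "t = real (p ^ n) / (p - 1)"
    define R where "R = sqrt p ^ n"
    have R1: "R \<ge> 1" unfolding R_def using p2 by (intro one_le_power) auto
    have fin: "finite (F n)" using n by (intro finite_F) auto
    have fin1: "finite (F 1)" by (intro finite_F) auto
    have E0: "norm_exp n > 0" using norm_exp_mult[of n] p2 n one_less_power[of p n]
      by (cases "norm_exp n") auto
    have "card (F n) \<le> card {x. poly f x = 0} + card {x \<in> F n. poly f x \<noteq> 0}"
      by (rule order_trans[OF card_mono card_Un_le])
         (use fin poly_roots_finite[OF f0] in auto)
    also have "\<dots> \<le> degree f + card {x \<in> F n. poly f x \<noteq> 0}"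
      using card_poly_roots_bound[OF f0] by simp
    also have "{x \<in> F n. poly f x \<noteq> 0} = (\<Union>z\<in>F 1 - {0}. {x \<in> F n. poly f x ^ norm_exp n = z})"
      using E0 by (auto intro!: norm_in_F_one[unfolded One_nat_def] stable_poly_in_F stable simp: zero_power)
    also have "card \<dots> = (\<Sum>z\<in>F 1 - {0}. N z)"
      unfolding N_def using fin fin1 by (subst card_UN_disjoint) auto
    also have "\<dots> = N z + (\<Sum>z\<in>F 1 - {0} - {z}. N z)"
      using fin1 z by (subst sum.remove[of _ z]) auto
    finally have "real (p ^ n) \<le> degree f + N z + real (\<Sum>z\<in>F 1 - {0} - {z}. N z)"
      using card_F[of n] n by linarith
    also have "real (\<Sum>z\<in>F 1 - {0} - {z}. N z) \<le> (\<Sum>z\<in>F 1 - {0} - {z}. t + C * R)"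
      unfolding of_nat_sum
      by (intro sum_mono) (use C(2)[OF n] in \<open>auto simp: N_def t_def R_def\<close>)
    also have "\<dots> = (real p - 2) * (t + C * R)"
    proof -
      have "card (F 1 - {0} - {z}) = p - 2"
        using card_F[of 1] fin1 z by (simp add: card_Diff_singleton)
      then show ?thesis using p2 by (simp add: of_nat_diff)
    qed
    also have "real (p ^ n) = (real p - 1) * t" using p2 by (simp add: t_def of_nat_diff)
    finally have "t \<le> real (N z) + (degree f + (real p - 2) * (C * R))"
      by (simp add: algebra_simps)
    also have "(real p - 2) * (C * R) \<le> real p * (C * R)"
      using C(1) R1 by (intro mult_right_mono) auto
    also have "real (degree f) \<le> degree f * R"
      using mult_left_mono[OF R1, of "degree f"] by simp
    finally have 1: "t \<le> real (N z) + (C * p + degree f) * R"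
      by (simp add: algebra_simps)
    have "C * R \<le> C * R * p" using C(1) R1 p2 mult_left_mono[of 1 "real p" "C * R"] by simp
    moreover have "real (degree f) * R \<ge> 0" using R1 by simp
    moreover have "real (N z) \<le> t + C * R" using C(2)[OF n] z by (simp add: N_def t_def R_def)
    ultimately have "\<bar>real (N z) - t\<bar> \<le> (C * p + degree f) * R"
      using 1 by (simp add: algebra_simps abs_le_iff)
    then show "\<bar>real (card {x \<in> F n. poly f x ^ norm_exp n = z}) - p ^ n / (p - 1)\<bar>
      \<le> (C * p + degree f) * sqrt p ^ n"
      by (simp add: N_def t_def R_def)
  qed (use C in simp)
qed

lemma norm_character_sum_bound:
  fixes h :: "'a \<Rightarrow> complex"
  assumes f: "f = [:0, c:] * g" and c: "c \<noteq> 0" and g0: "poly g 0 \<noteq> 0" and p2: "p > 2"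
    and stable: "stable f"
    and h0: "h 0 = 0" and h_bound: "\<And>z. z \<in> F 1 \<Longrightarrow> cmod (h z) \<le> 1" and h_sum: "(\<Sum>z\<in>F 1. h z) = 0"
  shows "\<exists>C\<ge>0. \<forall>n\<ge>6. cmod (\<Sum>x\<in>F n. h (poly f x ^ norm_exp n)) \<le> C * sqrt p ^ n"
proof -
  obtain C where C: "C \<ge> 0" "\<And>n z. n \<ge> 6 \<Longrightarrow> z \<in> F 1 - {0} \<Longrightarrow>
    \<bar>real (card {x \<in> F n. poly f x ^ norm_exp n = z}) - p ^ n / (p - 1)\<bar> \<le> C * sqrt p ^ n"
    using norm_equidistributed[OF f c g0 p2 stable] by blast
  have fin1: "finite (F 1)" by (intro finite_F) auto
  show ?thesis
  proof (intro exI[of _ "p * C"] conjI allI impI)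
    fix n :: nat assume n: "n \<ge> 6"
    define N where "N z = card {x \<in> F n. poly f x ^ norm_exp n = z}" for z
    define t where "t = real (p ^ n) / (p - 1)"
    have "(\<Sum>x\<in>F n. h (poly f x ^ norm_exp n))
        = (\<Sum>z\<in>F 1. \<Sum>x\<in>{x \<in> F n. poly f x ^ norm_exp n = z}. h (poly f x ^ norm_exp n))"
      by (rule sum.group[symmetric])
         (use n in \<open>auto intro!: finite_F norm_in_F_one[unfolded One_nat_def] stable_poly_in_F stable\<close>)
    also have "\<dots> = (\<Sum>z\<in>F 1. h z * N z)"
      by (intro sum.cong refl) (simp add: N_def)
    also have "\<dots> = (\<Sum>z\<in>F 1. h z * N z) - t * (\<Sum>z\<in>F 1. h z)"
      using h_sum by simp
    also have "\<dots> = (\<Sum>z\<in>F 1. h z * of_real (N z - t))"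
      by (simp add: sum_distrib_left sum_subtractf[symmetric] algebra_simps)
    also have "cmod \<dots> \<le> (\<Sum>z\<in>F 1. C * sqrt p ^ n)"
    proof (rule order_trans[OF norm_sum], rule sum_mono)
      fix z assume z: "z \<in> F 1"
      show "cmod (h z * of_real (N z - t)) \<le> C * sqrt p ^ n"
      proof (cases "z = 0")
        case False
        then have "\<bar>N z - t\<bar> \<le> C * sqrt p ^ n" using C(2)[OF n, of z] z by (simp add: N_def t_def)
        moreover have "cmod (h z) * \<bar>N z - t\<bar> \<le> 1 * \<bar>N z - t\<bar>"
          using h_bound[OF z] by (intro mult_right_mono) auto
        ultimately show ?thesis by (simp only: norm_mult norm_of_real mult_1)
      qed (use h0 C in simp)
    qed
    also have "\<dots> = p * C * sqrt p ^ n" using card_F[of 1] by simp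
    finally show "cmod (\<Sum>x\<in>F n. h (poly f x ^ norm_exp n)) \<le> p * C * sqrt p ^ n" .
  qed (use C in simp)
qed

end

section \<open>Divisibility by conjugate products\<close>

context char_p_field
begin

text \<open>
  The conjugates of \<open>x\<close> are among the finitely many roots of \<open>g\<close>, and the Frobenius map is injective.
\<close>

lemma exists_frob_period:
  assumes "stable g" "g \<noteq> 0" "poly g x = 0"
  shows "\<exists>j\<ge>1. x \<in> F j"
proof -
  have "range (\<lambda>i. x ^ (p ^ i)) \<subseteq> {y. poly g y = 0}"
  proof safe
    fix i
    have "poly g (x ^ (p ^ i)) = poly g x ^ (p ^ i)"
      by (rule stable_poly_frob_power[OF assms(1), symmetric])
    then show "poly g (x ^ (p ^ i)) = 0" using assms(3) p_gt_1 by simp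
  qed
  then have "finite (range (\<lambda>i. x ^ (p ^ i)))"
    using poly_roots_finite[OF assms(2)] finite_subset by blast
  then have "\<not> inj (\<lambda>i. x ^ (p ^ i))"
    using finite_imageD infinite_UNIV_nat by blast
  then obtain i k where ik: "i < k" "x ^ (p ^ i) = x ^ (p ^ k)"
    unfolding inj_def by (metis linorder_neqE_nat)
  have "(x ^ (p ^ (k - i))) ^ (p ^ i) = x ^ (p ^ i)"
    using ik by (simp add: frob_iterate)
  then have "x \<in> F (k - i)" by (simp add: frob_inj F_iff)
  then show ?thesis using ik by (intro exI[of _ "k - i"]) auto
qed

lemma F_subtract: assumes "x \<in> F d" "x \<in> F (d + j)" shows "x \<in> F j"
proof -
  have "x ^ (p ^ j) = (x ^ (p ^ d)) ^ (p ^ j)" using assms(1) by (simp add: F_iff)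
  also have "\<dots> = x" using assms(2) by (simp add: F_iff frob_iterate)
  finally show ?thesis by (simp add: F_iff)
qed

lemma F_plus: assumes "x \<in> F d" "x \<in> F j" shows "x \<in> F (d + j)"
  using assms by (simp add: F_iff frob_iterate[symmetric])

lemma conj_poly_Suc: "conj_poly x (Suc j) = conj_poly x j * [:- (x ^ (p ^ j)), 1:]"
  unfolding conj_poly_def by (simp only: prod.lessThan_Suc)

lemma poly_conj_poly_0_iff: "poly (conj_poly x j) y = 0 \<longleftrightarrow> (\<exists>i<j. y = x ^ (p ^ i))"
  by (auto simp: conj_poly_def poly_prod)

lemma conj_poly_dvd:
  assumes "stable g" "poly g x = 0" and min: "\<And>j. 1 \<le> j \<Longrightarrow> j < d \<Longrightarrow> x \<notin> F j"
  shows "conj_poly x d dvd g"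
proof -
  have "conj_poly x j dvd g" if "j \<le> d" for j
    using that
  proof (induction j)
    case (Suc j)
    then obtain k where k: "g = conj_poly x j * k" by (auto elim: dvdE)
    have "poly g (x ^ (p ^ j)) = poly g x ^ (p ^ j)"
      by (rule stable_poly_frob_power[OF assms(1), symmetric])
    then have "poly g (x ^ (p ^ j)) = 0" using assms(2) p_gt_1 by simp
    moreover have "poly (conj_poly x j) (x ^ (p ^ j)) \<noteq> 0"
    proof
      assume "poly (conj_poly x j) (x ^ (p ^ j)) = 0"
      then obtain i where i: "i < j" "x ^ (p ^ j) = x ^ (p ^ i)"
        by (auto simp: poly_conj_poly_0_iff)
      then have "(x ^ (p ^ (j - i))) ^ (p ^ i) = x ^ (p ^ i)" by (simp add: frob_iterate)
      then have "x \<in> F (j - i)" by (simp add: frob_inj F_iff)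
      then show False using min[of "j - i"] i Suc.prems by simp
    qed
    ultimately have "poly k (x ^ (p ^ j)) = 0" by (simp add: k)
    then have "[:- (x ^ (p ^ j)), 1:] dvd k" by (simp add: poly_eq_0_iff_dvd)
    then show ?case unfolding conj_poly_Suc k by (intro mult_dvd_mono dvd_refl)
  qed simp
  then show ?thesis by simp
qed

lemma order_conj_poly:
  assumes "d \<ge> 1" and min: "\<And>j. 1 \<le> j \<Longrightarrow> j < d \<Longrightarrow> x \<notin> F j"
  shows "order x (conj_poly x d) = 1"
proof -
  obtain d' where d': "d = Suc d'" using assms by (cases d) auto
  define R where "R = (\<Prod>i<d'. [:- (x ^ (p ^ Suc i)), 1:])"
  have eq: "conj_poly x d = [:- x, 1:] * R"
    unfolding conj_poly_def R_def d' by (subst prod.lessThan_Suc_shift) simp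
  have "x \<noteq> x ^ (p ^ Suc i)" if "i < d'" for i
  proof -
    have "x \<notin> F (Suc i)" using min[of "Suc i"] that d' by simp
    then show ?thesis by (metis F_iff)
  qed
  then have "poly R x \<noteq> 0"
    by (auto simp: R_def poly_prod simp del: power_Suc)
  then have "order x R = 0" by (rule order_0I)
  moreover have "order x [:- x, 1:] = 1" using order_power_n_n[of x 1] by simp
  ultimately show ?thesis
    unfolding eq using conj_poly_nz[of x d] by (subst order_mult) (auto simp: eq simp del: mult_pCons_left)
qed

text \<open>
  This replaces unique factorisation in the derivation of Newton's identities. If \<open>d\<close> is the least
  \<open>d \<ge> 1\<close> with \<open>x \<in> F d\<close>, the polynomial \<open>conj_poly x d\<close> is the minimal polynomial of \<open>x\<close>, and the
  conjugate products that divide \<open>g\<close> are its powers up to the multiplicity of \<open>x\<close> in \<open>g\<close>. The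
  induction splits off one such factor.
\<close>

lemma card_conj_dvd_eq_order:
  assumes "stable g" "g \<noteq> 0"
  shows "finite {j. 1 \<le> j \<and> x \<in> F j \<and> conj_poly x j dvd g} \<and>
    card {j. 1 \<le> j \<and> x \<in> F j \<and> conj_poly x j dvd g} = order x g"
  using assms
proof (induction "order x g" arbitrary: g rule: less_induct)
  case less
  define J where "J g = {j. 1 \<le> j \<and> x \<in> F j \<and> conj_poly x j dvd g}" for g
  show ?case
  proof (cases "poly g x = 0")
    case False
    have "J g = {}"
    proof -
      have "\<not> conj_poly x j dvd g" if "1 \<le> j" for j
      proof
        assume "conj_poly x j dvd g"
        moreover have "poly (conj_poly x j) x = 0"
          unfolding poly_conj_poly_0_iff using that by (intro exI[of _ 0]) auto
        ultimately show False using False by (auto elim: dvdE)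
      qed
      then show ?thesis by (auto simp: J_def)
    qed
    then have "{j. 1 \<le> j \<and> x \<in> F j \<and> conj_poly x j dvd g} = {}" by (simp only: J_def)
    then show ?thesis using order_0I[OF False] by (simp only: card.empty finite.emptyI)
  next
    case True
    define d where "d = (LEAST j. 1 \<le> j \<and> x \<in> F j)"
    have d: "1 \<le> d" "x \<in> F d"
      using LeastI_ex[of "\<lambda>j. 1 \<le> j \<and> x \<in> F j"] exists_frob_period[OF less.prems True]
      by (auto simp: d_def)
    have min: "x \<notin> F j" if "1 \<le> j" "j < d" for j
      using not_less_Least[of j "\<lambda>j. 1 \<le> j \<and> x \<in> F j"] that by (auto simp: d_def)
    obtain g' where g': "g = conj_poly x d * g'"
      using conj_poly_dvd[OF less.prems(1) True min] by (auto elim: dvdE)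
    have st: "stable g'"
      using stable_cancel[of "conj_poly x d" g'] less.prems(1) stable_conj_poly[OF d(2)] conj_poly_nz
      by (auto simp: g')
    have nz: "g' \<noteq> 0" using g' less.prems(2) by auto
    have ord: "order x g = Suc (order x g')"
      using less.prems(2) order_conj_poly[OF d(1) min] unfolding g' by (subst order_mult) auto
    have IH: "finite (J g')" "card (J g') = order x g'"
      using less.hyps[OF _ st nz] ord by (auto simp: J_def)
    have "J g = insert d ((\<lambda>j. d + j) ` J g')"
    proof (intro equalityI subsetI)
      fix j assume j: "j \<in> J g"
      then have "d \<le> j" using min[of j] by (force simp: J_def)
      show "j \<in> insert d ((\<lambda>j. d + j) ` J g')"
      proof (cases "j = d")
        case False
        define i where "i = j - d"
        have i: "j = d + i" "1 \<le> i" using False \<open>d \<le> j\<close> by (auto simp: i_def)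
        have "conj_poly x d * conj_poly x i dvd conj_poly x d * g'"
          using j conj_poly_add[OF d(2), of i] g' by (simp add: J_def i)
        then have "conj_poly x i dvd g'" using conj_poly_nz[of x d] by simp
        moreover have "x \<in> F i" using F_subtract[OF d(2), of i] j by (simp add: J_def i(1))
        ultimately have "i \<in> J g'" using i(2) by (simp add: J_def)
        then show ?thesis unfolding i(1) by blast
      qed simp
    next
      fix j assume "j \<in> insert d ((\<lambda>j. d + j) ` J g')"
      then show "j \<in> J g"
        using d g' by (auto simp: J_def conj_poly_add F_plus)
    qed
    moreover have "d \<notin> (\<lambda>j. d + j) ` J g'" by (auto simp: J_def)
    ultimately have "finite (J g) \<and> card (J g) = Suc (card (J g'))"
      using IH(1) by (simp add: card_image)
    then show ?thesis using IH(2) ord by (simp add: J_def)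
  qed
qed

text \<open>
  Count the pairs \<open>(j, x)\<close> with \<open>conj_poly x j\<close> dividing \<open>g\<close> in two ways: for a fixed root \<open>x\<close> there are
  as many as its multiplicity, and the multiplicities add up to the degree.
\<close>

lemma sum_card_conj_dvd:
  assumes "stable g" "g \<noteq> 0" "degree g = n"
  shows "(\<Sum>j=1..n. card {x \<in> F j. conj_poly x j dvd g}) = n"
proof -
  define A where "A = (SIGMA j:{1..n}. {x \<in> F j. conj_poly x j dvd g})"
  define B where "B = (SIGMA x:{x. poly g x = 0}. {j. 1 \<le> j \<and> x \<in> F j \<and> conj_poly x j dvd g})"
  have root: "poly g x = 0" if "1 \<le> j" "conj_poly x j dvd g" for x j
  proof -
    have "poly (conj_poly x j) x = 0"
      unfolding poly_conj_poly_0_iff using that by (intro exI[of _ 0]) auto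
    then show ?thesis using that by (auto elim: dvdE)
  qed
  have deg: "j \<le> n" if "conj_poly x j dvd g" for x j
    using dvd_imp_degree_le[OF that assms(2)] by (simp add: degree_conj_poly assms(3))
  have "bij_betw prod.swap A B"
    by (rule bij_betwI[of _ _ _ prod.swap]) (auto simp: A_def B_def root deg)
  then have "card A = card B" by (rule bij_betw_same_card)
  also have "card B = (\<Sum>x | poly g x = 0. order x g)"
    unfolding B_def
    by (subst card_SigmaI) (use card_conj_dvd_eq_order[OF assms(1,2)] poly_roots_finite[OF assms(2)] in auto)
  also have "\<dots> = n" using sum_order_eq_degree[OF assms(2)] assms(3) by simp
  finally have "card A = n" .
  moreover have "card A = (\<Sum>j=1..n. card {x \<in> F j. conj_poly x j dvd g})"
    unfolding A_def by (subst card_SigmaI) (auto intro!: finite_subset[OF _ finite_F])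
  ultimately show ?thesis by simp
qed

end

section \<open>The L-function of a product of shifted characters\<close>

text \<open>
  Here \<open>h\<close> is a nonprincipal multiplicative character of \<open>F 1\<close>. The distinguished root of the
  polynomial under the character is \<open>0\<close>, with exponent one; the other roots \<open>d i\<close> may coincide with
  each other but not with \<open>0\<close>.
\<close>

locale product_char_sum = char_p_field p F for p and F :: "nat \<Rightarrow> 'a::alg_closed_field set" +
  fixes h :: "'a \<Rightarrow> complex" and I :: "'i set" and d :: "'i \<Rightarrow> 'a" and e :: "'i \<Rightarrow> nat"
  assumes p_gt_2: "p > 2"
    and h_mult: "\<And>x y. x \<in> F 1 \<Longrightarrow> y \<in> F 1 \<Longrightarrow> h (x * y) = h x * h y"
    and h_0: "h 0 = 0" and h_1: "h 1 = 1"
    and h_bound: "\<And>x. x \<in> F 1 \<Longrightarrow> cmod (h x) \<le> 1"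
    and h_sum: "(\<Sum>x\<in>F 1. h x) = 0"
    and finite_I: "finite I"
    and d_in: "\<And>i. i \<in> I \<Longrightarrow> d i \<in> F 1" and d_nz: "\<And>i. i \<in> I \<Longrightarrow> d i \<noteq> 0"
begin

definition form :: "'a poly" where
  "form = [:0, -1:] * (\<Prod>i\<in>I. [:d i, -1:] ^ e i)"

text \<open>
  By reciprocity, evaluating \<open>g\<close> at the roots of \<open>form\<close> is, up to sign, the resultant of \<open>g\<close> and
  \<open>form\<close>. So \<open>\<Psi>\<close> is the completely multiplicative function whose L-series belongs to the character
  sums over the fields \<open>F n\<close> (see \<open>\<Psi>_conj_poly\<close>).
\<close>

definition \<Psi> :: "'a poly \<Rightarrow> complex" where
  "\<Psi> g = h (poly g 0 * (\<Prod>i\<in>I. poly g (d i) ^ e i))"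

definition monics :: "nat \<Rightarrow> 'a poly set" where
  "monics n = {g. stable g \<and> degree g = n \<and> lead_coeff g = 1}"

definition L_coeff :: "nat \<Rightarrow> complex" where "L_coeff n = (\<Sum>g\<in>monics n. \<Psi> g)"

definition ext_sum :: "nat \<Rightarrow> complex" where
  "ext_sum n = (\<Sum>x\<in>F n. h (poly form x ^ norm_exp n))"

lemma stable_form: "stable form"
  unfolding form_def
  by (intro stable_mult stable_prod stable_power)
     (auto simp: stable_pCons stable_0 d_in F_uminus simp del: One_nat_def)

lemma ext_sum_bound: "\<exists>C\<ge>0. \<forall>n\<ge>6. cmod (ext_sum n) \<le> C * sqrt p ^ n"
  unfolding ext_sum_def
proof (rule norm_character_sum_bound[OF form_def])
  show "poly (\<Prod>i\<in>I. [:d i, -1:] ^ e i) 0 \<noteq> 0"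
    using d_nz finite_I by (auto simp: poly_prod)
qed (use p_gt_2 stable_form h_0 h_bound h_sum in auto)

lemma finite_monics: "finite (monics n)"
  by (rule finite_subset[OF _ finite_stable[of n]]) (auto simp: monics_def)

lemma \<Psi>_arg_in: "stable g \<Longrightarrow> poly g 0 * (\<Prod>i\<in>I. poly g (d i) ^ e i) \<in> F 1"
  by (intro F_mult F_prod F_power stable_poly_in_F d_in zero_in_F)

lemma \<Psi>_mult:
  assumes "stable g" "stable k" shows "\<Psi> (g * k) = \<Psi> g * \<Psi> k"
proof -
  have "poly (g * k) 0 * (\<Prod>i\<in>I. poly (g * k) (d i) ^ e i)
      = (poly g 0 * (\<Prod>i\<in>I. poly g (d i) ^ e i)) * (poly k 0 * (\<Prod>i\<in>I. poly k (d i) ^ e i))"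
    by (simp add: power_mult_distrib prod.distrib mult_ac)
  then show ?thesis
    unfolding \<Psi>_def by (simp only: h_mult[OF \<Psi>_arg_in[OF assms(1)] \<Psi>_arg_in[OF assms(2)]])
qed

lemma \<Psi>_conj_poly: "\<Psi> (conj_poly x j) = h (poly form x ^ norm_exp j)"
proof -
  have "poly (conj_poly x j) 0 * (\<Prod>i\<in>I. poly (conj_poly x j) (d i) ^ e i)
      = (0 - x) ^ norm_exp j * (\<Prod>i\<in>I. ((d i - x) ^ norm_exp j) ^ e i)"
    by (simp only: poly_conj_poly[OF zero_in_F] poly_conj_poly[OF d_in] cong: prod.cong)
  also have "\<dots> = poly form x ^ norm_exp j"
  proof -
    have form: "poly form x = (0 - x) * (\<Prod>i\<in>I. (d i - x) ^ e i)"
      by (simp add: form_def poly_prod)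
    show ?thesis
      unfolding form power_mult_distrib prod_power_distrib by (simp add: power_mult[symmetric] mult.commute)
  qed
  finally show ?thesis by (simp add: \<Psi>_def)
qed

lemma monics_0: "monics 0 = {1}"
proof (intro equalityI subsetI)
  fix g assume "g \<in> monics 0"
  then obtain a where "g = [:a:]" "a = 1"
    by (auto simp: monics_def elim!: degree_eq_zeroE)
  then show "g \<in> {1}" by (simp add: one_pCons)
qed (auto simp: monics_def stable_1)

lemma L_coeff_0: "L_coeff 0 = 1"
  by (simp add: L_coeff_def monics_0 \<Psi>_def h_1)

text \<open>
  Let \<open>w\<close> vanish at all \<open>d i\<close> but not at \<open>0\<close>, with degree \<open>card I\<close>. Translation by multiples of \<open>w\<close>
  permutes the monic polynomials of degree \<open>n\<close>, fixes the values at \<open>d i\<close> and moves the value at \<open>0\<close>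
  through all of \<open>F 1\<close>, over which the character sums to zero.
\<close>

lemma L_coeff_eq_0: assumes n: "n > card I" shows "L_coeff n = 0"
proof -
  define w where "w = (\<Prod>i\<in>I. [:- d i, 1:])"
  have st_w: "stable w"
    unfolding w_def by (intro stable_prod) (auto simp: stable_pCons stable_0 d_in F_uminus simp del: One_nat_def)
  have deg_w: "degree w = card I"
    unfolding w_def by (subst degree_prod_eq_sum_degree) auto
  have w0: "poly w 0 \<noteq> 0" using d_nz finite_I by (auto simp: w_def poly_prod)
  have wd: "poly w (d i) = 0" if "i \<in> I" for i
    using that finite_I by (auto simp: w_def poly_prod)
  have w0_in: "poly w 0 \<in> F 1" by (intro stable_poly_in_F st_w) auto
  have shift: "g + smult t w \<in> monics n" if "g \<in> monics n" "t \<in> F 1" for g t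
  proof -
    have deg: "degree (smult t w) < degree g"
      using that n deg_w degree_smult_le[of t w] by (simp add: monics_def)
    have "stable (smult t w)"
      using stable_mult[of "[:t:]" w] that st_w by (simp add: stable_const)
    moreover from deg have d: "degree (g + smult t w) = degree g"
      by (rule degree_add_eq_left)
    moreover have "lead_coeff (g + smult t w) = lead_coeff g"
      unfolding d coeff_add coeff_eq_0[OF deg] by simp
    ultimately show ?thesis
      using that unfolding monics_def by (auto simp: stable_add simp del: coeff_add coeff_smult)
  qed
  have inv: "(\<Sum>g\<in>monics n. \<Psi> (g + smult t w)) = L_coeff n" if t: "t \<in> F 1" for t
    unfolding L_coeff_def
  proof (rule sum.reindex_bij_witness[of _ "\<lambda>g. g - smult t w" "\<lambda>g. g + smult t w"])
    fix g assume "g \<in> monics n"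
    then show "g - smult t w \<in> monics n" using shift[of g "- t"] F_uminus[OF t] by simp
  qed (use shift t in auto)
  have "of_nat p * L_coeff n = (\<Sum>t\<in>F 1. \<Sum>g\<in>monics n. \<Psi> (g + smult t w))"
    using card_F[of 1] by (simp add: inv)
  also have "\<dots> = (\<Sum>g\<in>monics n. \<Sum>t\<in>F 1. \<Psi> (g + smult t w))" by (rule sum.swap)
  also have "\<dots> = 0"
  proof (rule sum.neutral, rule ballI)
    fix g assume g: "g \<in> monics n"
    then have st: "stable g" by (simp add: monics_def)
    define A where "A = (\<Prod>i\<in>I. poly g (d i) ^ e i)"
    have A: "A \<in> F 1" unfolding A_def by (intro F_prod F_power stable_poly_in_F st d_in)
    have g0: "poly g 0 \<in> F 1" by (intro stable_poly_in_F st) auto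
    have "(\<Sum>t\<in>F 1. \<Psi> (g + smult t w)) = (\<Sum>t\<in>F 1. h (poly g 0 + t * poly w 0) * h A)"
    proof (intro sum.cong refl)
      fix t assume t: "t \<in> F 1"
      have "(\<Prod>i\<in>I. poly (g + smult t w) (d i) ^ e i) = A"
        unfolding A_def by (intro prod.cong refl) (simp add: wd)
      then have "\<Psi> (g + smult t w) = h ((poly g 0 + t * poly w 0) * A)"
        by (simp add: \<Psi>_def)
      then show "\<Psi> (g + smult t w) = h (poly g 0 + t * poly w 0) * h A"
        by (simp add: h_mult[OF F_add[OF g0 F_mult[OF t w0_in]] A])
    qed
    also have "\<dots> = (\<Sum>t\<in>F 1. h (poly g 0 + t * poly w 0)) * h A"
      by (simp add: sum_distrib_right)
    also have "(\<Sum>t\<in>F 1. h (poly g 0 + t * poly w 0)) = (\<Sum>t\<in>F 1. h t)"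
      by (rule sum.reindex_bij_witness[of _ "\<lambda>t. (t - poly g 0) / poly w 0" "\<lambda>t. poly g 0 + t * poly w 0"])
         (use w0 g0 w0_in in \<open>auto intro!: F_add F_mult F_divide F_diff\<close>)
    finally show "(\<Sum>t\<in>F 1. \<Psi> (g + smult t w)) = 0"
      by (simp only: h_sum mult_zero_left)
  qed
  finally show ?thesis using p_gt_1 by simp
qed

text \<open>
  The number \<open>n\<close> is replaced by the count in \<open>sum_card_conj_dvd\<close>; for a fixed conjugate
  product dividing \<open>g\<close> one then sums over the complementary factor.
\<close>

lemma newton: "of_nat n * L_coeff n = (\<Sum>j=1..n. ext_sum j * L_coeff (n - j))"
proof -
  have inner: "(\<Sum>g | g \<in> monics n \<and> conj_poly x j dvd g. \<Psi> g)
      = h (poly form x ^ norm_exp j) * L_coeff (n - j)" if j: "j \<in> {1..n}" and x: "x \<in> F j" for j x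
  proof -
    have st: "stable (conj_poly x j)" by (rule stable_conj_poly[OF x])
    have "(\<Sum>g | g \<in> monics n \<and> conj_poly x j dvd g. \<Psi> g)
        = (\<Sum>k\<in>monics (n - j). \<Psi> (conj_poly x j * k))"
    proof (rule sum.reindex_bij_witness[of _ "\<lambda>k. conj_poly x j * k" "\<lambda>g. g div conj_poly x j"])
      fix g assume g: "g \<in> {g. g \<in> monics n \<and> conj_poly x j dvd g}"
      then obtain k where k: "g = conj_poly x j * k" by (auto elim: dvdE)
      have k0: "k \<noteq> 0" using g by (auto simp: k monics_def)
      have "stable k" using stable_cancel[of "conj_poly x j" k] g st conj_poly_nz
        by (auto simp: k monics_def)
      moreover have "degree k = n - j"
        using g k0 conj_poly_nz[of x j] by (auto simp: k monics_def degree_mult_eq degree_conj_poly)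
      moreover have "lead_coeff k = 1"
        using g lead_coeff_mult[of "conj_poly x j" k] lead_coeff_conj_poly[of x j]
        by (auto simp: k monics_def)
      ultimately show "g div conj_poly x j \<in> monics (n - j)"
        using conj_poly_nz[of x j] by (simp add: k monics_def)
    next
      fix k assume k: "k \<in> monics (n - j)"
      then have k0: "k \<noteq> 0" by (auto simp: monics_def)
      show "conj_poly x j * k \<in> {g. g \<in> monics n \<and> conj_poly x j dvd g}"
        using k k0 j st conj_poly_nz[of x j] lead_coeff_mult[of "conj_poly x j" k] lead_coeff_conj_poly[of x j]
        by (auto simp: monics_def stable_mult degree_mult_eq degree_conj_poly)
    qed (use conj_poly_nz in auto)
    also have "\<dots> = (\<Sum>k\<in>monics (n - j). \<Psi> (conj_poly x j) * \<Psi> k)"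
      by (intro sum.cong refl \<Psi>_mult st) (simp add: monics_def)
    finally show ?thesis by (simp add: \<Psi>_conj_poly L_coeff_def sum_distrib_left)
  qed
  have "of_nat n * L_coeff n = (\<Sum>g\<in>monics n. of_nat n * \<Psi> g)"
    by (simp add: L_coeff_def sum_distrib_left)
  also have "\<dots> = (\<Sum>g\<in>monics n. \<Sum>j=1..n. \<Sum>x\<in>F j. if conj_poly x j dvd g then \<Psi> g else 0)"
  proof (intro sum.cong refl)
    fix g assume g: "g \<in> monics n"
    have "(\<Sum>j=1..n. card {x \<in> F j. conj_poly x j dvd g}) = n"
      using g by (intro sum_card_conj_dvd) (auto simp: monics_def)
    then have "of_nat n * \<Psi> g = of_nat (\<Sum>j=1..n. card {x \<in> F j. conj_poly x j dvd g}) * \<Psi> g"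
      by simp
    also have "\<dots> = (\<Sum>j=1..n. \<Sum>x\<in>{x \<in> F j. conj_poly x j dvd g}. \<Psi> g)"
      by (simp add: sum_distrib_right)
    also have "\<dots> = (\<Sum>j=1..n. \<Sum>x\<in>F j. if conj_poly x j dvd g then \<Psi> g else 0)"
      by (intro sum.cong refl sum.inter_filter finite_F) auto
    finally show "of_nat n * \<Psi> g
      = (\<Sum>j=1..n. \<Sum>x\<in>F j. if conj_poly x j dvd g then \<Psi> g else 0)" .
  qed
  also have "\<dots> = (\<Sum>j=1..n. \<Sum>x\<in>F j. \<Sum>g\<in>monics n. if conj_poly x j dvd g then \<Psi> g else 0)"
    by (subst sum.swap, intro sum.cong refl, rule sum.swap)
  also have "\<dots> = (\<Sum>j=1..n. \<Sum>x\<in>F j. h (poly form x ^ norm_exp j) * L_coeff (n - j))"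
  proof (intro sum.cong refl)
    fix j x assume "j \<in> {1..n}" "x \<in> F j"
    then show "(\<Sum>g\<in>monics n. if conj_poly x j dvd g then \<Psi> g else 0)
        = h (poly form x ^ norm_exp j) * L_coeff (n - j)"
      by (subst inner[symmetric]) (auto intro!: sum.inter_filter[symmetric] finite_monics)
  qed
  also have "\<dots> = (\<Sum>j=1..n. ext_sum j * L_coeff (n - j))"
    by (simp add: ext_sum_def sum_distrib_right)
  finally show ?thesis .
qed

end

section \<open>Bounding a power sum by its growth\<close>

text \<open>
  The linear coefficient of \<open>\<Prod> (1 - T / a)\<close> is minus the sum of the reciprocals of the roots.
\<close>

lemma cmod_coeff_1_le:
  fixes L :: "complex poly"
  assumes "coeff L 0 = 1" "\<rho> > 0" "\<And>a. poly L a = 0 \<Longrightarrow> cmod a \<ge> \<rho>"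
  shows "cmod (coeff L 1) \<le> degree L / \<rho>"
  using assms
proof (induction "degree L" arbitrary: L)
  case 0
  then show ?case by (simp add: coeff_eq_0)
next
  case (Suc n)
  obtain a where a: "poly L a = 0"
    using alg_closed_imp_poly_has_root[of L] Suc.hyps(2) by auto
  have a_ge: "cmod a \<ge> \<rho>" using Suc.prems(3) a by blast
  then have a0: "a \<noteq> 0" using Suc.prems(2) by auto
  obtain Q' where Q': "L = [:-a, 1:] * Q'" using a by (metis dvdE poly_eq_0_iff_dvd)
  define Q where "Q = smult (-a) Q'"
  have L: "L = [:1, - 1 / a:] * Q"
  proof -
    have "[:-a, 1:] = smult (-a) [:1, - 1 / a:]" using a0 by simp
    then show ?thesis unfolding Q' Q_def by (simp only: mult_smult_left mult_smult_right)
  qed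
  have "L \<noteq> 0" using Suc.prems(1) by auto
  then have Q0: "Q \<noteq> 0" using L by auto
  have "degree L = Suc (degree Q)"
    unfolding L using Q0 a0 by (subst degree_mult_eq) auto
  then have n: "n = degree Q" using Suc.hyps(2) by simp
  have "cmod (coeff Q 1) \<le> degree Q / \<rho>"
  proof (rule Suc.hyps(1)[OF n _ Suc.prems(2)])
    show "coeff Q 0 = 1" using Suc.prems(1) by (simp add: L)
    show "\<rho> \<le> cmod b" if "poly Q b = 0" for b
      using Suc.prems(3)[of b] that by (simp add: L)
  qed
  moreover have "coeff L 1 = coeff Q 1 - 1 / a"
    using Suc.prems(1) by (simp add: L)
  moreover have "cmod (1 / a) \<le> 1 / \<rho>"
    using a_ge Suc.prems(2) by (simp add: norm_divide frac_le)
  ultimately have "cmod (coeff L 1) \<le> degree Q / \<rho> + 1 / \<rho>"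
    using norm_triangle_ineq4[of "coeff Q 1" "1 / a"] by simp
  then show ?case
    using Suc.hyps(2)[symmetric] n by (simp add: add_divide_distrib[symmetric] add.commute)
qed

text \<open>
  Let \<open>L = \<Sum> c\<^sub>n T\<^sup>n\<close>, a polynomial. Newton's identities say \<open>T L'(T) = L(T) \<Sum> S\<^sub>n T\<^sup>n\<close>, and the power series
  converges for \<open>\<bar>T\<bar> < 1 / R\<close>. A zero of \<open>L\<close> in this disc, which cannot be \<open>0\<close>, would have smaller
  multiplicity on the left than on the right. So all zeros satisfy \<open>\<bar>T\<bar> \<ge> 1 / R\<close>, and
  \<open>S 1\<close> is the linear coefficient of \<open>L\<close>.
\<close>

lemma newton_power_sum_bound:
  fixes c S :: "nat \<Rightarrow> complex" and k :: nat and R C :: real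
  assumes c0: "c 0 = 1" and ck: "\<And>n. n > k \<Longrightarrow> c n = 0"
    and newton: "\<And>n. of_nat n * c n = (\<Sum>j=1..n. S j * c (n - j))"
    and R: "R > 0" and S: "\<And>n. n \<ge> n0 \<Longrightarrow> cmod (S n) \<le> C * R ^ n"
  shows "cmod (S 1) \<le> k * R"
proof -
  define L where "L = (\<Sum>i\<le>k. monom (c i) i)"
  have coeff_L: "coeff L n = c n" for n
    using ck[of n] by (auto simp: L_def coeff_sum coeff_monom not_le)
  (* S 0 does not occur in the recursion, so the power series is started at 1 *)
  define s where "s n = (if n = 0 then 0 else S n)" for n
  have sum_s: "summable (\<lambda>n. norm (s n * T ^ n))" if "cmod T < 1 / R" for T
  proof (rule summable_comparison_test_ev)
    show "summable (\<lambda>n. C * (R * cmod T) ^ n)"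
      using that R by (intro summable_mult summable_geometric) (simp add: field_simps)
    show "\<forall>\<^sub>F n in sequentially. norm (norm (s n * T ^ n)) \<le> C * (R * cmod T) ^ n"
      using eventually_ge_at_top[of "max n0 1"]
    proof eventually_elim
      case (elim n)
      then have "cmod (S n) * cmod T ^ n \<le> C * R ^ n * cmod T ^ n"
        by (intro mult_right_mono S) auto
      then show ?case using elim by (simp add: s_def norm_mult norm_power power_mult_distrib mult_ac)
    qed
  qed
  have key: "T * poly (pderiv L) T = (\<Sum>n. s n * T ^ n) * poly L T" if T: "cmod T < 1 / R" for T
  proof -
    have fin: "summable (\<lambda>n. norm (c n * T ^ n))"
      by (rule summable_finite[of "{..k}"]) (auto simp: ck)
    have "(\<lambda>n. \<Sum>i\<le>n. (s i * T ^ i) * (c (n - i) * T ^ (n - i))) sums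
        ((\<Sum>n. s n * T ^ n) * (\<Sum>n. c n * T ^ n))"
      by (rule Cauchy_product_sums[OF sum_s[OF T] fin])
    also have "(\<Sum>n. c n * T ^ n) = poly L T"
    proof -
      have "degree L \<le> k" by (intro degree_le) (auto simp: coeff_L ck)
      then have "poly L T = (\<Sum>n\<le>k. c n * T ^ n)"
        unfolding poly_altdef coeff_L
        by (intro sum.mono_neutral_left) (auto simp: coeff_eq_0 simp flip: coeff_L)
      also have "\<dots> = (\<Sum>n. c n * T ^ n)"
        by (rule suminf_finite[symmetric]) (auto simp: ck)
      finally show ?thesis ..
    qed
    also have "(\<lambda>n. \<Sum>i\<le>n. (s i * T ^ i) * (c (n - i) * T ^ (n - i))) = (\<lambda>n. of_nat n * c n * T ^ n)"
    proof
      fix n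
      have "(\<Sum>i\<le>n. (s i * T ^ i) * (c (n - i) * T ^ (n - i))) = (\<Sum>i\<le>n. s i * c (n - i) * T ^ n)"
        by (intro sum.cong refl) (simp add: power_add[symmetric] mult_ac)
      also have "\<dots> = (\<Sum>i=1..n. S i * c (n - i) * T ^ n)"
        by (intro sum.mono_neutral_cong_right) (auto simp: s_def)
      also have "\<dots> = of_nat n * c n * T ^ n" by (simp add: newton sum_distrib_right)
      finally show "(\<Sum>i\<le>n. (s i * T ^ i) * (c (n - i) * T ^ (n - i))) = of_nat n * c n * T ^ n" .
    qed
    finally have 1: "(\<lambda>n. of_nat n * c n * T ^ n) sums ((\<Sum>n. s n * T ^ n) * poly L T)" .
    have "(\<Sum>n\<le>k. of_nat n * c n * T ^ n) = T * poly (pderiv L) T"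
    proof -
      have "degree (pderiv L) \<le> k"
        by (intro degree_le) (auto simp: coeff_pderiv coeff_L ck)
      then have "poly (pderiv L) T = (\<Sum>n\<le>k. coeff (pderiv L) n * T ^ n)"
        unfolding poly_altdef
        by (intro sum.mono_neutral_left) (auto simp: coeff_eq_0)
      then have "T * poly (pderiv L) T = (\<Sum>n\<le>k. of_nat (Suc n) * c (Suc n) * T ^ Suc n)"
        by (simp add: coeff_pderiv coeff_L sum_distrib_left mult_ac)
      also have "\<dots> = (\<Sum>n\<le>Suc k. of_nat n * c n * T ^ n)"
        by (simp only: sum.atMost_Suc_shift) simp
      also have "\<dots> = (\<Sum>n\<le>k. of_nat n * c n * T ^ n)" by (simp add: ck)
      finally show ?thesis ..
    qed
    then have "(\<lambda>n. of_nat n * c n * T ^ n) sums (T * poly (pderiv L) T)"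
      using sums_finite[of "{..k}" "\<lambda>n. of_nat n * c n * T ^ n"] by (auto simp: ck)
    with 1 show ?thesis by (rule sums_unique2[symmetric])
  qed
  have L0: "L \<noteq> 0" using coeff_L[of 0] c0 by auto
  have root: "cmod a \<ge> 1 / R" if a: "poly L a = 0" for a
  proof (rule ccontr)
    assume "\<not> cmod a \<ge> 1 / R"
    then have aR: "cmod a < 1 / R" by simp
    have a0: "a \<noteq> 0" using a c0 coeff_L[of 0] by (auto simp: poly_0_coeff_0)
    obtain w where w: "order a L = Suc w" using a L0 by (metis order_root not0_implies_Suc)
    obtain Q where Q: "L = [:-a, 1:] ^ Suc w * Q" "poly Q a \<noteq> 0"
      using order_decomp[OF L0, of a] by (metis w poly_eq_0_iff_dvd)
    define F where "F T = (\<Sum>n. s n * T ^ n)" for T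
    have "isCont F a"
    proof -
      obtain r where r: "cmod a < r" "r < 1 / R" using dense[OF aR] by blast
      have "r > 0" using r(1) norm_ge_zero[of a] by linarith
      then have "cmod (of_real r :: complex) < 1 / R" using r(2) by simp
      from summable_norm_cancel[OF sum_s[OF this]] have "summable (\<lambda>n. s n * of_real r ^ n)" .
      then show ?thesis unfolding F_def by (rule isCont_powser) (use r in auto)
    qed
    then have contF: "(F \<longlongrightarrow> F a) (at a)" by (simp add: isCont_def)
    have "eventually (\<lambda>T. cmod T < 1 / R) (at a)"
      by (rule order_tendstoD(2)[OF tendsto_norm[OF tendsto_ident_at] aR])
    moreover have "eventually (\<lambda>T. T \<noteq> a) (at a)" by (simp add: eventually_at_filter)
    ultimately have "eventually (\<lambda>T. T * ((T - a) * poly (pderiv Q) T + of_nat (Suc w) * poly Q T)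
        = (T - a) * (F T * poly Q T)) (at a)"
    proof eventually_elim
      case (elim T)
      have "T * poly (pderiv L) T = F T * poly L T" using key elim by (simp add: F_def)
      moreover have "poly L T = (T - a) ^ w * ((T - a) * poly Q T)" by (simp add: Q(1) algebra_simps)
      moreover have "poly (pderiv L) T
          = (T - a) ^ w * ((T - a) * poly (pderiv Q) T + of_nat (Suc w) * poly Q T)"
        unfolding Q(1) pderiv_mult pderiv_power_Suc
        by (simp add: algebra_simps pderiv_pCons)
      ultimately have "(T - a) ^ w * (T * ((T - a) * poly (pderiv Q) T + of_nat (Suc w) * poly Q T))
          = (T - a) ^ w * ((T - a) * (F T * poly Q T))"
        by (simp only: mult_ac)
      then show ?case using elim by simp
    qed
    moreover have "((\<lambda>T. (T - a) * (F T * poly Q T)) \<longlongrightarrow> (a - a) * (F a * poly Q a)) (at a)"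
      by (intro tendsto_intros contF)
    ultimately have "((\<lambda>T. T * ((T - a) * poly (pderiv Q) T + of_nat (Suc w) * poly Q T))
        \<longlongrightarrow> (a - a) * (F a * poly Q a)) (at a)"
      by (simp add: tendsto_cong)
    moreover have "((\<lambda>T. T * ((T - a) * poly (pderiv Q) T + of_nat (Suc w) * poly Q T))
        \<longlongrightarrow> a * ((a - a) * poly (pderiv Q) a + of_nat (Suc w) * poly Q a)) (at a)"
      by (intro tendsto_intros)
    ultimately have "(a - a) * (F a * poly Q a)
        = a * ((a - a) * poly (pderiv Q) a + of_nat (Suc w) * poly Q a)"
      by (intro tendsto_unique[OF at_neq_bot])
    then show False using a0 Q(2) by (simp add: of_nat_Suc[symmetric] del: of_nat_Suc)
  qed
  have "S 1 = coeff L 1" using newton[of 1] c0 by (simp add: coeff_L)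
  also have "cmod \<dots> \<le> degree L / (1 / R)"
    by (rule cmod_coeff_1_le) (use c0 R root in \<open>auto simp: coeff_L\<close>)
  also have "\<dots> \<le> k * R"
  proof -
    have "degree L \<le> k" by (intro degree_le) (auto simp: coeff_L ck)
    then show ?thesis using R by simp
  qed
  finally show ?thesis .
qed

section \<open>Dirichlet characters modulo a prime\<close>

lemma character_periodic:
  assumes "dirichlet_character m \<chi>" "[x = y] (mod int m)"
  shows "\<chi> x = \<chi> y"
proof -
  have per: "\<chi> (x + int m) = \<chi> x" for x using assms(1) by (simp add: dirichlet_character_def)
  have nat: "\<chi> (x + int m * int k) = \<chi> x" for x k
  proof (induction k)
    case (Suc k)
    then show ?case using per[of "x + int m * int k"] by (simp add: algebra_simps)
  qed simp
  obtain k where k: "x = y + int m * k" using assms(2) by (metis cong_iff_lin cong_sym mult.commute)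
  show ?thesis
  proof (cases "k \<ge> 0")
    case True
    then show ?thesis using nat[of y "nat k"] k by simp
  next
    case False
    then show ?thesis using nat[of x "nat (- k)"] k by simp
  qed
qed

context
  fixes p :: nat and \<chi> :: "int \<Rightarrow> complex"
  assumes p: "prime p" and \<chi>: "dirichlet_character p \<chi>"
begin

lemma character_mult: "\<chi> (x * y) = \<chi> x * \<chi> y"
  using \<chi> by (simp add: dirichlet_character_def)

lemma character_eq_0_iff: "\<chi> x = 0 \<longleftrightarrow> int p dvd x"
  using \<chi> p prime_imp_coprime[of "int p" x] not_prime_unit[of "int p"]
  by (auto simp: dirichlet_character_def coprime_commute dest: coprime_common_divisor[of x "int p" "int p"])

lemma character_1: "\<chi> 1 = 1"
proof -
  have "\<chi> 1 * \<chi> 1 = \<chi> 1" using character_mult[of 1 1] by simp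
  moreover have "\<chi> 1 \<noteq> 0" using prime_gt_1_nat[OF p] by (simp add: character_eq_0_iff)
  ultimately show ?thesis by simp
qed

lemma character_power: "\<chi> (x ^ n) = \<chi> x ^ n"
  by (induction n) (auto simp: character_1 character_mult)

lemma character_prod: "\<chi> (prod f A) = (\<Prod>a\<in>A. \<chi> (f a))"
  by (induction A rule: infinite_finite_induct) (auto simp: character_1 character_mult)

lemma character_fermat:
  assumes "\<not> int p dvd x" shows "\<chi> x ^ (p - 1) = 1"
proof -
  define y where "y = nat (x mod int p)"
  have y: "int y = x mod int p" using p prime_gt_0_nat[OF p] by (simp add: y_def)
  have ndvd: "\<not> p dvd y"
    using assms y by (metis dvd_mod_iff dvd_refl int_dvd_int_iff)
  have "\<chi> x = \<chi> (int y)" by (rule character_periodic[OF \<chi>]) (simp add: y cong_def)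
  then have "\<chi> x ^ (p - 1) = \<chi> (int (y ^ (p - 1)))" by (simp add: character_power)
  also have "\<dots> = \<chi> 1"
    using character_periodic[OF \<chi>, of "int (y ^ (p - 1))" 1] fermat_theorem[OF p ndvd]
    by (metis cong_int_iff of_nat_1)
  finally show ?thesis using character_1 by simp
qed

lemma norm_character: "cmod (\<chi> x) = (if int p dvd x then 0 else 1)"
proof (cases "int p dvd x")
  case True
  then show ?thesis using character_eq_0_iff by simp
next
  case False
  then have "cmod (\<chi> x) ^ (p - 1) = 1"
    using character_fermat[of x] by (simp add: norm_power[symmetric])
  then have "cmod (\<chi> x) = 1"
    using prime_gt_1_nat[OF p] power_eq_imp_eq_base[of "cmod (\<chi> x)" "p - 1" 1] by simp
  then show ?thesis using False by simp
qed

lemma norm_character_le_1: "cmod (\<chi> x) \<le> 1"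
  by (simp add: norm_character)

lemma sum_residues_shift:
  fixes f :: "int \<Rightarrow> complex"
  assumes per: "\<And>x y. [x = y] (mod int p) \<Longrightarrow> f x = f y" and a: "\<not> int p dvd a"
  shows "(\<Sum>x\<in>{0..<int p}. f (a * x + b)) = (\<Sum>x\<in>{0..<int p}. f x)"
proof -
  have p0: "int p > 0" using prime_gt_0_nat[OF p] by simp
  have "coprime a (int p)" using a p prime_imp_coprime[of "int p" a] by (simp add: coprime_commute)
  have inj: "inj_on (\<lambda>x. (a * x + b) mod int p) {0..<int p}"
  proof (rule inj_onI)
    fix x y assume xy: "x \<in> {0..<int p}" "y \<in> {0..<int p}"
      "(a * x + b) mod int p = (a * y + b) mod int p"
    then have "[a * x = a * y] (mod int p)"
      using cong_add_rcancel[of "a * x" b "a * y" "int p"] by (simp add: cong_def)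
    then have "[x = y] (mod int p)"
      using cong_mult_lcancel[OF \<open>coprime a (int p)\<close>, of x y] by simp
    then show "x = y" using xy by (simp add: cong_def)
  qed
  moreover have "(\<lambda>x. (a * x + b) mod int p) ` {0..<int p} \<subseteq> {0..<int p}" using p0 by auto
  ultimately have bij: "bij_betw (\<lambda>x. (a * x + b) mod int p) {0..<int p} {0..<int p}"
    by (simp add: bij_betw_def endo_inj_surj)
  have "(\<Sum>x\<in>{0..<int p}. f (a * x + b)) = (\<Sum>x\<in>{0..<int p}. f ((a * x + b) mod int p))"
    by (intro sum.cong refl per) (simp add: cong_def)
  also have "\<dots> = (\<Sum>x\<in>{0..<int p}. f x)" by (rule sum.reindex_bij_betw[OF bij])
  finally show ?thesis .
qed

lemma nonprincipal_witness:
  assumes "\<chi> \<noteq> principal_character p"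
  shows "\<exists>a. \<not> int p dvd a \<and> \<chi> a \<noteq> 1"
proof (rule ccontr)
  assume "\<nexists>a. \<not> int p dvd a \<and> \<chi> a \<noteq> 1"
  then have "\<chi> x = principal_character p x" for x
    using character_eq_0_iff[of x] \<chi> by (auto simp: principal_character_def dirichlet_character_def)
  then show False using assms by auto
qed

lemma nonprincipal_sum:
  assumes "\<chi> \<noteq> principal_character p"
  shows "(\<Sum>x\<in>{0..<int p}. \<chi> x) = 0"
proof -
  obtain a where a: "\<not> int p dvd a" "\<chi> a \<noteq> 1" using nonprincipal_witness[OF assms] by auto
  have "(\<Sum>x\<in>{0..<int p}. \<chi> (a * x + 0)) = (\<Sum>x\<in>{0..<int p}. \<chi> x)"
    by (rule sum_residues_shift[OF character_periodic[OF \<chi>] a(1)])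
  then have "\<chi> a * (\<Sum>x\<in>{0..<int p}. \<chi> x) = (\<Sum>x\<in>{0..<int p}. \<chi> x)"
    by (simp add: character_mult sum_distrib_left)
  then show ?thesis using a(2) by simp
qed

lemma nonprincipal_gt_2:
  assumes "\<chi> \<noteq> principal_character p"
  shows "p > 2"
proof (rule ccontr)
  assume "\<not> p > 2"
  then have p2: "p = 2" using prime_ge_2_nat[OF p] by simp
  obtain a where a: "\<not> int p dvd a" "\<chi> a \<noteq> 1" using nonprincipal_witness[OF assms] by auto
  have "[a = 1] (mod int p)" using a(1) by (simp add: p2 cong_def odd_iff_mod_2_eq_one)
  then show False using character_periodic[OF \<chi>] character_1 a(2) by metis
qed

end

section \<open>The Weil bound for all primes\<close>

text \<open>
  The condition on \<open>d0\<close> makes it a simple root of the polynomial under the character. A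
  negative exponent can be raised by a multiple of \<open>p - 1\<close>, so products of values of \<open>\<chi>\<close> and of its
  complex conjugate are covered.
\<close>

definition weil_bound :: "nat \<Rightarrow> bool" where
  "weil_bound p \<longleftrightarrow> (\<forall>\<chi> (I :: nat set) d0 d e.
     dirichlet_character p \<chi> \<longrightarrow> \<chi> \<noteq> principal_character p \<longrightarrow> finite I \<longrightarrow>
     (\<forall>i\<in>I. \<not> int p dvd d0 - d i) \<longrightarrow>
     cmod (\<Sum>x\<in>{0..<int p}. \<chi> ((x - d0) * (\<Prod>i\<in>I. (x - d i) ^ e i))) \<le> card I * sqrt p)"

context char_p_field
begin

lemma F_1_eq: "F 1 = of_int ` {0..<int p}"
proof (rule card_seteq[symmetric])
  have "(of_int a :: 'a) ^ p = of_int a" for a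
  proof -
    have "of_nat n \<in> F 1" for n :: nat
    proof (induction n)
      case (Suc n)
      then show ?case using F_add[of 1 1 "of_nat n"] by simp
    qed simp
    then have "of_int (int n) \<in> F 1" for n by simp
    then have "of_int a \<in> F 1" by (cases a rule: int_cases2) (auto intro: F_uminus[of _ 1, unfolded One_nat_def])
    then show ?thesis by (simp add: F_iff)
  qed
  then show "of_int ` {0..<int p} \<subseteq> F 1" by (auto simp: F_iff)
  have "inj_on (of_int :: int \<Rightarrow> 'a) {0..<int p}"
    by (rule inj_onI) (simp add: of_int_eq_iff_cong_CHAR CHAR_p cong_def)
  then show "card (F 1) \<le> card (of_int ` {0..<int p} :: 'a set)"
    using card_F[of 1] by (simp add: card_image)
qed (use finite_F[of 1] in simp)

text \<open>
  The substitution \<open>x = d0 - y\<close> turns the sum into the one over \<open>F 1\<close> with distinguished root \<open>0\<close>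
  and further roots \<open>d0 - d i\<close>.
\<close>

lemma weil_bound: "weil_bound p"
  unfolding weil_bound_def
proof (intro allI impI)
  fix \<chi> and I :: "nat set" and d0 :: int and d :: "nat \<Rightarrow> int" and e :: "nat \<Rightarrow> nat"
  assume \<chi>: "dirichlet_character p \<chi>" "\<chi> \<noteq> principal_character p" and I: "finite I"
    and d: "\<forall>i\<in>I. \<not> int p dvd d0 - d i"
  define h :: "'a \<Rightarrow> complex" where "h y = \<chi> (SOME a. of_int a = y)" for y
  have h: "h (of_int a) = \<chi> a" for a
  proof -
    have "of_int (SOME b. of_int b = (of_int a :: 'a)) = (of_int a :: 'a)"
      by (rule someI) simp
    then show ?thesis
      unfolding h_def by (intro character_periodic[OF \<chi>(1)]) (simp add: of_int_eq_iff_cong_CHAR CHAR_p)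
  qed
  have inj: "inj_on (of_int :: int \<Rightarrow> 'a) {0..<int p}"
    by (rule inj_onI) (simp add: of_int_eq_iff_cong_CHAR CHAR_p cong_def)
  have sum_F: "(\<Sum>x\<in>F 1. f x) = (\<Sum>a\<in>{0..<int p}. f (of_int a))" for f :: "'a \<Rightarrow> complex"
    unfolding F_1_eq by (rule sum.reindex[OF inj, unfolded o_def])
  have in_F: "of_int a \<in> F 1" for a
  proof -
    have "of_int a = (of_int (a mod int p) :: 'a)"
      by (simp add: of_int_eq_iff_cong_CHAR CHAR_p cong_def)
    then show ?thesis unfolding F_1_eq using p_gt_1 by auto
  qed
  define d' :: "nat \<Rightarrow> 'a" where "d' i = of_int (d0 - d i)" for i
  interpret product_char_sum p F h I d' e
  proof
    show "p > 2" by (rule nonprincipal_gt_2[OF prime_p \<chi>])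
    show "h (x * y) = h x * h y" if xy: "x \<in> F 1" "y \<in> F 1" for x y
    proof -
      obtain a b where "x = of_int a" "y = of_int b" using xy unfolding F_1_eq by blast
      then show ?thesis by (simp add: h character_mult[OF prime_p \<chi>(1)] flip: of_int_mult)
    qed
    show "h 0 = 0" using h[of 0] character_eq_0_iff[OF prime_p \<chi>(1), of 0] by simp
    show "h 1 = 1" using h[of 1] character_1[OF prime_p \<chi>(1)] by simp
    show "cmod (h x) \<le> 1" if x: "x \<in> F 1" for x
    proof -
      obtain a where "x = of_int a" using x unfolding F_1_eq by blast
      then show ?thesis by (simp add: h norm_character_le_1[OF prime_p \<chi>(1)])
    qed
    show "(\<Sum>x\<in>F 1. h x) = 0" by (simp only: sum_F h nonprincipal_sum[OF prime_p \<chi>])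
    show "finite I" by fact
    show "d' i \<in> F 1" for i unfolding d'_def by (rule in_F)
    show "d' i \<noteq> 0" if "i \<in> I" for i
      using d that by (simp add: d'_def of_int_eq_0_iff_char_dvd CHAR_p del: of_int_diff)
  qed
  obtain C where C: "\<forall>n\<ge>6. cmod (ext_sum n) \<le> C * sqrt p ^ n" using ext_sum_bound by blast
  have "cmod (ext_sum 1) \<le> card I * sqrt p"
    by (rule newton_power_sum_bound[OF L_coeff_0 L_coeff_eq_0 newton])
       (use C p_gt_1 in auto)
  also have "ext_sum 1 = (\<Sum>y\<in>{0..<int p}. \<chi> (- y * (\<Prod>i\<in>I. (d0 - d i - y) ^ e i)))"
  proof -
    have "poly form (of_int y) ^ norm_exp 1 = of_int (- y * (\<Prod>i\<in>I. (d0 - d i - y) ^ e i))" for y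
      by (simp add: form_def poly_prod norm_exp_def d'_def)
    then show ?thesis unfolding ext_sum_def sum_F by (simp only: h)
  qed
  also have "\<dots> = (\<Sum>y\<in>{0..<int p}. \<chi> ((- 1 * y + d0 - d0) * (\<Prod>i\<in>I. (- 1 * y + d0 - d i) ^ e i)))"
    by (intro sum.cong refl arg_cong[of _ _ \<chi>] arg_cong2[of _ _ _ _ "(*)"] arg_cong2[of _ _ _ _ "(^)"] prod.cong) auto
  also have "\<dots> = (\<Sum>x\<in>{0..<int p}. \<chi> ((x - d0) * (\<Prod>i\<in>I. (x - d i) ^ e i)))"
    by (rule sum_residues_shift[OF prime_p \<chi>(1)])
       (use p_gt_1 in \<open>auto intro!: character_periodic[OF \<chi>(1)] cong_mult cong_diff cong_prod cong_pow\<close>)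
  finally show "cmod (\<Sum>x\<in>{0..<int p}. \<chi> ((x - d0) * (\<Prod>i\<in>I. (x - d i) ^ e i))) \<le> card I * sqrt p" .
qed

end

text \<open>
  The argument above needs an algebraically closed type of characteristic \<open>p\<close>, and types cannot
  depend on a variable prime. It suffices, however, to treat one definite prime, chosen as a
  counterexample to the Weil bound if there is any: if the bound holds for this prime, it
  holds for all.
\<close>

definition weil_candidate :: nat where
  "weil_candidate = (if \<exists>p. prime p \<and> \<not> weil_bound p then SOME p. prime p \<and> \<not> weil_bound p else 2)"

lemma prime_weil_candidate: "prime weil_candidate"
  unfolding weil_candidate_def
  using someI_ex[of "\<lambda>p. prime p \<and> \<not> weil_bound p"] by auto

lemma weil_bound_if_candidate:
  assumes "weil_bound weil_candidate" "prime p" shows "weil_bound p"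
proof (rule ccontr)
  assume "\<not> weil_bound p"
  then have ex: "\<exists>p. prime p \<and> \<not> weil_bound p" using assms(2) by blast
  then have "\<not> weil_bound weil_candidate"
    unfolding weil_candidate_def using someI_ex[OF ex] by simp
  then show False using assms(1) by simp
qed

typedef candidate_field = "{0..<int weil_candidate}"
  using prime_gt_0_nat[OF prime_weil_candidate] by (intro exI[of _ 0]) auto

setup_lifting type_definition_candidate_field

lemma candidate_gt_1: "int weil_candidate > 1"
  using prime_gt_1_nat[OF prime_weil_candidate] by simp

instantiation candidate_field :: field
begin

lift_definition zero_candidate_field :: candidate_field is 0
  using candidate_gt_1 by simp
lift_definition one_candidate_field :: candidate_field is 1
  using candidate_gt_1 by simp
lift_definition plus_candidate_field :: "candidate_field \<Rightarrow> candidate_field \<Rightarrow> candidate_field"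
  is "\<lambda>x y. (x + y) mod int weil_candidate" using candidate_gt_1 by simp
lift_definition minus_candidate_field :: "candidate_field \<Rightarrow> candidate_field \<Rightarrow> candidate_field"
  is "\<lambda>x y. (x - y) mod int weil_candidate" using candidate_gt_1 by simp
lift_definition uminus_candidate_field :: "candidate_field \<Rightarrow> candidate_field"
  is "\<lambda>x. (- x) mod int weil_candidate" using candidate_gt_1 by simp
lift_definition times_candidate_field :: "candidate_field \<Rightarrow> candidate_field \<Rightarrow> candidate_field"
  is "\<lambda>x y. (x * y) mod int weil_candidate" using candidate_gt_1 by simp
lift_definition inverse_candidate_field :: "candidate_field \<Rightarrow> candidate_field"
  is "\<lambda>x. if x = 0 then 0 else (x ^ (weil_candidate - 2)) mod int weil_candidate"
  using candidate_gt_1 by simp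
definition divide_candidate_field :: "candidate_field \<Rightarrow> candidate_field \<Rightarrow> candidate_field"
  where "divide_candidate_field x y = x * inverse y"

instance
proof
  fix a b c :: candidate_field
  show "a * b * c = a * (b * c)" by transfer (simp add: mod_simps mult_ac)
  show "a * b = b * a" by transfer (simp add: mult_ac)
  show "1 * a = a" by transfer simp
  show "a + b + c = a + (b + c)" by transfer (simp add: mod_simps add_ac)
  show "a + b = b + a" by transfer (simp add: add_ac)
  show "0 + a = a" by transfer simp
  show "- a + a = 0" by transfer (simp add: mod_simps)
  show "a - b = a + - b" by transfer (simp add: mod_simps)
  show "(a + b) * c = a * c + b * c" by transfer (simp add: mod_simps algebra_simps)
  show "(0::candidate_field) \<noteq> 1" by transfer simp
  show "a div b = a * inverse b" by (simp add: divide_candidate_field_def)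
  show "inverse (0::candidate_field) = 0" by transfer simp
  show "inverse a * a = 1" if "a \<noteq> 0"
    using that
  proof transfer
    fix a :: int assume a: "a \<in> {0..<int weil_candidate}" "a \<noteq> 0"
    define n where "n = nat a"
    have n: "a = int n" "0 < n" "n < weil_candidate" using a by (auto simp: n_def)
    then have "\<not> weil_candidate dvd n" by (auto dest: dvd_imp_le)
    from fermat_theorem[OF prime_weil_candidate this]
    have "[int (n ^ (weil_candidate - 1)) = 1] (mod int weil_candidate)"
      by (metis cong_int_iff of_nat_1)
    moreover have "weil_candidate - 1 = Suc (weil_candidate - 2)"
      using candidate_gt_1 by simp
    ultimately have "[a ^ (weil_candidate - 2) * a = 1] (mod int weil_candidate)"
      by (simp add: n mult.commute)
    then show "(if a = 0 then 0 else a ^ (weil_candidate - 2) mod int weil_candidate) * a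
        mod int weil_candidate = 1"
      using a candidate_gt_1 by (simp add: cong_def mod_simps)
  qed
qed

end

lemma CHAR_candidate_field: "CHAR(candidate_field) = weil_candidate"
proof (rule CHAR_eqI)
  have rep: "Rep_candidate_field (of_nat n) = int n mod int weil_candidate" for n
    by (induction n)
       (simp_all add: zero_candidate_field.rep_eq plus_candidate_field.rep_eq one_candidate_field.rep_eq mod_simps)
  have "Rep_candidate_field (of_nat n) = Rep_candidate_field 0 \<longleftrightarrow> weil_candidate dvd n" for n
    unfolding rep by (simp add: zero_candidate_field.rep_eq flip: zmod_int dvd_eq_mod_eq_0)
  then have *: "of_nat n = (0 :: candidate_field) \<longleftrightarrow> weil_candidate dvd n" for n
    by (simp add: Rep_candidate_field_inject)
  show "of_nat weil_candidate = (0 :: candidate_field)" by (simp add: *)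
  show "weil_candidate dvd n" if "of_nat n = (0 :: candidate_field)" for n
    using that by (simp add: *)
qed

lemma weil_bound_prime:
  assumes "prime p" shows "weil_bound p"
proof (rule weil_bound_if_candidate[OF _ assms])
  interpret char_p_field weil_candidate
    "\<lambda>n. {x :: candidate_field alg_closure. x ^ (weil_candidate ^ n) = x}"
    by standard (auto simp: prime_weil_candidate CHAR_candidate_field)
  show "weil_bound weil_candidate" by (rule weil_bound)
qed

section \<open>Moments of shifted character sums\<close>

text \<open>
  The enumeration may repeat elements; this lets a set with at most \<open>r\<close> elements be coded by a tuple
  of length exactly \<open>r\<close>.
\<close>

lemma exists_enumeration:
  assumes "finite V" "V \<noteq> {}" "card V \<le> r"
  shows "\<exists>u. u ` {..<r} = V"
proof -
  obtain h where h: "bij_betw h {0..<card V} V" using ex_bij_betw_nat_finite[OF assms(1)] by blast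
  then have h: "h ` {0..<card V} = V" by (simp add: bij_betw_def)
  have pos: "0 < card V" using assms by (simp add: card_gt_0_iff)
  define u where "u i = (if i < card V then h i else h 0)" for i
  have "u ` {..<r} = V"
  proof (intro equalityI subsetI)
    fix y assume "y \<in> u ` {..<r}"
    then show "y \<in> V" using h pos by (auto simp: u_def)
  next
    fix y assume "y \<in> V"
    then obtain i where "i < card V" "y = h i" using h by (metis atLeast0LessThan imageE lessThan_iff)
    then show "y \<in> u ` {..<r}" using assms(3) by (intro image_eqI[of _ _ i]) (auto simp: u_def)
  qed
  then show ?thesis by blast
qed

text \<open>
  A tuple of length \<open>2 r\<close> in which every entry is repeated has at most \<open>r\<close> distinct values, so it is the
  composition of a map into \<open>r\<close> labels with a labelling by elements of \<open>D\<close>.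
\<close>

lemma card_repeating_tuples_le:
  fixes D :: "'d set"
  assumes "finite D" "r \<ge> 1"
  shows "card {g \<in> {..<2 * r} \<rightarrow>\<^sub>E D. \<forall>i<2 * r. \<exists>j<2 * r. j \<noteq> i \<and> g j = g i} \<le> r ^ (2 * r) * card D ^ r"
proof -
  define Bad where "Bad = {g \<in> {..<2 * r} \<rightarrow>\<^sub>E D. \<forall>i<2 * r. \<exists>j<2 * r. j \<noteq> i \<and> g j = g i}"
  define \<Phi> where "\<Phi> = (\<lambda>(s :: nat \<Rightarrow> nat, u :: nat \<Rightarrow> 'd). restrict (\<lambda>i. u (s i)) {..<2 * r})"
  have "Bad \<subseteq> \<Phi> ` (({..<2 * r} \<rightarrow>\<^sub>E {..<r}) \<times> ({..<r} \<rightarrow>\<^sub>E D))"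
  proof
    fix g assume g: "g \<in> Bad"
    define V where "V = g ` {..<2 * r}"
    have V: "finite V" "V \<noteq> {}" "V \<subseteq> D" using g assms(2) by (auto simp: V_def Bad_def lessThan_empty_iff)
    have "2 * card V = (\<Sum>v\<in>V. 2)" by simp
    also have "\<dots> \<le> (\<Sum>v\<in>V. card {i \<in> {..<2 * r}. g i = v})"
    proof (rule sum_mono)
      fix v assume "v \<in> V"
      then obtain i where i: "i < 2 * r" "v = g i" by (auto simp: V_def)
      then obtain j where j: "j < 2 * r" "j \<noteq> i" "g j = g i" using g by (auto simp: Bad_def)
      have "card {i, j} \<le> card {i \<in> {..<2 * r}. g i = v}"
        using i j by (intro card_mono) auto
      then show "2 \<le> card {i \<in> {..<2 * r}. g i = v}" using j(2) by simp
    qed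
    also have "\<dots> = (\<Sum>v\<in>V. \<Sum>i\<in>{i \<in> {..<2 * r}. g i = v}. 1)" by simp
    also have "\<dots> = (\<Sum>i<2 * r. 1)"
      using V(1) by (intro sum.group) (auto simp: V_def)
    finally have "card V \<le> r" by simp
    then obtain u where u: "u ` {..<r} = V" using exists_enumeration[OF V(1,2)] by blast
    have "\<exists>k<r. u k = g i" if "i < 2 * r" for i
    proof -
      have "g i \<in> u ` {..<r}" using that unfolding u V_def by simp
      then show ?thesis by force
    qed
    then obtain s where s: "\<And>i. i < 2 * r \<Longrightarrow> s i < r \<and> u (s i) = g i" by metis
    define s' where "s' = restrict s {..<2 * r}"
    define u' where "u' = restrict u {..<r}"
    have "g = \<Phi> (s', u')"
    proof
      fix i
      show "g i = \<Phi> (s', u') i"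
      proof (cases "i < 2 * r")
        case True
        then show ?thesis using s by (simp add: \<Phi>_def s'_def u'_def)
      next
        case False
        have "g \<in> {..<2 * r} \<rightarrow>\<^sub>E D" using g by (simp add: Bad_def)
        then have "g i = undefined" by (rule PiE_arb) (use False in simp)
        then show ?thesis using False by (simp add: \<Phi>_def)
      qed
    qed
    moreover have "s' \<in> {..<2 * r} \<rightarrow>\<^sub>E {..<r}" using s by (auto simp: s'_def)
    moreover have "u' \<in> {..<r} \<rightarrow>\<^sub>E D" using u V(3) by (auto simp: u'_def)
    ultimately show "g \<in> \<Phi> ` (({..<2 * r} \<rightarrow>\<^sub>E {..<r}) \<times> ({..<r} \<rightarrow>\<^sub>E D))" by blast
  qed
  moreover have "finite (({..<2 * r} \<rightarrow>\<^sub>E {..<r}) \<times> ({..<r} \<rightarrow>\<^sub>E D))"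
    using assms by (intro finite_cartesian_product finite_PiE) auto
  ultimately have "card Bad \<le> card (({..<2 * r} \<rightarrow>\<^sub>E {..<r}) \<times> ({..<r} \<rightarrow>\<^sub>E D))"
    by (rule surj_card_le[rotated])
  also have "\<dots> = r ^ (2 * r) * card D ^ r" by (simp add: card_cartesian_product card_PiE)
  finally show ?thesis by (simp only: Bad_def)
qed

context
  fixes p :: nat and \<chi> :: "int \<Rightarrow> complex"
  assumes p: "prime p" and \<chi>: "dirichlet_character p \<chi>" and nonprincipal: "\<chi> \<noteq> principal_character p"
begin

lemma cnj_character: "cnj (\<chi> x) = \<chi> (x ^ (p - 2))"
proof (cases "int p dvd x")
  case True
  have "p - 2 > 0" using nonprincipal_gt_2[OF p \<chi> nonprincipal] by simp
  then have "int p dvd x ^ (p - 2)" using True by (simp add: dvd_power_iff dvd_trans[OF True])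
  then show ?thesis using True by (simp add: character_eq_0_iff[OF p \<chi>, THEN iffD2])
next
  case False
  have "p - 1 = Suc (p - 2)" using nonprincipal_gt_2[OF p \<chi> nonprincipal] by simp
  then have "\<chi> x * \<chi> (x ^ (p - 2)) = 1"
    using character_fermat[OF p \<chi> False] by (simp add: character_power[OF p \<chi>])
  moreover have "\<chi> x * cnj (\<chi> x) = 1"
    using norm_character[OF p \<chi>, of x] False by (simp add: complex_norm_square[symmetric])
  moreover have "\<chi> x \<noteq> 0" using False character_eq_0_iff[OF p \<chi>] by blast
  ultimately show ?thesis by (metis mult_left_cancel)
qed

lemma mixed_character_sum_bound_aux:
  fixes g :: "nat \<Rightarrow> int" and \<sigma> :: "nat \<Rightarrow> bool"
  assumes "finite J" "i0 \<in> J" "\<sigma> i0" "\<And>i. i \<in> J \<Longrightarrow> i \<noteq> i0 \<Longrightarrow> \<not> int p dvd g i0 - g i"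
  shows "cmod (\<Sum>x\<in>{0..<int p}. \<Prod>i\<in>J. if \<sigma> i then \<chi> (x - g i) else cnj (\<chi> (x - g i))) \<le> card J * sqrt p"
proof -
  define e where "e i = (if \<sigma> i then 1 else p - 2)" for i
  have "(\<Prod>i\<in>J. if \<sigma> i then \<chi> (x - g i) else cnj (\<chi> (x - g i)))
      = \<chi> ((x - g i0) * (\<Prod>i\<in>J - {i0}. (x - g i) ^ e i))" for x
  proof -
    have "(\<Prod>i\<in>J. if \<sigma> i then \<chi> (x - g i) else cnj (\<chi> (x - g i))) = (\<Prod>i\<in>J. \<chi> ((x - g i) ^ e i))"
      by (intro prod.cong refl) (simp add: e_def cnj_character)
    also have "\<dots> = \<chi> ((x - g i0) ^ e i0) * (\<Prod>i\<in>J - {i0}. \<chi> ((x - g i) ^ e i))"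
      by (rule prod.remove) fact+
    finally show ?thesis
      using assms(3) by (simp add: e_def character_mult[OF p \<chi>] character_prod[OF p \<chi>])
  qed
  then have "cmod (\<Sum>x\<in>{0..<int p}. \<Prod>i\<in>J. if \<sigma> i then \<chi> (x - g i) else cnj (\<chi> (x - g i)))
      = cmod (\<Sum>x\<in>{0..<int p}. \<chi> ((x - g i0) * (\<Prod>i\<in>J - {i0}. (x - g i) ^ e i)))"
    by simp
  also have "\<dots> \<le> card (J - {i0}) * sqrt p"
    using weil_bound_prime[OF p, unfolded weil_bound_def] \<chi> nonprincipal assms by blast
  also have "\<dots> \<le> card J * sqrt p"
    using assms(1) by (intro mult_right_mono) (auto intro: card_mono)
  finally show ?thesis .
qed

text \<open>
  If the simple root \<open>g i0\<close> belongs to a conjugated factor, pass to the complex conjugate of the whole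
  sum.
\<close>

lemma mixed_character_sum_bound:
  fixes g :: "nat \<Rightarrow> int" and \<sigma> :: "nat \<Rightarrow> bool"
  assumes "finite J" "i0 \<in> J" "\<And>i. i \<in> J \<Longrightarrow> i \<noteq> i0 \<Longrightarrow> \<not> int p dvd g i0 - g i"
  shows "cmod (\<Sum>x\<in>{0..<int p}. \<Prod>i\<in>J. if \<sigma> i then \<chi> (x - g i) else cnj (\<chi> (x - g i))) \<le> card J * sqrt p"
proof (cases "\<sigma> i0")
  case True
  then show ?thesis using mixed_character_sum_bound_aux assms by blast
next
  case False
  have "cnj (\<Sum>x\<in>{0..<int p}. \<Prod>i\<in>J. if \<sigma> i then \<chi> (x - g i) else cnj (\<chi> (x - g i)))
      = (\<Sum>x\<in>{0..<int p}. \<Prod>i\<in>J. if \<not> \<sigma> i then \<chi> (x - g i) else cnj (\<chi> (x - g i)))"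
    unfolding cnj_sum cnj_prod by (intro sum.cong prod.cong refl) simp
  then show ?thesis
    using mixed_character_sum_bound_aux[of J i0 "\<lambda>i. \<not> \<sigma> i" g] assms False
    by (metis complex_mod_cnj)
qed

text \<open>
  Expand the \<open>2 r\<close>-th power into a sum over tuples, \<open>r\<close> factors being conjugated. A tuple
  with an unrepeated entry gives a complete sum with a simple root, which is \<open>O(\<surd>p)\<close>; the other
  tuples are rare and are estimated trivially by \<open>p\<close>.
\<close>

lemma moment_bound:
  fixes D :: "int set" and \<alpha> :: "int \<Rightarrow> complex"
  assumes D: "D \<subseteq> {1..int p - 1}" and \<alpha>: "\<And>d. d \<in> D \<Longrightarrow> cmod (\<alpha> d) \<le> 1" and r: "r \<ge> 1"
  shows "(\<Sum>x\<in>{0..<int p}. cmod (\<Sum>d\<in>D. \<alpha> d * \<chi> (x - d)) ^ (2 * r))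
    \<le> real (r ^ (2 * r)) * real (card D) ^ r * p + real (card D) ^ (2 * r) * (2 * real r * sqrt p)"
proof -
  have finD: "finite D" using D by (rule finite_subset) simp
  define J where "J = {..<2 * r}"
  define T where "T = J \<rightarrow>\<^sub>E D"
  define Bad where "Bad = {g \<in> T. \<forall>i<2 * r. \<exists>j<2 * r. j \<noteq> i \<and> g j = g i}"
  define \<sigma> where "\<sigma> i \<longleftrightarrow> i < r" for i :: nat
  define G where "G i d x = (if \<sigma> i then \<alpha> d * \<chi> (x - d) else cnj (\<alpha> d * \<chi> (x - d)))" for i :: nat and d x
  define H where "H g x = (\<Prod>i\<in>J. if \<sigma> i then \<chi> (x - g i) else cnj (\<chi> (x - g i)))" for g x
  define a where "a g = (\<Prod>i\<in>J. if \<sigma> i then \<alpha> (g i) else cnj (\<alpha> (g i)))" for g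
  have finT: "finite T" unfolding T_def J_def using finD by (intro finite_PiE) auto
  have expand: "of_real (cmod (\<Sum>d\<in>D. \<alpha> d * \<chi> (x - d)) ^ (2 * r)) = (\<Sum>g\<in>T. a g * H g x)" for x
  proof -
    define w where "w = (\<Sum>d\<in>D. \<alpha> d * \<chi> (x - d))"
    have "of_real (cmod w ^ (2 * r)) = complex_of_real ((cmod w)\<^sup>2) ^ r"
      by (simp add: power_mult)
    also have "\<dots> = (w * cnj w) ^ r" by (simp only: complex_norm_square)
    also have "\<dots> = (\<Prod>i<r. w) * (\<Prod>i\<in>{r..<2 * r}. cnj w)" by (simp add: power_mult_distrib)
    also have "\<dots> = (\<Prod>i<r. \<Sum>d\<in>D. G i d x) * (\<Prod>i\<in>{r..<2 * r}. \<Sum>d\<in>D. G i d x)"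
      by (intro arg_cong2[of _ _ _ _ "(*)"] prod.cong refl) (simp_all add: G_def \<sigma>_def w_def)
    also have "\<dots> = (\<Prod>i\<in>J. \<Sum>d\<in>D. G i d x)"
      unfolding J_def lessThan_atLeast0 by (rule prod.atLeastLessThan_concat) auto
    also have "\<dots> = (\<Sum>g\<in>T. \<Prod>i\<in>J. G i (g i) x)"
      unfolding T_def by (rule prod_sum_PiE) (auto simp: J_def finD)
    also have "\<dots> = (\<Sum>g\<in>T. a g * H g x)"
      unfolding a_def H_def prod.distrib[symmetric] by (intro sum.cong prod.cong refl) (simp add: G_def)
    finally show ?thesis by (simp only: w_def)
  qed
  have a_le: "cmod (a g) \<le> 1" if "g \<in> T" for g
    unfolding a_def prod_norm[symmetric] using that \<alpha> by (intro prod_le_1) (auto simp: T_def)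
  have H_le: "cmod (H g x) \<le> 1" for g x
    unfolding H_def prod_norm[symmetric] by (intro prod_le_1) (auto simp: norm_character_le_1[OF p \<chi>])
  have "of_real (\<Sum>x\<in>{0..<int p}. cmod (\<Sum>d\<in>D. \<alpha> d * \<chi> (x - d)) ^ (2 * r))
      = (\<Sum>x\<in>{0..<int p}. \<Sum>g\<in>T. a g * H g x)"
    by (simp only: of_real_sum expand)
  also have "\<dots> = (\<Sum>g\<in>T. a g * (\<Sum>x\<in>{0..<int p}. H g x))"
    by (subst sum.swap) (simp add: sum_distrib_left)
  finally have eq: "of_real (\<Sum>x\<in>{0..<int p}. cmod (\<Sum>d\<in>D. \<alpha> d * \<chi> (x - d)) ^ (2 * r))
      = (\<Sum>g\<in>T. a g * (\<Sum>x\<in>{0..<int p}. H g x))" .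
  have "(\<Sum>x\<in>{0..<int p}. cmod (\<Sum>d\<in>D. \<alpha> d * \<chi> (x - d)) ^ (2 * r))
      = cmod (of_real (\<Sum>x\<in>{0..<int p}. cmod (\<Sum>d\<in>D. \<alpha> d * \<chi> (x - d)) ^ (2 * r)))"
    unfolding norm_of_real by (intro abs_of_nonneg[symmetric] sum_nonneg) auto
  also have "\<dots> \<le> (\<Sum>g\<in>T. cmod (a g * (\<Sum>x\<in>{0..<int p}. H g x)))"
    unfolding eq by (rule norm_sum)
  also have "\<dots> \<le> (\<Sum>g\<in>T. cmod (\<Sum>x\<in>{0..<int p}. H g x))"
  proof (rule sum_mono)
    fix g assume "g \<in> T"
    then show "cmod (a g * (\<Sum>x\<in>{0..<int p}. H g x)) \<le> cmod (\<Sum>x\<in>{0..<int p}. H g x)"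
      unfolding norm_mult using a_le by (intro mult_left_le_one_le) auto
  qed
  also have "\<dots> = (\<Sum>g\<in>Bad. cmod (\<Sum>x\<in>{0..<int p}. H g x)) + (\<Sum>g\<in>T - Bad. cmod (\<Sum>x\<in>{0..<int p}. H g x))"
    using finT by (subst add.commute, intro sum.subset_diff) (auto simp: Bad_def)
  also have "\<dots> \<le> (\<Sum>g\<in>Bad. real p) + (\<Sum>g\<in>T - Bad. 2 * real r * sqrt p)"
  proof (intro add_mono sum_mono)
    fix g
    have "cmod (\<Sum>x\<in>{0..<int p}. H g x) \<le> (\<Sum>x\<in>{0..<int p}. 1)"
      by (rule order_trans[OF norm_sum]) (intro sum_mono H_le)
    then show "cmod (\<Sum>x\<in>{0..<int p}. H g x) \<le> real p" by simp
  next
    fix g assume g: "g \<in> T - Bad"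
    then obtain i0 where i0: "i0 < 2 * r" "\<And>j. j < 2 * r \<Longrightarrow> j \<noteq> i0 \<Longrightarrow> g j \<noteq> g i0"
      by (auto simp: Bad_def)
    have "\<not> int p dvd g i0 - g i" if "i \<in> J" "i \<noteq> i0" for i
    proof -
      have "g i \<in> D" "g i0 \<in> D"
        using g that i0(1) PiE_mem[of g J "\<lambda>_. D"] by (auto simp: T_def J_def)
      then have "g i \<in> {1..int p - 1}" "g i0 \<in> {1..int p - 1}" using D by blast+
      moreover have "g i0 - g i \<noteq> 0" using i0(2)[of i] that by (simp add: J_def)
      ultimately have "\<bar>g i0 - g i\<bar> < int p" "g i0 - g i \<noteq> 0" by auto
      then show ?thesis using dvd_imp_le_int[of "g i0 - g i" "int p"] by auto
    qed
    then have "cmod (\<Sum>x\<in>{0..<int p}. H g x) \<le> card J * sqrt p"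
      unfolding H_def by (intro mixed_character_sum_bound[of J i0]) (use i0 in \<open>auto simp: J_def\<close>)
    then show "cmod (\<Sum>x\<in>{0..<int p}. H g x) \<le> 2 * real r * sqrt p" by (simp add: J_def)
  qed
  also have "\<dots> = card Bad * real p + card (T - Bad) * (2 * real r * sqrt p)" by simp
  also have "\<dots> \<le> real (r ^ (2 * r) * card D ^ r) * p + real (card D ^ (2 * r)) * (2 * real r * sqrt p)"
  proof (intro add_mono mult_right_mono of_nat_mono)
    show "card Bad \<le> r ^ (2 * r) * card D ^ r"
      unfolding Bad_def T_def J_def by (rule card_repeating_tuples_le[OF finD r])
    have "card (T - Bad) \<le> card T" using finT by (intro card_mono) auto
    then show "card (T - Bad) \<le> card D ^ (2 * r)" by (simp add: T_def J_def card_PiE)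
  qed auto
  finally show ?thesis by simp
qed

end

section \<open>The divisor bound\<close>

abbreviation divisor_count :: "nat \<Rightarrow> nat" where
  "divisor_count n \<equiv> card {d. d dvd n}"

lemma divisor_count_mult_le:
  assumes "a > 0" "b > 0"
  shows "divisor_count (a * b) \<le> divisor_count a * divisor_count b"
proof -
  have "{d. d dvd a * b} \<subseteq> (\<lambda>(x, y). x * y) ` ({d. d dvd a} \<times> {d. d dvd b})"
    using division_decomp by force
  moreover have "finite ({d. d dvd a} \<times> {d. d dvd b})" using assms by auto
  ultimately have "divisor_count (a * b) \<le> card ({d. d dvd a} \<times> {d. d dvd b})"
    by (rule surj_card_le[rotated])
  then show ?thesis by (simp add: card_cartesian_product)
qed

lemma divisor_count_prime_power_le:
  assumes "prime (q :: nat)" shows "divisor_count (q ^ v) \<le> v + 1"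
proof -
  have "{d. d dvd q ^ v} \<subseteq> (\<lambda>i. q ^ i) ` {..v}"
    using divides_primepow_nat[OF assms] by auto
  from surj_card_le[OF _ this] show ?thesis by simp
qed

text \<open>
  The number of divisors is at most the product of \<open>v + 1\<close> over the prime powers \<open>q\<^sup>v\<close> exactly dividing
  \<open>n\<close>. If \<open>q\<^sup>\<delta> \<ge> 2\<close>, the factor \<open>v + 1 \<le> 2\<^sup>v\<close> is at most \<open>(q\<^sup>v)\<^sup>\<delta>\<close>; each of the finitely many other
  primes costs at most a constant \<open>C0\<close> more.
\<close>

lemma divisor_bound:
  fixes \<delta> :: real assumes \<delta>: "\<delta> > 0"
  shows "\<exists>C\<ge>1. \<forall>n\<ge>1. divisor_count n \<le> C * real n powr \<delta>"
proof -
  define Sm where "Sm = {q::nat. prime q \<and> real q powr \<delta> < 2}"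
  define C0 where "C0 = 1 + 1 / (\<delta> * ln 2)"
  have C0: "C0 \<ge> 1" using \<delta> by (simp add: C0_def)
  have fin: "finite Sm"
  proof (rule finite_subset)
    show "Sm \<subseteq> {.. nat \<lceil>2 powr (1 / \<delta>)\<rceil>}"
    proof
      fix q assume q: "q \<in> Sm"
      then have "real q = (real q powr \<delta>) powr (1 / \<delta>)" using \<delta> by (simp add: powr_powr)
      also have "\<dots> \<le> 2 powr (1 / \<delta>)" using q \<delta> by (intro powr_mono2) (auto simp: Sm_def)
      finally have "real q \<le> 2 powr (1 / \<delta>)" .
      then show "q \<in> {.. nat \<lceil>2 powr (1 / \<delta>)\<rceil>}" by (simp add: le_nat_iff) linarith
    qed
  qed simp
  have small: "real v + 1 \<le> C0 * real (q ^ v) powr \<delta>" if "q \<ge> 2" for q v :: nat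
  proof -
    have "1 + \<delta> * ln 2 * v \<le> exp (\<delta> * ln 2 * v)" by (rule exp_ge_add_one_self)
    also have "exp (\<delta> * ln 2 * v) = (2 powr v) powr \<delta>" by (simp add: powr_powr powr_def mult_ac)
    also have "\<dots> \<le> real (q ^ v) powr \<delta>"
    proof (intro powr_mono2)
      have "2 powr real v = 2 ^ v" by (simp add: powr_realpow)
      also have "\<dots> \<le> real q ^ v" using that by (intro power_mono) auto
      finally show "2 powr real v \<le> real (q ^ v)" by simp
    qed (use \<delta> in auto)
    finally have le: "1 + \<delta> * ln 2 * v \<le> real (q ^ v) powr \<delta>" .
    have pos: "\<delta> * ln 2 > 0" using \<delta> by simp
    have "real v = (\<delta> * ln 2 * v) / (\<delta> * ln 2)" using \<delta> by simp
    also have "\<dots> \<le> real (q ^ v) powr \<delta> / (\<delta> * ln 2)"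
      using le pos by (intro divide_right_mono) auto
    finally have "real v \<le> real (q ^ v) powr \<delta> / (\<delta> * ln 2)" .
    moreover have "1 \<le> real (q ^ v) powr \<delta>" using le pos mult_nonneg_nonneg[of "\<delta> * ln 2" "real v"] by linarith
    ultimately show ?thesis by (simp add: C0_def distrib_right)
  qed
  have large: "real v + 1 \<le> real (q ^ v) powr \<delta>" if "real q powr \<delta> \<ge> 2" for q v :: nat
  proof -
    have "real v + 1 \<le> 2 ^ v" by (induction v) auto
    also have "\<dots> \<le> (real q powr \<delta>) ^ v" using that by (intro power_mono) auto
    also have "\<dots> = real (q ^ v) powr \<delta>"
      using that by (cases "q = 0") (auto simp: powr_powr mult.commute simp flip: powr_realpow)
    finally show ?thesis .
  qed
  have main: "divisor_count n \<le> C0 ^ card {q\<in>Sm. q dvd n} * real n powr \<delta>" if "n \<ge> 1" for n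
    using that
  proof (induction n rule: less_induct)
    case (less n)
    show ?case
    proof (cases "n = 1")
      case False
      then obtain q where q: "prime q" "q dvd n" using prime_factor_nat by blast
      define v where "v = multiplicity q n"
      have v: "v \<ge> 1" using q less.prems by (simp add: v_def Suc_le_eq prime_multiplicity_gt_zero_iff)
      have "n \<noteq> 0" "\<not> is_unit q" using less.prems prime_gt_1_nat[OF q(1)] by auto
      then obtain m where m: "n = q ^ v * m" "\<not> q dvd m"
        using multiplicity_decompose'[of n q] unfolding v_def by blast
      have m1: "m \<ge> 1" using m less.prems by (cases m) auto
      have "q ^ v > 1" using v prime_gt_1_nat[OF q(1)] by (intro one_less_power) auto
      then have mn: "m < n" using m(1) m1 by simp
      have split: "{q'\<in>Sm. q' dvd m} \<subseteq> {q'\<in>Sm. q' dvd n} - {q}" using m by auto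
      have finn: "finite {q'\<in>Sm. q' dvd n}" using fin by simp
      have powr: "real n powr \<delta> = real (q ^ v) powr \<delta> * real m powr \<delta>"
        by (simp add: m(1) powr_mult)
      have "real (divisor_count n) \<le> real ((v + 1) * divisor_count m)"
        unfolding m(1) using divisor_count_mult_le[of "q ^ v" m] divisor_count_prime_power_le[OF q(1), of v] m1 prime_gt_0_nat[OF q(1)]
        by (intro of_nat_mono order_trans[OF divisor_count_mult_le] mult_le_mono1) auto
      also have "\<dots> = (real v + 1) * real (divisor_count m)"
        by (simp only: of_nat_mult of_nat_add of_nat_1)
      also have "\<dots> \<le> (real v + 1) * (C0 ^ card {q'\<in>Sm. q' dvd m} * real m powr \<delta>)"
        by (intro mult_left_mono less.IH mn m1) simp
      also have "\<dots> \<le> C0 ^ card {q\<in>Sm. q dvd n} * real n powr \<delta>"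
      proof (cases "q \<in> Sm")
        case True
        then have qn: "q \<in> {q'\<in>Sm. q' dvd n}" using q by simp
        have "Suc (card {q'\<in>Sm. q' dvd m}) \<le> Suc (card ({q'\<in>Sm. q' dvd n} - {q}))"
          using card_mono[OF _ split] finn by simp
        also have "\<dots> = card {q'\<in>Sm. q' dvd n}" using finn qn by (rule card_Suc_Diff1)
        finally have "C0 ^ Suc (card {q'\<in>Sm. q' dvd m}) \<le> C0 ^ card {q'\<in>Sm. q' dvd n}"
          using C0 by (rule power_increasing)
        then have *: "C0 * C0 ^ card {q'\<in>Sm. q' dvd m} \<le> C0 ^ card {q'\<in>Sm. q' dvd n}" by simp
        have "(real v + 1) * (C0 ^ card {q'\<in>Sm. q' dvd m} * real m powr \<delta>)
            \<le> (C0 * real (q ^ v) powr \<delta>) * (C0 ^ card {q'\<in>Sm. q' dvd m} * real m powr \<delta>)"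
          using small[OF prime_ge_2_nat[OF q(1)], of v] C0 by (intro mult_right_mono) auto
        also have "\<dots> = (C0 * C0 ^ card {q'\<in>Sm. q' dvd m}) * real n powr \<delta>"
          by (simp only: powr mult_ac)
        also have "\<dots> \<le> C0 ^ card {q'\<in>Sm. q' dvd n} * real n powr \<delta>"
          using * by (intro mult_right_mono) auto
        finally show ?thesis .
      next
        case False
        then have ge: "real q powr \<delta> \<ge> 2" using q by (simp add: Sm_def)
        have "card {q'\<in>Sm. q' dvd m} \<le> card {q'\<in>Sm. q' dvd n}"
          using card_mono[OF finn, of "{q'\<in>Sm. q' dvd m}"] split by blast
        then have *: "C0 ^ card {q'\<in>Sm. q' dvd m} \<le> C0 ^ card {q'\<in>Sm. q' dvd n}"
          using C0 by (rule power_increasing)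
        have "(real v + 1) * (C0 ^ card {q'\<in>Sm. q' dvd m} * real m powr \<delta>)
            \<le> real (q ^ v) powr \<delta> * (C0 ^ card {q'\<in>Sm. q' dvd m} * real m powr \<delta>)"
          using large[OF ge, of v] C0 by (intro mult_right_mono) auto
        also have "\<dots> = C0 ^ card {q'\<in>Sm. q' dvd m} * real n powr \<delta>"
          by (simp only: powr mult_ac)
        also have "\<dots> \<le> C0 ^ card {q'\<in>Sm. q' dvd n} * real n powr \<delta>"
          using * by (intro mult_right_mono) auto
        finally show ?thesis .
      qed
      finally show ?thesis .
    qed (use C0 in simp)
  qed
  show ?thesis
  proof (intro exI[of _ "C0 ^ card Sm"] conjI allI impI)
    fix n :: nat assume n: "n \<ge> 1"
    have "C0 ^ card {q\<in>Sm. q dvd n} \<le> C0 ^ card Sm"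
      using C0 fin by (intro power_increasing card_mono) auto
    then have "C0 ^ card {q\<in>Sm. q dvd n} * real n powr \<delta> \<le> C0 ^ card Sm * real n powr \<delta>"
      by (intro mult_right_mono) auto
    then show "divisor_count n \<le> C0 ^ card Sm * real n powr \<delta>" using main[OF n] by linarith
  qed (use C0 one_le_power in auto)
qed

section \<open>Hoelder's inequality\<close>

text \<open>
  Sum the tangent inequality for the \<open>r\<close>-th power at the weighted mean \<open>\<mu>\<close>; the linear terms cancel.
\<close>

lemma weighted_power_mean:
  fixes \<nu> w :: "'x \<Rightarrow> real"
  assumes "\<And>x. x \<in> Y \<Longrightarrow> \<nu> x \<ge> 0" "\<And>x. x \<in> Y \<Longrightarrow> w x \<ge> 0" and r: "r \<ge> 1"
  shows "(\<Sum>x\<in>Y. \<nu> x * w x) ^ r \<le> (\<Sum>x\<in>Y. \<nu> x) ^ (r - 1) * (\<Sum>x\<in>Y. \<nu> x * w x ^ r)"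
proof -
  define S where "S = (\<Sum>x\<in>Y. \<nu> x)"
  define P where "P = (\<Sum>x\<in>Y. \<nu> x * w x)"
  have S0: "S \<ge> 0" and P0: "P \<ge> 0" unfolding S_def P_def using assms by (auto intro!: sum_nonneg)
  have rhs: "S ^ (r - 1) * (\<Sum>x\<in>Y. \<nu> x * w x ^ r) \<ge> 0"
    using assms S0 by (auto intro!: mult_nonneg_nonneg sum_nonneg)
  show ?thesis
  proof (cases "P = 0")
    case True
    then show ?thesis using rhs r by (simp add: P_def[symmetric] S_def[symmetric] zero_power)
  next
    case False
    then have Ppos: "P > 0" using P0 by simp
    have Spos: "S > 0"
    proof (rule ccontr)
      assume "\<not> S > 0"
      then have S: "S = 0" using S0 by simp
      have "P = 0"
      proof (cases "finite Y")
        case True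
        then have "\<forall>x\<in>Y. \<nu> x = 0" using S assms(1) by (simp add: S_def sum_nonneg_eq_0_iff)
        then show ?thesis by (simp add: P_def)
      qed (simp add: P_def)
      then show False using Ppos by simp
    qed
    define \<mu> where "\<mu> = P / S"
    have \<mu>: "\<mu> > 0" using Ppos Spos by (simp add: \<mu>_def)
    have tangent: "w x ^ r \<ge> \<mu> ^ r * (1 + r * (w x / \<mu> - 1))" if "x \<in> Y" for x
    proof -
      have "1 + r * (w x / \<mu> - 1) \<le> (1 + (w x / \<mu> - 1)) ^ r"
        using assms(2)[OF that] \<mu> by (intro Bernoulli_inequality) simp
      then have "\<mu> ^ r * (1 + r * (w x / \<mu> - 1)) \<le> \<mu> ^ r * (w x / \<mu>) ^ r"
        using \<mu> by (intro mult_left_mono) auto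
      then show ?thesis using \<mu> by (simp add: power_divide)
    qed
    have "S * \<mu> ^ r = (\<Sum>x\<in>Y. \<nu> x * (\<mu> ^ r * (1 + r * (w x / \<mu> - 1))))"
    proof -
      have "(\<Sum>x\<in>Y. \<nu> x * (\<mu> ^ r * (1 + r * (w x / \<mu> - 1))))
          = (\<Sum>x\<in>Y. \<mu> ^ r * ((1 - real r) * \<nu> x + (r / \<mu>) * (\<nu> x * w x)))"
        by (intro sum.cong refl) (simp add: algebra_simps)
      also have "\<dots> = \<mu> ^ r * ((1 - real r) * S + (r / \<mu>) * P)"
        by (simp only: sum_distrib_left[symmetric] sum.distrib S_def P_def)
      also have "(r / \<mu>) * P = r * S" using Spos Ppos by (simp add: \<mu>_def)
      finally show ?thesis by (simp add: algebra_simps)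
    qed
    also have "\<dots> \<le> (\<Sum>x\<in>Y. \<nu> x * w x ^ r)"
      by (intro sum_mono mult_left_mono tangent assms)
    finally have "S ^ (r - 1) * (S * \<mu> ^ r) \<le> S ^ (r - 1) * (\<Sum>x\<in>Y. \<nu> x * w x ^ r)"
      using Spos by (intro mult_left_mono) auto
    moreover have "S ^ (r - 1) * (S * \<mu> ^ r) = P ^ r"
    proof -
      have "S ^ (r - 1) * S = S ^ r" using r by (cases r) auto
      then have "S ^ (r - 1) * (S * \<mu> ^ r) = (S * \<mu>) ^ r"
        by (simp only: mult.assoc[symmetric] power_mult_distrib)
      then show ?thesis using Spos by (simp add: \<mu>_def)
    qed
    ultimately show ?thesis by (simp only: S_def P_def)
  qed
qed

text \<open>
  The power mean inequality with weights \<open>\<nu>\<close>, followed by Cauchy-Schwarz.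
\<close>

lemma hoelder_second_moment:
  fixes \<nu> w :: "'x \<Rightarrow> real"
  assumes "\<And>x. x \<in> Y \<Longrightarrow> \<nu> x \<ge> 0" "\<And>x. x \<in> Y \<Longrightarrow> w x \<ge> 0" and r: "r \<ge> 1"
  shows "(\<Sum>x\<in>Y. \<nu> x * w x) ^ (2 * r)
    \<le> (\<Sum>x\<in>Y. \<nu> x) ^ (2 * r - 2) * ((\<Sum>x\<in>Y. \<nu> x ^ 2) * (\<Sum>x\<in>Y. w x ^ (2 * r)))"
proof -
  define S where "S = (\<Sum>x\<in>Y. \<nu> x)"
  have "(\<Sum>x\<in>Y. \<nu> x * w x) ^ (2 * r) = ((\<Sum>x\<in>Y. \<nu> x * w x) ^ r) ^ 2"
    by (simp add: power_mult[symmetric] mult.commute)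
  also have "\<dots> \<le> (S ^ (r - 1) * (\<Sum>x\<in>Y. \<nu> x * w x ^ r)) ^ 2"
    unfolding S_def using assms
    by (intro power_mono weighted_power_mean zero_le_power sum_nonneg mult_nonneg_nonneg) auto
  also have "\<dots> = S ^ (2 * r - 2) * (\<Sum>x\<in>Y. \<nu> x * w x ^ r) ^ 2"
  proof -
    have "(r - 1) * 2 = 2 * r - 2" by simp
    then show ?thesis by (simp only: power_mult_distrib power_mult[symmetric])
  qed
  also have "\<dots> \<le> S ^ (2 * r - 2) * ((\<Sum>x\<in>Y. \<nu> x ^ 2) * (\<Sum>x\<in>Y. (w x ^ r) ^ 2))"
    using assms by (intro mult_left_mono Cauchy_Schwarz_ineq_sum) (auto simp: S_def intro!: sum_nonneg zero_le_power)
  finally show ?thesis by (simp add: S_def power_mult[symmetric] mult.commute)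
qed

section \<open>The trilinear sum\<close>

abbreviation index_box :: "nat \<Rightarrow> nat \<Rightarrow> nat \<Rightarrow> (nat \<times> nat \<times> nat) set" where
  "index_box A B C \<equiv> {1..A} \<times> {1..B} \<times> {1..C}"

text \<open>
  Given \<open>a, b, c'\<close>, both \<open>a'\<close> and \<open>b'\<close> divide \<open>a b c'\<close>, and then \<open>c\<close> is determined.
\<close>

lemma card_equal_ratios_le:
  assumes Z: "\<And>n. 1 \<le> n \<Longrightarrow> n \<le> A * B * C \<Longrightarrow> divisor_count n \<le> Z"
  shows "card {((a, b, c), (a', b', c')) \<in> index_box A B C \<times> index_box A B C. a * b * c' = a' * b' * c}
    \<le> A * B * C * Z\<^sup>2"
proof -
  define Q where "Q = {((a, b, c), (a', b', c')) \<in> index_box A B C \<times> index_box A B C. a * b * c' = a' * b' * c}"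
  define S where "S = (SIGMA t:index_box A B C. (case t of (a, b, c') \<Rightarrow>
     {d. d dvd a * b * c'} \<times> {d. d dvd a * b * c'}))"
  define \<phi> :: "(nat \<times> nat \<times> nat) \<times> (nat \<times> nat \<times> nat) \<Rightarrow> _"
    where "\<phi> = (\<lambda>((a, b, c), (a', b', c')). ((a, b, c'), (a', b')))"
  have "inj_on \<phi> Q" by (auto simp: inj_on_def Q_def \<phi>_def)
  moreover have "\<phi> ` Q \<subseteq> S" by (auto simp: Q_def \<phi>_def S_def)
  moreover have "finite S" unfolding S_def by (intro finite_SigmaI) auto
  ultimately have "card Q \<le> card S" by (rule card_inj_on_le)
  also have "card S = (\<Sum>t\<in>index_box A B C. case t of (a, b, c') \<Rightarrow> divisor_count (a * b * c') ^ 2)"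
    unfolding S_def by (subst card_SigmaI) (auto simp: card_cartesian_product power2_eq_square intro!: sum.cong)
  also have "\<dots> \<le> (\<Sum>t\<in>index_box A B C. Z\<^sup>2)"
    by (rule sum_mono) (auto intro!: power_mono Z mult_le_mono)
  also have "\<dots> = A * B * C * Z\<^sup>2" by simp
  finally show ?thesis by (simp only: Q_def)
qed

lemma sum_fibre_squares_eq:
  assumes "finite S" "finite Y" "f ` S \<subseteq> Y"
  shows "(\<Sum>y\<in>Y. card {s \<in> S. f s = y} ^ 2) = card {(s, s') \<in> S \<times> S. f s = f s'}"
proof -
  have "{(s, s') \<in> S \<times> S. f s = f s'} = (\<Union>y\<in>Y. {s \<in> S. f s = y} \<times> {s \<in> S. f s = y})"
    using assms(3) by auto
  also have "card \<dots> = (\<Sum>y\<in>Y. card ({s \<in> S. f s = y} \<times> {s \<in> S. f s = y}))"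
    using assms by (intro card_UN_disjoint) auto
  finally show ?thesis by (simp add: card_cartesian_product power2_eq_square)
qed

text \<open>
  The lower bound on a power of \<open>card \<D>\<close> makes both terms of \<open>moment_bound\<close> at most a constant
  times \<open>(card \<D>)\<^sup>2\<^sup>r \<surd>p\<close>. Since \<open>ABC \<ge> p\<^sup>1\<^sup>/\<^sup>2\<^sup>+\<^sup>\<epsilon>\<close>, the factor \<open>\<surd>p\<close> is at most \<open>ABC p\<^sup>-\<^sup>\<epsilon>\<close>, and the
  divisor bound gives back half of the saving \<open>p\<^sup>-\<^sup>\<epsilon>\<close>.
\<close>

lemma T_sum_power_bound:
  fixes p A B C :: nat and \<D> :: "int set" and \<alpha> :: "int \<Rightarrow> complex" and \<epsilon> C0 :: real
  assumes p: "prime p" and \<chi>: "dirichlet_character p \<chi>" "\<chi> \<noteq> principal_character p"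
    and pos: "A > 0" "B > 0" "C > 0" and less: "p > A * B * C"
    and large: "real (A * B * C) \<ge> real p powr (1 / 2 + \<epsilon>)"
    and D: "real (card \<D>) ^ r \<ge> sqrt p" and D_sub: "\<D> \<subseteq> {1..int p - 1}"
    and \<alpha>: "\<And>d. d \<in> \<D> \<Longrightarrow> cmod (\<alpha> d) \<le> 1" and r: "r \<ge> 1" and \<epsilon>: "\<epsilon> > 0"
    and C0: "C0 \<ge> 1" "\<And>n. n \<ge> 1 \<Longrightarrow> divisor_count n \<le> C0 * real n powr (\<epsilon> / 4)"
  shows "T_sum \<chi> A B C \<D> \<alpha> ^ (2 * r) \<le>
    (real (A * B * C * card \<D>)) ^ (2 * r) * (C0\<^sup>2 * (real (r ^ (2 * r)) + 2 * real r)) * p powr (- \<epsilon> / 2)"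
proof -
  define N where "N = A * B * C"
  define W where "W x = (\<Sum>d\<in>\<D>. \<alpha> d * \<chi> (x - d))" for x
  define S where "S = index_box A B C"
  have C_less: "C < p"
  proof -
    have "1 * C \<le> (A * B) * C" using pos by (intro mult_le_mono1) (simp add: Suc_le_eq)
    then show ?thesis using less unfolding mult_1 by (rule le_less_trans)
  qed
  have ndvd: "\<not> int p dvd int c" if "c \<in> {1..C}" for c
    using that C_less by (auto simp: int_dvd_int_iff dest: dvd_imp_le)
  have "\<exists>y. [int c * y = 1] (mod int p)" if "c \<in> {1..C}" for c
    using ndvd[OF that] p prime_imp_coprime[of "int p" "int c"]
    by (intro cong_solve_coprime_int) (simp add: coprime_commute)
  then obtain iv where iv: "\<And>c. c \<in> {1..C} \<Longrightarrow> [int c * iv c = 1] (mod int p)" by metis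
  define f where "f = (\<lambda>(a, b, c). (int a * int b * iv c) mod int p)"
  have cf: "[int c * f (a, b, c) = int a * int b] (mod int p)" if "c \<in> {1..C}" for a b c
  proof -
    have "[int c * f (a, b, c) = int c * (int a * int b * iv c)] (mod int p)"
      by (simp add: f_def cong_def mod_simps)
    also have "int c * (int a * int b * iv c) = int a * int b * (int c * iv c)" by (simp add: mult_ac)
    also have "[int a * int b * (int c * iv c) = int a * int b * 1] (mod int p)"
      by (intro cong_mult cong_refl iv that)
    finally show ?thesis by simp
  qed
  define \<nu> where "\<nu> x = real (card {t \<in> S. f t = x})" for x
  have finS: "finite S" by (simp add: S_def)
  have fS: "f ` S \<subseteq> {0..<int p}" using prime_gt_0_nat[OF p] by (auto simp: f_def)

  have T_eq: "T_sum \<chi> A B C \<D> \<alpha> = (\<Sum>x\<in>{0..<int p}. \<nu> x * cmod (W x))"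
  proof -
    have "T_sum \<chi> A B C \<D> \<alpha> = (\<Sum>(a, b, c)\<in>S.
        cmod (\<Sum>d\<in>\<D>. \<alpha> d * \<chi> (int a * int b - int c * d)))"
      by (simp add: T_sum_def S_def sum.cartesian_product)
    also have "\<dots> = (\<Sum>t\<in>S. cmod (W (f t)))"
    proof (rule sum.cong[OF refl], clarify)
      fix a b c assume "(a, b, c) \<in> S"
      then have c: "c \<in> {1..C}" by (simp add: S_def)
      have "\<chi> (int a * int b - int c * d) = \<chi> (int c) * \<chi> (f (a, b, c) - d)" for d
      proof -
        have "[int c * (f (a, b, c) - d) = int a * int b - int c * d] (mod int p)"
          unfolding right_diff_distrib by (intro cong_diff cf c cong_refl)
        then show ?thesis
          using character_periodic[OF \<chi>(1)] character_mult[OF p \<chi>(1)] by metis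
      qed
      then have "(\<Sum>d\<in>\<D>. \<alpha> d * \<chi> (int a * int b - int c * d)) = \<chi> (int c) * W (f (a, b, c))"
        by (simp add: W_def sum_distrib_left mult_ac)
      then show "cmod (\<Sum>d\<in>\<D>. \<alpha> d * \<chi> (int a * int b - int c * d)) = cmod (W (f (a, b, c)))"
        using norm_character[OF p \<chi>(1), of "int c"] ndvd[OF c] by (simp add: norm_mult)
    qed
    also have "\<dots> = (\<Sum>x\<in>{0..<int p}. \<Sum>t\<in>{t \<in> S. f t = x}. cmod (W (f t)))"
      by (rule sum.group[symmetric]) (use finS fS in auto)
    also have "\<dots> = (\<Sum>x\<in>{0..<int p}. \<nu> x * cmod (W x))"
      by (intro sum.cong refl) (simp add: \<nu>_def)
    finally show ?thesis .
  qed

  have sum_\<nu>: "(\<Sum>x\<in>{0..<int p}. \<nu> x) = N"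
  proof -
    have "(\<Sum>x\<in>{0..<int p}. card {t \<in> S. f t = x}) = (\<Sum>x\<in>{0..<int p}. \<Sum>t\<in>{t \<in> S. f t = x}. 1)"
      by simp
    also have "\<dots> = (\<Sum>t\<in>S. 1)" by (rule sum.group) (use finS fS in auto)
    also have "\<dots> = N" by (simp add: S_def N_def)
    finally show ?thesis unfolding \<nu>_def of_nat_sum[symmetric] by simp
  qed

  have sum_\<nu>2: "(\<Sum>x\<in>{0..<int p}. \<nu> x ^ 2) \<le> N * (C0\<^sup>2 * p powr (\<epsilon> / 2))"
  proof -
    define Z where "Z = nat \<lfloor>C0 * real p powr (\<epsilon> / 4)\<rfloor>"
    have p1: "real p \<ge> 1" using prime_ge_1_nat[OF p] by simp
    have Z: "divisor_count n \<le> Z" if "1 \<le> n" "n \<le> A * B * C" for n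
    proof -
      have "real (divisor_count n) \<le> C0 * real n powr (\<epsilon> / 4)" by (rule C0(2)[OF that(1)])
      also have "\<dots> \<le> C0 * real p powr (\<epsilon> / 4)"
        using that less C0 \<epsilon> by (intro mult_left_mono powr_mono2) auto
      finally show ?thesis by (simp add: Z_def le_nat_floor)
    qed
    have "(\<Sum>x\<in>{0..<int p}. card {t \<in> S. f t = x} ^ 2) = card {(s, s') \<in> S \<times> S. f s = f s'}"
      by (rule sum_fibre_squares_eq[OF finS _ fS]) simp
    also have "\<dots> \<le> card {((a, b, c), (a', b', c')) \<in> S \<times> S. a * b * c' = a' * b' * c}"
    proof (rule card_mono)
      show "finite {((a, b, c), (a', b', c')) \<in> S \<times> S. a * b * c' = a' * b' * c}"
        by (rule finite_subset[of _ "S \<times> S"]) (use finS in auto)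
      show "{(s, s') \<in> S \<times> S. f s = f s'} \<subseteq> {((a, b, c), (a', b', c')) \<in> S \<times> S. a * b * c' = a' * b' * c}"
      proof
        fix y assume y: "y \<in> {(s, s') \<in> S \<times> S. f s = f s'}"
        obtain a b c a' b' c' where y_eq: "y = ((a, b, c), (a', b', c'))" by (metis surj_pair)
        have S: "(a, b, c) \<in> S" "(a', b', c') \<in> S" and eq: "f (a, b, c) = f (a', b', c')"
          using y by (simp_all add: y_eq)
        have c: "c \<in> {1..C}" "c' \<in> {1..C}" using S by (auto simp: S_def)
        have "[int a * int b * int c' = int c * f (a, b, c) * int c'] (mod int p)"
          by (intro cong_mult cong_refl cong_sym[OF cf] c)
        also have "int c * f (a, b, c) * int c' = int c' * f (a', b', c') * int c"
          by (simp add: eq mult_ac)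
        also have "[int c' * f (a', b', c') * int c = int a' * int b' * int c] (mod int p)"
          by (intro cong_mult cong_refl cf c)
        finally have "[a * b * c' = a' * b' * c] (mod p)" by (simp flip: cong_int_iff)
        moreover have "a * b * c' < p" "a' * b' * c < p"
          using S less by (auto simp: S_def intro!: le_less_trans[OF _ less] mult_le_mono)
        ultimately have "a * b * c' = a' * b' * c" by (simp add: cong_def)
        then show "y \<in> {((a, b, c), (a', b', c')) \<in> S \<times> S. a * b * c' = a' * b' * c}"
          using S by (simp add: y_eq)
      qed
    qed
    also have "\<dots> \<le> A * B * C * Z\<^sup>2"
      unfolding S_def by (rule card_equal_ratios_le[OF Z])
    finally have "(\<Sum>x\<in>{0..<int p}. card {t \<in> S. f t = x} ^ 2) \<le> N * Z\<^sup>2" by (simp add: N_def)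
    then have "real (\<Sum>x\<in>{0..<int p}. card {t \<in> S. f t = x} ^ 2) \<le> real (N * Z\<^sup>2)"
      by (rule of_nat_mono)
    then have "(\<Sum>x\<in>{0..<int p}. \<nu> x ^ 2) \<le> N * real Z ^ 2" by (simp add: \<nu>_def)
    also have "\<dots> \<le> N * (C0 * real p powr (\<epsilon> / 4)) ^ 2"
      using C0 by (intro mult_left_mono power_mono) (auto simp: Z_def)
    also have "(C0 * real p powr (\<epsilon> / 4)) ^ 2 = C0\<^sup>2 * real p powr (\<epsilon> / 2)"
    proof -
      have "(real p powr (\<epsilon> / 4)) ^ 2 = real p powr (\<epsilon> / 4 + \<epsilon> / 4)"
        by (simp only: power2_eq_square powr_add)
      then show ?thesis by (simp add: power_mult_distrib)
    qed
    finally show ?thesis .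
  qed

  define Dn where "Dn = real (card \<D>)"
  define K where "K = real (r ^ (2 * r)) + 2 * real r"
  have sum_W: "(\<Sum>x\<in>{0..<int p}. cmod (W x) ^ (2 * r)) \<le> Dn ^ (2 * r) * (sqrt p * K)"
  proof -
    have "(\<Sum>x\<in>{0..<int p}. cmod (W x) ^ (2 * r))
      \<le> real (r ^ (2 * r)) * Dn ^ r * p + Dn ^ (2 * r) * (2 * real r * sqrt p)"
      unfolding W_def Dn_def by (rule moment_bound[OF p \<chi> D_sub \<alpha> r])
    also have "real (r ^ (2 * r)) * Dn ^ r * p = real (r ^ (2 * r)) * Dn ^ r * sqrt p * sqrt p"
      by simp
    also have "\<dots> \<le> real (r ^ (2 * r)) * Dn ^ r * Dn ^ r * sqrt p"
      using D by (intro mult_right_mono mult_left_mono) (auto simp: Dn_def)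
    also have "\<dots> = Dn ^ (2 * r) * (real (r ^ (2 * r)) * sqrt p)"
    proof -
      have "Dn ^ (2 * r) = Dn ^ r * Dn ^ r" by (simp only: mult_2 power_add)
      then show ?thesis by (simp only: mult.assoc mult.commute mult.left_commute)
    qed
    finally show ?thesis by (simp add: K_def algebra_simps)
  qed

  have sqrt_p: "sqrt p \<le> N * p powr (- \<epsilon>)"
  proof -
    have "sqrt p = p powr (1 / 2 + \<epsilon>) * p powr (- \<epsilon>)"
      by (simp add: powr_half_sqrt flip: powr_add)
    also have "\<dots> \<le> N * p powr (- \<epsilon>)"
      using large by (intro mult_right_mono) (auto simp: N_def)
    finally show ?thesis .
  qed
  have N0: "N > 0" using pos by (simp add: N_def)
  have K0: "K \<ge> 0" by (simp add: K_def)

  have "T_sum \<chi> A B C \<D> \<alpha> ^ (2 * r)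
      \<le> real N ^ (2 * r - 2) * ((\<Sum>x\<in>{0..<int p}. \<nu> x ^ 2) * (\<Sum>x\<in>{0..<int p}. cmod (W x) ^ (2 * r)))"
    unfolding T_eq sum_\<nu>[symmetric] by (rule hoelder_second_moment) (use r in \<open>auto simp: \<nu>_def\<close>)
  also have "\<dots> \<le> real N ^ (2 * r - 2) * ((N * (C0\<^sup>2 * p powr (\<epsilon> / 2))) * (Dn ^ (2 * r) * (N * p powr (- \<epsilon>) * K)))"
  proof (intro mult_left_mono mult_mono sum_\<nu>2)
    have "Dn ^ (2 * r) * (sqrt p * K) \<le> Dn ^ (2 * r) * (N * p powr (- \<epsilon>) * K)"
      using sqrt_p K0 by (intro mult_left_mono mult_right_mono) (auto simp: Dn_def)
    then show "(\<Sum>x\<in>{0..<int p}. cmod (W x) ^ (2 * r)) \<le> Dn ^ (2 * r) * (N * p powr (- \<epsilon>) * K)"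
      using sum_W by linarith
  qed (auto intro!: sum_nonneg)
  also have "\<dots> = (real N ^ (2 * r - 2) * N * N) * Dn ^ (2 * r) * (C0\<^sup>2 * K) * (p powr (\<epsilon> / 2) * p powr (- \<epsilon>))"
    by (simp only: mult_ac)
  also have "real N ^ (2 * r - 2) * N * N = real N ^ (2 * r)"
  proof -
    have "2 * r = Suc (Suc (2 * r - 2))" using r by simp
    then have "real N ^ (2 * r) = real N ^ Suc (Suc (2 * r - 2))" by (rule arg_cong)
    then show ?thesis by (simp only: power_Suc mult_ac)
  qed
  also have "p powr (\<epsilon> / 2) * p powr (- \<epsilon>) = p powr (- \<epsilon> / 2)"
    by (simp flip: powr_add)
  finally show ?thesis
    by (simp add: N_def Dn_def K_def power_mult_distrib mult_ac)
qed

theorem corollary1p6: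
  shows "\<exists>c::real. c > 0 \<and>
    (\<forall>\<epsilon>::real. \<epsilon> > 0 \<longrightarrow>
      (\<exists>K::real. K > 0 \<and>
        (\<forall>(p::nat) (\<chi> :: int \<Rightarrow> complex) (A::nat) (B::nat) (C::nat) (D::nat)
           (\<D> :: int set) (\<alpha> :: int \<Rightarrow> complex).
           prime p \<longrightarrow>
           dirichlet_character p \<chi> \<longrightarrow>
           \<chi> \<noteq> principal_character p \<longrightarrow>
           A > 0 \<longrightarrow> B > 0 \<longrightarrow> C > 0 \<longrightarrow> D > 0 \<longrightarrow>
           p > A * B * C \<longrightarrow>
           real (A * B * C) \<ge> real p powr (1 / 2 + \<epsilon>) \<longrightarrow>
           real D \<ge> real p powr \<epsilon> \<longrightarrow>
           \<D> \<subseteq> {1..int p - 1} \<longrightarrow>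
           card \<D> = D \<longrightarrow>
           (\<forall>d\<in>\<D>. cmod (\<alpha> d) \<le> 1) \<longrightarrow>
           T_sum \<chi> A B C \<D> \<alpha> \<le> K * real (A * B * C * D) * real p powr (- c * \<epsilon>\<^sup>2))))"
proof (rule exI[of _ "1 / 4"], intro conjI allI impI)
  fix \<epsilon> :: real assume \<epsilon>: "\<epsilon> > 0"
  obtain C0 where C0: "C0 \<ge> 1" "\<And>n. n \<ge> 1 \<Longrightarrow> divisor_count n \<le> C0 * real n powr (\<epsilon> / 4)"
    using divisor_bound[of "\<epsilon> / 4"] \<epsilon> by auto
  (* the least r with eps * r \<ge> 1/2; as eps < 1/2 below, also eps * r \<le> 1 *)
  define r where "r = nat \<lceil>1 / (2 * \<epsilon>)\<rceil>"
  define K where "K = C0\<^sup>2 * (real (r ^ (2 * r)) + 2 * real r)"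
  have r1: "r \<ge> 1" using \<epsilon> by (simp add: r_def Suc_le_eq)
  have r_ge: "real r \<ge> 1 / (2 * \<epsilon>)" unfolding r_def by linarith
  have "1 / (2 * \<epsilon>) > 0" using \<epsilon> by simp
  then have r_le: "real r \<le> 1 / (2 * \<epsilon>) + 1" unfolding r_def by linarith
  have K1: "K \<ge> 1"
  proof -
    have "1 * 1 \<le> C0\<^sup>2 * (real (r ^ (2 * r)) + 2 * real r)"
      using C0(1) r1 by (intro mult_mono one_le_power) (auto intro: add_increasing)
    then show ?thesis by (simp add: K_def)
  qed
  show "\<exists>K::real. K > 0 \<and>
        (\<forall>(p::nat) (\<chi> :: int \<Rightarrow> complex) (A::nat) (B::nat) (C::nat) (D::nat)
           (\<D> :: int set) (\<alpha> :: int \<Rightarrow> complex).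
           prime p \<longrightarrow>
           dirichlet_character p \<chi> \<longrightarrow>
           \<chi> \<noteq> principal_character p \<longrightarrow>
           A > 0 \<longrightarrow> B > 0 \<longrightarrow> C > 0 \<longrightarrow> D > 0 \<longrightarrow>
           p > A * B * C \<longrightarrow>
           real (A * B * C) \<ge> real p powr (1 / 2 + \<epsilon>) \<longrightarrow>
           real D \<ge> real p powr \<epsilon> \<longrightarrow>
           \<D> \<subseteq> {1..int p - 1} \<longrightarrow>
           card \<D> = D \<longrightarrow>
           (\<forall>d\<in>\<D>. cmod (\<alpha> d) \<le> 1) \<longrightarrow>
           T_sum \<chi> A B C \<D> \<alpha> \<le> K * real (A * B * C * D) * real p powr (- (1 / 4) * \<epsilon>\<^sup>2))"
  proof (intro exI[of _ K] conjI allI impI)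
    show "K > 0" using K1 by simp
    fix p :: nat and \<chi> :: "int \<Rightarrow> complex" and A B C D :: nat and \<D> :: "int set" and \<alpha> :: "int \<Rightarrow> complex"
    assume p: "prime p" and \<chi>: "dirichlet_character p \<chi>" "\<chi> \<noteq> principal_character p"
      and pos: "A > 0" "B > 0" "C > 0" and D0: "D > 0" and less: "p > A * B * C"
      and large: "real (A * B * C) \<ge> real p powr (1 / 2 + \<epsilon>)"
      and D: "real D \<ge> real p powr \<epsilon>" and D_sub: "\<D> \<subseteq> {1..int p - 1}" and card_D: "card \<D> = D"
      and \<alpha>: "\<forall>d\<in>\<D>. cmod (\<alpha> d) \<le> 1"
    have p1: "real p > 1" using prime_gt_1_nat[OF p] by simp
    have "real (A * B * C) < real p powr 1" using less p1 by (simp only: of_nat_less_iff powr_one)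
    then have "real p powr (1 / 2 + \<epsilon>) < real p powr 1" using large by (rule le_less_trans[rotated])
    then have "1 / 2 + \<epsilon> < 1" by (simp only: powr_less_cancel_iff[OF p1])
    then have \<epsilon>_half: "\<epsilon> < 1 / 2" by simp
    have \<epsilon>r_ge: "1 / 2 \<le> \<epsilon> * r" using mult_left_mono[OF r_ge, of \<epsilon>] \<epsilon> by simp
    have \<epsilon>r_le: "\<epsilon> * r \<le> 1"
      using mult_left_mono[OF r_le, of \<epsilon>] \<epsilon> \<epsilon>_half by (simp add: distrib_left)
    have "sqrt p = p powr (1 / 2)" using p1 by (simp add: powr_half_sqrt)
    also have "\<dots> \<le> p powr (\<epsilon> * r)" using \<epsilon>r_ge p1 by (intro powr_mono) auto
    also have "\<dots> = (p powr \<epsilon>) ^ r" using p1 by (simp add: powr_powr flip: powr_realpow)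
    also have "\<dots> \<le> real D ^ r" using D by (intro power_mono) auto
    finally have Dr: "real (card \<D>) ^ r \<ge> sqrt p" by (simp add: card_D)
    define M where "M = real (A * B * C * D)"
    have "T_sum \<chi> A B C \<D> \<alpha> ^ (2 * r) \<le> M ^ (2 * r) * K * p powr (- \<epsilon> / 2)"
      using T_sum_power_bound[OF p \<chi> pos less large Dr D_sub _ r1 \<epsilon> C0] \<alpha>
      by (simp add: M_def K_def card_D)
    also have "\<dots> \<le> M ^ (2 * r) * K ^ (2 * r) * (p powr (- (1 / 4) * \<epsilon>\<^sup>2)) ^ (2 * r)"
    proof (intro mult_mono mult_left_mono)
      show "K \<le> K ^ (2 * r)" using K1 r1 by (intro self_le_power) auto
      have "\<epsilon> * (\<epsilon> * r) \<le> \<epsilon> * 1" using \<epsilon>r_le \<epsilon> by (intro mult_left_mono) auto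
      then have "- \<epsilon> / 2 \<le> - (1 / 4) * \<epsilon>\<^sup>2 * real (2 * r)"
        by (simp add: power2_eq_square)
      then have "p powr (- \<epsilon> / 2) \<le> p powr (- (1 / 4) * \<epsilon>\<^sup>2 * real (2 * r))"
        using p1 by (intro powr_mono) auto
      also have "\<dots> = (p powr (- (1 / 4) * \<epsilon>\<^sup>2)) powr real (2 * r)" by (simp only: powr_powr)
      also have "\<dots> = (p powr (- (1 / 4) * \<epsilon>\<^sup>2)) ^ (2 * r)" using p1 by (subst powr_realpow) auto
      finally show "p powr (- \<epsilon> / 2) \<le> (p powr (- (1 / 4) * \<epsilon>\<^sup>2)) ^ (2 * r)" .
    qed (use K1 in \<open>auto simp: M_def\<close>)
    also have "\<dots> = (K * M * p powr (- (1 / 4) * \<epsilon>\<^sup>2)) ^ (2 * r)"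
      by (simp only: power_mult_distrib mult_ac)
    finally have le: "T_sum \<chi> A B C \<D> \<alpha> ^ (2 * r)
      \<le> (K * M * p powr (- (1 / 4) * \<epsilon>\<^sup>2)) ^ (2 * r)" .
    obtain n where n: "2 * r = Suc n" using r1 by (cases "2 * r") auto
    have "T_sum \<chi> A B C \<D> \<alpha> \<le> K * M * p powr (- (1 / 4) * \<epsilon>\<^sup>2)"
      by (rule power_le_imp_le_base[OF le[unfolded n]]) (use K1 in \<open>auto simp: M_def\<close>)
    then show "T_sum \<chi> A B C \<D> \<alpha> \<le> K * real (A * B * C * D) * real p powr (- (1 / 4) * \<epsilon>\<^sup>2)"
      by (simp only: M_def)
  qed
qed simp

end
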